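(* Let $x,y,z$ be non-negative integers and $\mathbf{a}=(a_1,\dots,a_n)$ a sequence of positive integers with $y+2\operatorname{O}(\mathbf{a})\ge a_1+1$. Write $s=\mathbf{s}_n(\mathbf{a})$, $E=\operatorname{E}(\mathbf{a})$, $O=\operatorname{O}(\mathbf{a})$, and set $a_k:=0$ for $k>n$. If $y$ is odd, then \[ \operatorname{M}(\mathcal{R}_{x,y,z}(\mathbf{a}))=\prod_{i=1}^{\frac{y-1}{2}}(2x+2i)_{2s+2y+2z-4i+1}\cdot\frac{1}{2^{y-1}}\frac{\operatorname{H}(s+y+z-1)\operatorname{H}_2(y)\operatorname{H}_2(2E+2z+1)\operatorname{H}_2(2O+1)\operatorname{H}_2(2s+y+2z)}{\operatorname{H}(s+z)\operatorname{H}_2(2E+y+2z)\operatorname{H}_2(2O+y)\operatorname{H}_2(2s+2y+2z-1)} \] \[ \times\operatorname{Q}\Big(x+\tfrac{y-1}{2}+a_{2\lfloor\frac{n+1}{2}\rfloor},a_{2\lfloor\frac{n+1}{2}\rfloor-1},\dots,a_1\Big)\operatorname{Q}\Big(x+\tfrac{y-1}{2}+a_{2\lfloor\frac{n}{2}\rfloor+1},a_{2\lfloor\frac{n}{2}\rfloor},\dots,a_1,z\Big), \] and if $y$ is even, then \[ \operatorname{M}(\mathcal{R}_{x,y,z}(\mathbf{a}))=\prod_{i=1}^{\frac{y}{2}}(2x+2i)_{2s+2y+2z-4i+1}\cdot\frac{\operatorname{H}(s+y+z)\operatorname{H}_2(y)\operatorname{H}_2(2E+2z)\operatorname{H}_2(2O)\operatorname{H}_2(2s+y+2z)}{\operatorname{H}(s+z)\operatorname{H}_2(2E+y+2z)\operatorname{H}_2(2O+y)\operatorname{H}_2(2s+2y+2z)}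 \] \[ \times\operatorname{K}\Big(x+\tfrac{y}{2}+a_{2\lfloor\frac{n+1}{2}\rfloor},a_{2\lfloor\frac{n+1}{2}\rfloor-1},\dots,a_1\Big)\operatorname{K}\Big(x+\tfrac{y}{2}+a_{2\lfloor\frac{n}{2}\rfloor+1},a_{2\lfloor\frac{n}{2}\rfloor},\dots,a_1,z\Big). \] Empty products are $1$.
   Context: Work on the triangular lattice drawn with horizontal lattice lines; unit triangles are up- or down-pointing. A lozenge is the union of two unit triangles sharing an edge; a tiling of a region is a covering by lozenges without gaps or overlaps; $\operatorname{M}(R)$ is the number of tilings of $R$ (or, for weighted lozenges, the sum over tilings of the product of lozenge weights). A vertical lozenge is the union of an up- and a down-pointing unit triangle sharing a horizontal edge. A "vertical zigzag western side with $N$ unit segments": from the north-west corner, the western boundary consists of $N$ unit segments alternately in the south-west and south-east directions, the first going south-west. "Weighting the western vertical lozenges by $\frac12$": for each $i$, the vertical lozenge formed by the leftmost unit triangle of row $2i-1$ and that of row $2i$ (rows counted from the top) gets weight $\frac12$, all others weight $1$. For a sequence $\mathbf{b}=(b_1,\dots,b_m)$: $\operatorname{E}(\mathbf{b})=\sum_{i\text{ even}}b_i$, $\operatorname{O}(\mathbf{b})=\sum_{i\text{ odd}}b_i$, $\mathbf{s}_k(\mathbf{b})=\sum_{i\le k}b_i$. $\operatorname{H}(n)=0!\,1!\cdots(n-1)!$; $\operatorname{H}_2(n)=0!\,2!\cdots(n-2)!$ for even $n$ and $1!\,3!\cdots(n-2)!$ for odd $n$ (empty products $=1$). Pochhammer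 symbol: $(u)_m=u(u+1)\cdots(u+m-1)$ for $m>0$, $(u)_0=1$, $(u)_m=1/((u-1)(u-2)\cdots(u+m))$ for $m<0$. $\mathcal{Q}(\mathbf{t})$, for $\mathbf{t}=(t_1,\dots,t_{2l})$ non-negative: region with northern side $\operatorname{O}(\mathbf{t})$, straight northeastern side $2\operatorname{E}(\mathbf{t})$, southern side $\operatorname{E}(\mathbf{t})+\operatorname{O}(\mathbf{t})$, vertical zigzag western side with $2\operatorname{E}(\mathbf{t})$ unit segments; along the southern side from left to right, leave a segment $t_1$, remove the up-pointing triangle of side $t_2$ resting on the southern side, leave $t_3$, remove an up-pointing triangle of side $t_4$, etc. $\mathcal{K}(\mathbf{t})$: same but with northeastern side $2\operatorname{E}(\mathbf{t})-1$ and zigzag western side with $2\operatorname{E}(\mathbf{t})-1$ unit segments. $\operatorname{Q}(\mathbf{t})=\operatorname{M}(\mathcal{Q}(\mathbf{t}))$, $\operatorname{K}(\mathbf{t})=\operatorname{M}(\mathcal{K}(\mathbf{t}))$. $\mathcal{R}_{x,y,z}(\mathbf{a})$: start from the region with northern side $x+\operatorname{E}(\mathbf{a})$, northeastern side $y+z+2\operatorname{O}(\mathbf{a})-1$, southeastern side $y+z+2\operatorname{E}(\mathbf{a})-1$, southern side $x+\operatorname{O}(\mathbf{a})$, and vertical zigzag western side with $2(y+z+\mathbf{s}_n(\mathbf{a})-1)$ unit segments. Let $V$ be its eastern vertex (where the northeastern and southeastern sides meet), $\ell$ the horizontal lattice line $z$ units above $V$, and $P$ the point where $\ell$ meets the northeastern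 side. Going left from $P$ along $\ell$, mark consecutive segments of lengths $a_1,a_2,\dots,a_n$; remove the up-pointing triangle having the $i$-th segment as base for odd $i$, and the down-pointing triangle having the $i$-th segment as its top side for even $i$ (so the triangle of side $a_1$ has its right side on the northeastern side). The result is $\mathcal{R}_{x,y,z}(\mathbf{a})$ (unweighted). *)

theory Defs
  imports Complex_Main "HOL-Library.Disjoint_Sets"
begin

text \<open>A sequence \<open>b\<^sub>1, \<dots>, b\<^sub>m\<close> is a list of naturals; indices are 1-based, and entries beyond
  the length are read as 0.\<close>

definition entry :: "nat list \<Rightarrow> nat \<Rightarrow> nat" where
  "entry b k = (if 1 \<le> k \<and> k \<le> length b then b ! (k - 1) else 0)"

definition even_sum :: "nat list \<Rightarrow> nat" where
  "even_sum b = (\<Sum>i | i \<in> {1..length b} \<and> even i. entry b i)"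

definition odd_sum :: "nat list \<Rightarrow> nat" where
  "odd_sum b = (\<Sum>i | i \<in> {1..length b} \<and> odd i. entry b i)"

definition part_sum :: "nat list \<Rightarrow> nat \<Rightarrow> nat" where
  "part_sum b k = (\<Sum>i=1..k. entry b i)"

definition hyper :: "nat \<Rightarrow> nat" where
  "hyper n = (\<Prod>k<n. fact k)"

text \<open>The factorials run over all \<open>k \<le> n - 2\<close> with the parity of \<open>n\<close>, that is
  \<open>k = 2 * j + n mod 2\<close> with \<open>j < n div 2\<close>.\<close>

definition hyper2 :: "nat \<Rightarrow> nat" where
  "hyper2 n = (\<Prod>j<n div 2. fact (2 * j + n mod 2))"

text \<open>
  Every region below has its north-west corner at the origin. A lattice point is written
  \<open>(X, d)\<close>: \<open>d\<close> is the number of lattice rows below the origin and \<open>X\<close> is the horizontal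
  position measured in half units, so \<open>X \<equiv> d (mod 2)\<close>. A unit step east is \<open>(+2, 0)\<close>,
  south-east is \<open>(+1, +1)\<close> and south-west is \<open>(-1, +1)\<close>.

  The pair \<open>(r, c)\<close> stands for the unit triangle lying between depths \<open>r\<close> and \<open>r + 1\<close> that is
  symmetric about the vertical line \<open>X = c\<close>. If \<open>r + c\<close> is even it is up-pointing, with apex
  \<open>(c, r)\<close> and base from \<open>(c - 1, r + 1)\<close> to \<open>(c + 1, r + 1)\<close>; if \<open>r + c\<close> is odd it is
  down-pointing, with top side from \<open>(c - 1, r)\<close> to \<open>(c + 1, r)\<close> and apex \<open>(c, r + 1)\<close>. Every
  unit triangle of the lattice is represented by exactly one pair of integers.

  Two unit triangles share a non-horizontal edge iff they are consecutive in a row. They share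
  a horizontal edge iff they are \<open>(r, c)\<close> and \<open>(r + 1, c)\<close> with \<open>r + c\<close> even.
\<close>

type_synonym unit_triangle = "int \<times> int"
type_synonym region = "unit_triangle set"

definition is_lozenge :: "region \<Rightarrow> bool" where
  "is_lozenge L \<longleftrightarrow>
     (\<exists>r c. L = {(r, c), (r, c + 1)} \<or> (even (r + c) \<and> L = {(r, c), (r + 1, c)}))"

definition is_tiling :: "region \<Rightarrow> region set \<Rightarrow> bool" where
  "is_tiling R T \<longleftrightarrow> partition_on R T \<and> (\<forall>L\<in>T. is_lozenge L)"

definition num_tilings :: "region \<Rightarrow> nat" where
  "num_tilings R = card {T. is_tiling R T}"

text \<open>The up-pointing triangle of side \<open>t\<close> whose base runs from \<open>(X, d)\<close> to \<open>(X + 2 * t, d)\<close>,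
  and the down-pointing triangle with that segment as its top side.\<close>

definition up_triangle :: "int \<Rightarrow> int \<Rightarrow> int \<Rightarrow> region" where
  "up_triangle X d t = {(r, c). r < d \<and> X + (d - r) \<le> c \<and> c \<le> X + 2 * t - (d - r)}"

definition down_triangle :: "int \<Rightarrow> int \<Rightarrow> int \<Rightarrow> region" where
  "down_triangle X d t =
     {(r, c). d \<le> r \<and> X + (r + 1 - d) \<le> c \<and> c \<le> X + 2 * t - (r + 1 - d)}"

text \<open>
  The zigzag western boundary passes through \<open>(- (d mod 2), d)\<close> at each depth \<open>d\<close>, so the
  unit triangles to its right are exactly those with \<open>c \<ge> 0\<close>. The northeastern side from
  \<open>(2 * odd_sum t, 0)\<close> passes through \<open>(2 * odd_sum t + d, d)\<close>, so the last unit triangle of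
  row \<open>r\<close> is the up-pointing one with \<open>c = 2 * odd_sum t + r\<close>. The southern side lies at depth
  \<open>h\<close> and starts at \<open>X = - (h mod 2)\<close>. The region is empty if \<open>h \<le> 0\<close>.
\<close>

definition dented_quarter :: "int \<Rightarrow> nat list \<Rightarrow> region" where
  "dented_quarter h t =
     {(r, c). 0 \<le> r \<and> r < h \<and> 0 \<le> c \<and> c \<le> 2 * int (odd_sum t) + r}
     - (\<Union>i \<in> {i. i \<in> {1..length t} \<and> even i}.
          up_triangle (2 * int (part_sum t (i - 1)) - h mod 2) h (int (entry t i)))"

definition Q_region :: "nat list \<Rightarrow> region" where
  "Q_region t = dented_quarter (2 * int (even_sum t)) t"

definition K_region :: "nat list \<Rightarrow> region" where
  "K_region t = dented_quarter (2 * int (even_sum t) - 1) t"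

definition Q_num :: "nat list \<Rightarrow> nat" where
  "Q_num t = num_tilings (Q_region t)"

definition K_num :: "nat list \<Rightarrow> nat" where
  "K_num t = num_tilings (K_region t)"

text \<open>
  With \<open>N\<close> the length of the northern side, \<open>v\<close> that of the northeastern side and \<open>h\<close> the number
  of zigzag segments, the eastern vertex is \<open>V = (2 * N + v, v)\<close>. The northeastern side bounds
  \<open>c\<close> by \<open>2 * N + r\<close>; the southeastern side passes through \<open>(2 * N + 2 * v - d, d)\<close>, and the last
  unit triangle of a row \<open>r \<ge> v\<close> is the down-pointing one with \<open>c = 2 * N + 2 * v - r - 1\<close>.
  For \<open>r < v\<close> the second bound is implied by the first, and for \<open>r \<ge> v\<close> the first by the second.
  The southeastern side has length \<open>h - v = y + z + 2 * even_sum a - 1\<close>, so the southern side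
  runs from \<open>X = 0\<close> to \<open>X = 2 * (x + odd_sum a)\<close>.
  (For \<open>y = z = 0\<close> and \<open>n = 1\<close> this length is \<open>-1\<close>: there are then \<open>h = v - 1\<close> rows, all
  bounded by the northeastern side, and the removed triangle is clipped to them.)

  The line along which the triangles are removed has depth \<open>l = v - z\<close> and meets the
  northeastern side at \<open>P = (2 * N + l, l)\<close>; the \<open>i\<close>-th segment left of \<open>P\<close> has its left end at
  \<open>X = 2 * N + l - 2 * part_sum a i\<close>.
\<close>

definition R_region :: "nat \<Rightarrow> nat \<Rightarrow> nat \<Rightarrow> nat list \<Rightarrow> region" where
  "R_region x y z a =
     (let N = int x + int (even_sum a);
          v = int y + int z + 2 * int (odd_sum a) - 1;
          h = 2 * (int y + int z + int (part_sum a (length a)) - 1);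
          l = v - int z;
          left = (\<lambda>i. 2 * N + l - 2 * int (part_sum a i))
      in {(r, c). 0 \<le> r \<and> r < h \<and> 0 \<le> c \<and> c \<le> 2 * N + r \<and> c \<le> 2 * N + 2 * v - r - 1}
         - (\<Union>i \<in> {i. i \<in> {1..length a} \<and> odd i}. up_triangle (left i) l (int (entry a i)))
         - (\<Union>i \<in> {i. i \<in> {1..length a} \<and> even i}. down_triangle (left i) l (int (entry a i))))"

end

theory Submission
  imports Defs "Jordan_Normal_Form.Determinant"
begin

text \<open>
  Cut the region along the line \<open>\<ell>\<close> of the removed triangles. Above and below one is left with
  trapezoids with a zigzag western side and dents along one horizontal side; peeling off rows gives
  a sum over interlacing dents, which is evaluated with determinants: in terms of \<open>u = 2k + 2 - p\<close>
  for a dent in position \<open>k\<close> (with \<open>p\<close> the parity of the height), the number of tilings is a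
  constant times \<open>\<Prod> u\<^sub>i\<close> (only for \<open>p = 0\<close>) times \<open>\<Prod> (u\<^sub>j\<^sup>2 - u\<^sub>i\<^sup>2)\<close>.

  Let \<open>S\<close> be the set of free positions where a vertical lozenge crosses \<open>\<ell>\<close>. The dents forced by the
  fern are those of its up-pointing triangles for the upper half, and those of its down-pointing
  triangles and of the corner of side \<open>z\<close> for the lower half; together they fill an interval.
  Hence the factors that mix \<open>S\<close> with the fern depend only on that interval, and the sum over \<open>S\<close>
  depends only on \<open>x\<close>, \<open>y\<close> and \<open>s + z\<close>. It is therefore known from the region without a fern, which is
  a single trapezoid with a triangular dent.
\<close>

section \<open>Tilings by lozenges\<close>

text \<open>A Vandermonde product in \<open>u^2\<close> is, up to leading coefficients, the
  determinant of any polynomials of degrees 0, 1, 2, ... in \<open>u^2\<close>. Taking them from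
  \<open>(u + 1)^n - (u - 1)^n\<close> (divided by \<open>u\<close> for even \<open>n\<close>) makes
  the sum over the positions between two neighbouring dents telescope, so that one more row replaces
  these differences by powers at the new dents. The zigzag makes the exponents alternately odd and
  even; this is the origin of the parity \<open>p\<close> and of the two kinds of row step. The
  leading coefficients accumulate to the factorials of \<open>hyper2\<close>. Both halves have
  heights of parity \<open>p\<close>, where \<open>y + p = 2 * m + 1\<close>; hence Q for odd
  \<open>y\<close> and K for even \<open>y\<close>. Balance of the two orientations forces exactly
  \<open>m\<close> lozenges across the cut, so the sum runs over \<open>m\<close>-subsets and
  contains a squared product, as in Selberg's integral. It is not attacked directly: trading the
  fern for a corner of side \<open>L = s + z\<close> leaves the sum unchanged, and the resulting
  region is also a trapezoid whose dents form an interval, for which the weight is an explicit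
  product.\<close>

lemma is_tiling_iff:
  "is_tiling R T \<longleftrightarrow> \<Union>T = R \<and> disjoint T \<and> (\<forall>L\<in>T. is_lozenge L)"
  by (auto simp: is_tiling_def partition_on_def is_lozenge_def)

lemma finite_tilings: "finite R \<Longrightarrow> finite {T. is_tiling R T}"
  by (rule finite_subset[of _ "Pow (Pow R)"]) (auto simp: is_tiling_iff)

lemma num_tilings_empty [simp]: "num_tilings {} = 1"
proof -
  have "{T. is_tiling {} T} = {{}}"
    by (auto simp: is_tiling_def partition_on_def)
  then show ?thesis by (simp add: num_tilings_def)
qed

text \<open>Tilings are grouped by the set \<open>V\<close> of lozenges that meet both parts; the
  rest then splits into independent tilings of what \<open>V\<close> leaves of \<open>A\<close> and
  of \<open>B\<close>. Since the straddling lozenges \<open>X\<close> are pairwise disjoint, every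
  subset of \<open>X\<close> is an admissible \<open>V\<close>.\<close>

lemma num_tilings_split:
  assumes "finite A" "finite B" "A \<inter> B = {}"
  defines "X \<equiv> {L. is_lozenge L \<and> L \<subseteq> A \<union> B \<and> L \<inter> A \<noteq> {} \<and> L \<inter> B \<noteq> {}}"
  assumes "disjoint X"
  shows "num_tilings (A \<union> B) = (\<Sum>V\<in>Pow X. num_tilings (A - \<Union>V) * num_tilings (B - \<Union>V))"
proof -
  have fin: "finite {T. is_tiling (A \<union> B) T}"
    using assms by (intro finite_tilings) simp
  have finX: "finite X"
    by (rule finite_subset[of _ "Pow (A \<union> B)"]) (use assms in auto)
  have "num_tilings (A \<union> B) = (\<Sum>V\<in>Pow X. card {T. is_tiling (A \<union> B) T \<and> T \<inter> X = V})"
    unfolding num_tilings_def card_eq_sum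
    by (subst sum.group[symmetric, where g = "\<lambda>T. T \<inter> X", OF fin, of "Pow X"])
      (use finX in \<open>auto intro!: sum.cong\<close>)
  also have "\<dots> = (\<Sum>V\<in>Pow X. num_tilings (A - \<Union>V) * num_tilings (B - \<Union>V))"
  proof (rule sum.cong[OF refl])
    fix V assume "V \<in> Pow X"
    then have V: "V \<subseteq> X" by simp
    let ?f = "\<lambda>(T1, T2). T1 \<union> T2 \<union> V"
    have "bij_betw ?f ({T. is_tiling (A - \<Union>V) T} \<times> {T. is_tiling (B - \<Union>V) T})
        {T. is_tiling (A \<union> B) T \<and> T \<inter> X = V}"
    proof (rule bij_betw_byWitness[where f' = "\<lambda>T. ({L\<in>T. L \<subseteq> A}, {L\<in>T. L \<subseteq> B})"])
      have nonempty: "L \<noteq> {}" if "is_lozenge L" for L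
        using that by (auto simp: is_lozenge_def)
      have X: "\<not> L \<subseteq> A \<and> \<not> L \<subseteq> B" if "L \<in> X" for L
        using that assms(3) by (auto simp: X_def)
      show "\<forall>TT\<in>{T. is_tiling (A - \<Union>V) T} \<times> {T. is_tiling (B - \<Union>V) T}.
          ({L\<in>?f TT. L \<subseteq> A}, {L\<in>?f TT. L \<subseteq> B}) = TT"
      proof (clarsimp, intro conjI)
        fix T1 T2 assume T: "is_tiling (A - \<Union>V) T1" "is_tiling (B - \<Union>V) T2"
        have 1: "L \<subseteq> A \<and> \<not> L \<subseteq> B" if "L \<in> T1" for L
          using that T(1) nonempty[of L] assms(3) unfolding is_tiling_iff by blast
        have 2: "L \<subseteq> B \<and> \<not> L \<subseteq> A" if "L \<in> T2" for L
          using that T(2) nonempty[of L] assms(3) unfolding is_tiling_iff by blast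
        show "{L. (L \<in> T1 \<or> L \<in> T2 \<or> L \<in> V) \<and> L \<subseteq> A} = T1"
          "{L. (L \<in> T1 \<or> L \<in> T2 \<or> L \<in> V) \<and> L \<subseteq> B} = T2"
          using 1 2 X V by blast+
      qed
      show "\<forall>T\<in>{T. is_tiling (A \<union> B) T \<and> T \<inter> X = V}.
          ?f ({L\<in>T. L \<subseteq> A}, {L\<in>T. L \<subseteq> B}) = T"
      proof clarsimp
        fix T assume T: "is_tiling (A \<union> B) T"
        have "L \<subseteq> A \<or> L \<subseteq> B \<or> L \<in> X" if "L \<in> T" for L
          using that T by (auto simp: is_tiling_iff X_def)
        then show "{L\<in>T. L \<subseteq> A} \<union> {L\<in>T. L \<subseteq> B} \<union> T \<inter> X = T" by blast
      qed
      show "?f ` ({T. is_tiling (A - \<Union>V) T} \<times> {T. is_tiling (B - \<Union>V) T})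
          \<subseteq> {T. is_tiling (A \<union> B) T \<and> T \<inter> X = V}"
      proof clarsimp
        fix T1 T2 assume T: "is_tiling (A - \<Union>V) T1" "is_tiling (B - \<Union>V) T2"
        have disjV: "disjoint V" using assms(5) V by (rule pairwise_subset)
        have VAB: "\<Union>V \<subseteq> A \<union> B" "\<forall>L\<in>V. is_lozenge L" using V by (auto simp: X_def)
        have "\<Union>(T1 \<union> T2 \<union> V) = A \<union> B" using T VAB by (auto simp: is_tiling_iff)
        moreover have "disjoint (T1 \<union> T2 \<union> V)"
          using T disjV assms(3) by (intro disjoint_union) (auto simp: is_tiling_iff)
        moreover have "\<forall>L\<in>T1 \<union> T2 \<union> V. is_lozenge L"
          using T VAB by (auto simp: is_tiling_iff)
        moreover have "L \<notin> X" if "L \<in> T1 \<union> T2" for L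
          using that T X[of L] by (auto simp: is_tiling_iff)
        ultimately show "is_tiling (A \<union> B) (T1 \<union> T2 \<union> V) \<and> (T1 \<union> T2 \<union> V) \<inter> X = V"
          using V by (auto simp: is_tiling_iff)
      qed
      show "(\<lambda>T. ({L\<in>T. L \<subseteq> A}, {L\<in>T. L \<subseteq> B})) ` {T. is_tiling (A \<union> B) T \<and> T \<inter> X = V}
          \<subseteq> {T. is_tiling (A - \<Union>V) T} \<times> {T. is_tiling (B - \<Union>V) T}"
      proof clarsimp
        fix T assume T: "is_tiling (A \<union> B) T" and V': "V = T \<inter> X"
        have disj: "L \<inter> L' = {}" if "L \<in> T" "L' \<in> T" "L \<noteq> L'" for L L'
          using that T by (auto simp: is_tiling_iff pairwise_def disjnt_def)
        have cases: "L \<subseteq> A \<or> L \<subseteq> B \<or> L \<in> X" if "L \<in> T" for L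
          using that T by (auto simp: is_tiling_iff X_def)
        have un: "\<Union>T = A \<union> B" using T by (simp add: is_tiling_iff)
        have sub: "disjoint T'" if "T' \<subseteq> T" for T'
          using T that by (auto simp: is_tiling_iff intro: pairwise_subset)
        have *: "\<Union>{L\<in>T. L \<subseteq> C} = C - \<Union>(T \<inter> X)"
          if C: "C \<subseteq> A \<union> B" "\<And>L t. L \<in> T \<Longrightarrow> t \<in> L \<Longrightarrow> t \<in> C \<Longrightarrow> L \<subseteq> C \<or> L \<in> X"
            "\<And>L. L \<in> X \<Longrightarrow> \<not> L \<subseteq> C" for C
        proof (intro equalityI subsetI)
          fix t assume t: "t \<in> C - \<Union>(T \<inter> X)"
          with un C(1) obtain L where "L \<in> T" "t \<in> L" by (metis DiffD1 UnionE subsetD)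
          with t C(2)[of L t] show "t \<in> \<Union>{L\<in>T. L \<subseteq> C}" by auto
        next
          fix t assume "t \<in> \<Union>{L\<in>T. L \<subseteq> C}"
          then obtain L where L: "L \<in> T" "L \<subseteq> C" "t \<in> L" by auto
          have False if "t \<in> L'" "L' \<in> T" "L' \<in> X" for L'
            using disj[of L L'] L that C(3)[of L'] by auto
          with L show "t \<in> C - \<Union>(T \<inter> X)" by auto
        qed
        have "\<Union>{L\<in>T. L \<subseteq> A} = A - \<Union>(T \<inter> X)"
          using cases assms(3) X by (intro *) auto
        moreover have "\<Union>{L\<in>T. L \<subseteq> B} = B - \<Union>(T \<inter> X)"
          using cases assms(3) X by (intro *) auto
        ultimately show "is_tiling (A - \<Union>(T \<inter> X)) {L\<in>T. L \<subseteq> A} \<and>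
            is_tiling (B - \<Union>(T \<inter> X)) {L\<in>T. L \<subseteq> B}"
          using T by (auto simp: is_tiling_iff intro!: sub)
      qed
    qed
    from bij_betw_same_card[OF this]
    show "card {T. is_tiling (A \<union> B) T \<and> T \<inter> X = V} =
        num_tilings (A - \<Union>V) * num_tilings (B - \<Union>V)"
      by (simp add: num_tilings_def card_cartesian_product)
  qed
  finally show ?thesis .
qed

lemma num_tilings_Un:
  assumes "finite A" "finite B" "A \<inter> B = {}"
    and "\<And>L. is_lozenge L \<Longrightarrow> L \<subseteq> A \<union> B \<Longrightarrow> L \<subseteq> A \<or> L \<subseteq> B"
  shows "num_tilings (A \<union> B) = num_tilings A * num_tilings B"
proof -
  have "{L. is_lozenge L \<and> L \<subseteq> A \<union> B \<and> L \<inter> A \<noteq> {} \<and> L \<inter> B \<noteq> {}} = {}"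
    using assms(3,4) by blast
  with num_tilings_split[OF assms(1-3)] show ?thesis by simp
qed

lemma is_lozenge_vertical: "even (d - 1 + c) \<Longrightarrow> is_lozenge {(d - 1, c), (d, c)}"
  unfolding is_lozenge_def by (intro exI[of _ "d - 1"] exI[of _ c]) auto

text \<open>Only vertical lozenges straddle a horizontal line, at most one per column; so they are
  pairwise disjoint and \<open>V\<close> can be recorded by its columns.\<close>

lemma num_tilings_cut:
  fixes d :: int
  assumes "finite A" "finite B" "\<And>r c. (r, c) \<in> A \<Longrightarrow> r < d" "\<And>r c. (r, c) \<in> B \<Longrightarrow> d \<le> r"
  defines "C \<equiv> {c. (d - 1, c) \<in> A \<and> (d, c) \<in> B \<and> even (d - 1 + c)}"
  shows "num_tilings (A \<union> B) =
    (\<Sum>V\<in>Pow C. num_tilings (A - {d - 1} \<times> V) * num_tilings (B - {d} \<times> V))"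
proof -
  define X where "X = {L. is_lozenge L \<and> L \<subseteq> A \<union> B \<and> L \<inter> A \<noteq> {} \<and> L \<inter> B \<noteq> {}}"
  define v where "v = (\<lambda>c :: int. {(d - 1, c), (d, c)})"
  have AB: "A \<inter> B = {}" using assms(3,4) by force
  have "X = v ` C"
  proof (intro equalityI subsetI)
    fix L assume "L \<in> X"
    then have L: "is_lozenge L" "L \<subseteq> A \<union> B" "L \<inter> A \<noteq> {}" "L \<inter> B \<noteq> {}"
      by (auto simp: X_def)
    from L(1) show "L \<in> v ` C" unfolding is_lozenge_def
    proof (elim exE disjE conjE)
      fix r c assume "L = {(r, c), (r, c + 1)}"
      then show ?thesis using L(2-4) assms(3)[of r c] assms(3)[of r "c + 1"]
          assms(4)[of r c] assms(4)[of r "c + 1"] by auto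
    next
      fix r c assume rc: "even (r + c)" "L = {(r, c), (r + 1, c)}"
      then have "(r, c) \<in> A" "(r + 1, c) \<in> B" "r = d - 1"
        using L(2-4) assms(3)[of r c] assms(3)[of "r + 1" c]
          assms(4)[of r c] assms(4)[of "r + 1" c] by auto
      then show ?thesis using rc by (auto simp: v_def C_def)
    qed
  next
    fix L assume "L \<in> v ` C"
    then show "L \<in> X" unfolding X_def v_def C_def by (auto simp: is_lozenge_vertical)
  qed
  moreover have "disjoint (v ` C)"
    by (auto simp: v_def pairwise_def disjnt_def)
  ultimately have "num_tilings (A \<union> B) =
      (\<Sum>V\<in>Pow (v ` C). num_tilings (A - \<Union>V) * num_tilings (B - \<Union>V))"
    using num_tilings_split[OF assms(1,2) AB] by (simp add: X_def)
  also have "Pow (v ` C) = (`) v ` Pow C"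
    by (rule image_Pow_surj[symmetric, OF refl])
  also have "(\<Sum>V\<in>(`) v ` Pow C. num_tilings (A - \<Union>V) * num_tilings (B - \<Union>V)) =
      (\<Sum>V\<in>Pow C. num_tilings (A - \<Union>(v ` V)) * num_tilings (B - \<Union>(v ` V)))"
  proof (rule sum.reindex_cong[where l = "(`) v"])
    have "inj v" by (auto simp: v_def inj_def doubleton_eq_iff)
    then show "inj_on ((`) v) (Pow C)"
      by (meson inj_image_eq_iff inj_onI)
  qed auto
  also have "\<dots> = (\<Sum>V\<in>Pow C. num_tilings (A - {d - 1} \<times> V) * num_tilings (B - {d} \<times> V))"
  proof (rule sum.cong[OF refl])
    fix V
    have "A - \<Union>(v ` V) = A - {d - 1} \<times> V" "B - \<Union>(v ` V) = B - {d} \<times> V"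
      using assms(3,4) by (auto simp: v_def) force+
    then show "num_tilings (A - \<Union>(v ` V)) * num_tilings (B - \<Union>(v ` V)) =
        num_tilings (A - {d - 1} \<times> V) * num_tilings (B - {d} \<times> V)" by simp
  qed
  finally show ?thesis .
qed

text \<open>Every tiling covers \<open>a\<close>, and only \<open>L\<close> can do so; inserting and
  deleting \<open>L\<close> are inverse to each other.\<close>

lemma num_tilings_forced:
  assumes "is_lozenge L" "L \<subseteq> R" "a \<in> L"
    and "\<And>L'. is_lozenge L' \<Longrightarrow> a \<in> L' \<Longrightarrow> L' \<subseteq> R \<Longrightarrow> L' = L"
  shows "num_tilings R = num_tilings (R - L)"
proof -
  have "bij_betw (insert L) {T. is_tiling (R - L) T} {T. is_tiling R T}"
  proof (rule bij_betw_byWitness[where f' = "\<lambda>T. T - {L}"])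
    have *: "L \<in> T" if "is_tiling R T" for T
    proof -
      from that assms(2,3) obtain L' where "L' \<in> T" "a \<in> L'" by (auto simp: is_tiling_iff)
      moreover from this that have "is_lozenge L'" "L' \<subseteq> R" by (auto simp: is_tiling_iff)
      ultimately show ?thesis using assms(4) by metis
    qed
    show "\<forall>T\<in>{T. is_tiling (R - L) T}. insert L T - {L} = T"
      using assms(3) by (auto simp: is_tiling_iff)
    show "\<forall>T\<in>{T. is_tiling R T}. insert L (T - {L}) = T"
      using * by auto
    show "insert L ` {T. is_tiling (R - L) T} \<subseteq> {T. is_tiling R T}"
    proof clarsimp
      fix T assume T: "is_tiling (R - L) T"
      then have "\<And>L'. L' \<in> T \<Longrightarrow> L' \<inter> L = {}" by (auto simp: is_tiling_iff)
      with T assms(1,2) show "is_tiling R (insert L T)"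
        unfolding is_tiling_iff pairwise_insert disjnt_def by blast
    qed
    show "(\<lambda>T. T - {L}) ` {T. is_tiling R T} \<subseteq> {T. is_tiling (R - L) T}"
    proof clarsimp
      fix T assume T: "is_tiling R T"
      have "L' \<inter> L = {}" if "L' \<in> T - {L}" for L'
        using that T *[OF T] by (auto simp: is_tiling_iff pairwise_def disjnt_def)
      then have "\<Union>(T - {L}) = R - L"
        using T *[OF T] unfolding is_tiling_iff by blast
      then show "is_tiling (R - L) (T - {L})"
        using T by (auto simp: is_tiling_iff intro: pairwise_subset)
    qed
  qed
  then show ?thesis by (simp add: num_tilings_def bij_betw_same_card)
qed

text \<open>An inequality is enough, because it applies to the image of \<open>R\<close> as well and
  \<open>f\<close> is its own inverse.\<close>

lemma num_tilings_involution:
  assumes "finite R" "\<And>t. f (f t) = t" "\<And>L. is_lozenge L \<Longrightarrow> is_lozenge (f ` L)"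
  shows "num_tilings (f ` R) = num_tilings R"
proof -
  have inj: "inj f" by (metis assms(2) injI)
  have le: "num_tilings R \<le> num_tilings (f ` R)" if "finite R" for R
    unfolding num_tilings_def
  proof (rule card_inj_on_le[where f = "(`) ((`) f)"])
    show "inj_on ((`) ((`) f)) {T. is_tiling R T}"
      by (meson inj inj_image_eq_iff inj_onI injI)
    show "(`) ((`) f) ` {T. is_tiling R T} \<subseteq> {T. is_tiling (f ` R) T}"
    proof clarsimp
      fix T assume T: "is_tiling R T"
      have "f ` L \<inter> f ` L' = {}" if "L \<in> T" "L' \<in> T" "f ` L \<noteq> f ` L'" for L L'
      proof -
        have "L \<inter> L' = {}"
          using T that unfolding is_tiling_iff pairwise_def disjnt_def by blast
        then show ?thesis by (simp add: image_Int[OF inj, symmetric])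
      qed
      then have "disjoint ((`) f ` T)"
        by (auto simp: pairwise_def disjnt_def)
      with T show "is_tiling (f ` R) ((`) f ` T)"
        using assms(3) by (auto simp: is_tiling_iff)
    qed
  qed (use that in \<open>simp add: finite_tilings\<close>)
  have "f ` f ` R = R" using assms(2) by (simp add: image_image)
  then show ?thesis using le[of R] le[of "f ` R"] assms(1) by simp
qed

text \<open>A lozenge contains one triangle of either orientation.\<close>

lemma num_tilings_balanced:
  assumes "finite R" "num_tilings R \<noteq> 0"
  shows "card {(r, c)\<in>R. even (r + c)} = card {(r, c)\<in>R. odd (r + c)}"
proof -
  define g where "g = (\<lambda>(r :: int, c :: int). if even (r + c) then 1 else - 1 :: int)"
  from assms(2) obtain T where T: "is_tiling R T"
    unfolding num_tilings_def by (metis (mono_tags) Collect_empty_eq card.empty)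
  have "sum g L = 0" if "is_lozenge L" for L
    using that by (auto simp: is_lozenge_def g_def)
  moreover have "sum g (\<Union>T) = (\<Sum>L\<in>T. sum g L)"
  proof (rule sum.Union_disjoint[unfolded comp_def])
    show "\<forall>L\<in>T. finite L" using T assms(1) by (auto simp: is_tiling_iff intro: finite_subset)
    show "\<forall>L\<in>T. \<forall>L'\<in>T. L \<noteq> L' \<longrightarrow> L \<inter> L' = {}"
      using T by (auto simp: is_tiling_iff pairwise_def disjnt_def)
  qed
  ultimately have "sum g R = 0" using T by (simp add: is_tiling_iff)
  moreover have "sum g R = int (card {(r, c)\<in>R. even (r + c)}) - int (card {(r, c)\<in>R. odd (r + c)})"
  proof -
    have R: "R = {(r, c)\<in>R. even (r + c)} \<union> {(r, c)\<in>R. odd (r + c)}" by auto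
    have "sum g R = sum g {(r, c)\<in>R. even (r + c)} + sum g {(r, c)\<in>R. odd (r + c)}"
      by (subst R, rule sum.union_disjoint) (auto intro: finite_subset[OF _ assms(1)])
    also have "sum g {(r, c)\<in>R. even (r + c)} = sum (\<lambda>_. 1) {(r, c)\<in>R. even (r + c)}"
      by (rule sum.cong) (auto simp: g_def)
    also have "sum g {(r, c)\<in>R. odd (r + c)} = sum (\<lambda>_. - 1) {(r, c)\<in>R. odd (r + c)}"
      by (rule sum.cong) (auto simp: g_def)
    finally show ?thesis by simp
  qed
  ultimately show ?thesis by simp
qed

section \<open>Determinants of polynomial values\<close>

text \<open>The Newton polynomials are monic, so peeling off the top one lowers the degree, and the
  top Newton coefficient is the leading coefficient. The latter becomes the diagonal of the upper
  triangular factor below.\<close>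

lemma newton_expansion:
  fixes q :: "'a::comm_ring_1 poly" and v :: "nat \<Rightarrow> 'a"
  assumes "degree q \<le> j"
  shows "\<exists>a. a j = coeff q j \<and> q = (\<Sum>l\<le>j. smult (a l) (\<Prod>i<l. [:- v i, 1:]))"
  using assms
proof (induction j arbitrary: q)
  case 0
  then show ?case
    by (intro exI[of _ "\<lambda>_. coeff q 0"]) (auto elim: degree_eq_zeroE)
next
  case (Suc j)
  define N where "N = (\<lambda>l. \<Prod>i<l. [:- v i, 1:])"
  have deg_N: "degree (N l) \<le> l \<and> coeff (N l) l = 1" for l
  proof (induction l)
    case 0
    then show ?case by (simp add: N_def)
  next
    case (Suc l)
    have "N (Suc l) = pCons 0 (N l) - smult (v l) (N l)"
      by (simp add: N_def mult.commute)
    moreover have "coeff (N l) (Suc l) = 0"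
      using Suc by (intro coeff_eq_0) simp
    moreover have "degree (pCons 0 (N l) - smult (v l) (N l)) \<le> Suc l"
      using Suc by (intro degree_diff_le order.trans[OF degree_pCons_le]
        order.trans[OF degree_smult_le]) auto
    ultimately show ?case using Suc by simp
  qed
  define r where "r = q - smult (coeff q (Suc j)) (N (Suc j))"
  have "degree r \<le> Suc j"
    unfolding r_def using Suc.prems deg_N[of "Suc j"]
    by (intro degree_diff_le order.trans[OF degree_smult_le]) auto
  moreover have "coeff r (Suc j) = 0"
    using deg_N[of "Suc j"] by (simp add: r_def)
  ultimately have "degree r \<le> j"
    by (metis eq_zero_or_degree_less degree_0 le_SucE less_Suc_eq_le zero_le)
  from Suc.IH[OF this] obtain a where a: "r = (\<Sum>l\<le>j. smult (a l) (N l))"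
    unfolding N_def by blast
  have "q = (\<Sum>l\<le>Suc j. smult ((a(Suc j := coeff q (Suc j))) l) (N l))"
  proof -
    have "q = r + smult (coeff q (Suc j)) (N (Suc j))" by (simp add: r_def)
    then show ?thesis by (simp add: a)
  qed
  then show ?case unfolding N_def by (metis fun_upd_same)
qed

text \<open>In the Newton basis at the nodes \<open>v\<^sub>i\<close> the matrix is the product of a lower and an upper
  triangular one.\<close>

lemma det_poly_vandermonde:
  fixes q :: "nat \<Rightarrow> 'a::idom poly"
  assumes "\<And>j. j < k \<Longrightarrow> degree (q j) \<le> j"
  shows "det (mat k k (\<lambda>(i, j). poly (q j) (v i))) =
    (\<Prod>j<k. coeff (q j) j) * (\<Prod>j<k. \<Prod>i<j. v j - v i)"
proof -
  have "\<forall>j. \<exists>a. j < k \<longrightarrow>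
      a j = coeff (q j) j \<and> q j = (\<Sum>l\<le>j. smult (a l) (\<Prod>i<l. [:- v i, 1:]))"
    using newton_expansion assms by blast
  then obtain a where a: "\<And>j. j < k \<Longrightarrow> a j j = coeff (q j) j"
    and q: "\<And>j. j < k \<Longrightarrow> q j = (\<Sum>l\<le>j. smult (a j l) (\<Prod>i<l. [:- v i, 1:]))"
    by metis
  define L where "L = mat k k (\<lambda>(i, l). \<Prod>i'<l. v i - v i')"
  define U where "U = mat k k (\<lambda>(l, j). if l \<le> j then a j l else 0)"
  have "mat k k (\<lambda>(i, j). poly (q j) (v i)) = L * U"
  proof (rule eq_matI)
    fix i j assume "i < dim_row (L * U)" "j < dim_col (L * U)"
    then have ij: "i < k" "j < k" by (auto simp: L_def U_def)
    have "(L * U) $$ (i, j) = (\<Sum>l<k. (\<Prod>i'<l. v i - v i') * (if l \<le> j then a j l else 0))"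
      using ij by (simp add: L_def U_def scalar_prod_def lessThan_atLeast0)
    also have "\<dots> = (\<Sum>l\<le>j. a j l * (\<Prod>i'<l. v i - v i'))"
      using ij by (intro sum.mono_neutral_cong_right) auto
    also have "\<dots> = poly (q j) (v i)"
      using ij by (subst q) (auto simp: poly_sum poly_prod)
    finally show "mat k k (\<lambda>(i, j). poly (q j) (v i)) $$ (i, j) = (L * U) $$ (i, j)"
      using ij by simp
  qed (auto simp: L_def U_def)
  moreover have "det L = (\<Prod>j<k. \<Prod>i<j. v j - v i)"
  proof -
    have "det L = prod_list (diag_mat L)"
      by (rule det_lower_triangular[where n = k]) (auto simp: L_def)
    also have "\<dots> = (\<Prod>j<k. \<Prod>i<j. v j - v i)"
      by (simp add: L_def diag_mat_def prod.distinct_set_conv_list[symmetric] lessThan_atLeast0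
        cong: prod.cong) (rule prod.cong; simp)
    finally show ?thesis .
  qed
  moreover have "det U = (\<Prod>j<k. coeff (q j) j)"
  proof -
    have "det U = prod_list (diag_mat U)"
      by (rule det_upper_triangular[where n = k]) (auto simp: U_def)
    also have "\<dots> = (\<Prod>j<k. coeff (q j) j)"
      by (simp add: U_def diag_mat_def prod.distinct_set_conv_list[symmetric] lessThan_atLeast0 a
        cong: prod.cong) (rule prod.cong; simp add: a)
    finally show ?thesis .
  qed
  moreover have "L \<in> carrier_mat k k" "U \<in> carrier_mat k k" by (auto simp: L_def U_def)
  ultimately show ?thesis by (simp add: det_mult)
qed

text \<open>Row \<open>i\<close> depends on \<open>s i\<close> only, so in the Leibniz expansion the
  sum over all choice functions factors into sums over single rows.\<close>

lemma sum_det_rows: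
  fixes p :: "nat \<Rightarrow> 'b \<Rightarrow> 'a::comm_ring_1"
  assumes "\<And>i. i < k \<Longrightarrow> finite (A i)"
  shows "(\<Sum>s\<in>PiE {..<k} A. det (mat k k (\<lambda>(i, j). p j (s i)))) =
    det (mat k k (\<lambda>(i, j). \<Sum>x\<in>A i. p j x))"
proof -
  have *: "det (mat k k f) = (\<Sum>\<pi> | \<pi> permutes {0..<k}. signof \<pi> * (\<Prod>i<k. f (i, \<pi> i)))"
    for f :: "nat \<times> nat \<Rightarrow> 'a"
  proof -
    have "det (mat k k f) =
        (\<Sum>\<pi> | \<pi> permutes {0..<k}. signof \<pi> * (\<Prod>i = 0..<k. mat k k f $$ (i, \<pi> i)))"
      by (rule det_def') simp
    also have "\<dots> = (\<Sum>\<pi> | \<pi> permutes {0..<k}. signof \<pi> * (\<Prod>i<k. f (i, \<pi> i)))"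
      unfolding lessThan_atLeast0
    proof (intro sum.cong refl arg_cong2[of _ _ _ _ "(*)"] prod.cong)
      fix \<pi> i assume "\<pi> \<in> {\<pi>. \<pi> permutes {0..<k}}" "i \<in> {0..<k}"
      then have "\<pi> i < k" using permutes_in_image[of \<pi> "{0..<k}" i] by simp
      then show "mat k k f $$ (i, \<pi> i) = f (i, \<pi> i)" using \<open>i \<in> {0..<k}\<close> by simp
    qed
    finally show ?thesis .
  qed
  have PiE: "(\<Sum>s\<in>PiE {..<k} A. \<Prod>i<k. p (\<pi> i) (s i)) = (\<Prod>i<k. \<Sum>x\<in>A i. p (\<pi> i) x)" for \<pi>
    using assms by (intro prod_sum_PiE[symmetric, of "{..<k}" A "\<lambda>i. p (\<pi> i)"]) auto
  have "(\<Sum>s\<in>PiE {..<k} A. det (mat k k (\<lambda>(i, j). p j (s i)))) =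
     (\<Sum>\<pi> | \<pi> permutes {0..<k}. signof \<pi> * (\<Sum>s\<in>PiE {..<k} A. \<Prod>i<k. p (\<pi> i) (s i)))"
    unfolding * by (subst sum.swap) (simp add: sum_distrib_left)
  also have "\<dots> = det (mat k k (\<lambda>(i, j). \<Sum>x\<in>A i. p j x))"
    by (simp add: * PiE)
  finally show ?thesis .
qed

text \<open>The lower triangular matrix of ones has determinant 1 and turns consecutive differences
  into differences from the first value.\<close>

lemma det_row_differences:
  fixes f :: "nat \<Rightarrow> nat \<Rightarrow> 'a::idom"
  shows "det (mat k k (\<lambda>(i, j). f (Suc i) j - f i j)) = det (mat k k (\<lambda>(i, j). f (Suc i) j - f 0 j))"
proof -
  define D where "D = mat k k (\<lambda>(i, j). f (Suc i) j - f i j)"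
  define L where "L = mat k k (\<lambda>(i, l). if l \<le> i then 1 else (0::'a))"
  have "mat k k (\<lambda>(i, j). f (Suc i) j - f 0 j) = L * D"
  proof (rule eq_matI)
    fix i j assume "i < dim_row (L * D)" "j < dim_col (L * D)"
    then have ij: "i < k" "j < k" by (auto simp: L_def D_def)
    have "(L * D) $$ (i, j) = (\<Sum>l<k. (if l \<le> i then 1 else 0) * (f (Suc l) j - f l j))"
      using ij by (simp add: L_def D_def scalar_prod_def lessThan_atLeast0)
    also have "\<dots> = (\<Sum>l<Suc i. f (Suc l) j - f l j)"
      using ij by (intro sum.mono_neutral_cong_right) auto
    also have "\<dots> = f (Suc i) j - f 0 j"
      by (rule sum_lessThan_telescope)
    finally show "mat k k (\<lambda>(i, j). f (Suc i) j - f 0 j) $$ (i, j) = (L * D) $$ (i, j)"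
      using ij by simp
  qed (auto simp: L_def D_def)
  moreover have "det L = 1"
  proof -
    have "det L = prod_list (diag_mat L)"
      by (rule det_lower_triangular[where n = k]) (auto simp: L_def)
    also have "\<dots> = 1"
      by (simp add: L_def diag_mat_def prod.distinct_set_conv_list[symmetric])
    finally show ?thesis .
  qed
  moreover have "L \<in> carrier_mat k k" "D \<in> carrier_mat k k" by (auto simp: L_def D_def)
  ultimately show ?thesis by (simp add: det_mult D_def)
qed

lemma det_scale_rows:
  fixes f :: "nat \<Rightarrow> nat \<Rightarrow> 'a::comm_ring_1"
  shows "det (mat k k (\<lambda>(i, j). c i * f i j)) = (\<Prod>i<k. c i) * det (mat k k (\<lambda>(i, j). f i j))"
proof -
  have "det (mat\<^sub>r k k (\<lambda>i. c i \<cdot>\<^sub>v vec k (f i))) = prod c {0..<k} * det (mat\<^sub>r k k (\<lambda>i. vec k (f i)))"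
    by (rule det_rows_mul) simp
  moreover have "mat\<^sub>r k k (\<lambda>i. c i \<cdot>\<^sub>v vec k (f i)) = mat k k (\<lambda>(i, j). c i * f i j)"
    by (rule eq_matI) auto
  moreover have "mat\<^sub>r k k (\<lambda>i. vec k (f i)) = mat k k (\<lambda>(i, j). f i j)"
    by (rule eq_matI) auto
  ultimately show ?thesis by (simp add: lessThan_atLeast0)
qed

text \<open>With \<open>\<alpha> = u + 1\<close> and \<open>\<beta> = u - 1\<close>, both families come from the recursion
  \<open>D (n + 2) = (\<alpha> + \<beta>) D (n + 1) - \<alpha> \<beta> D n\<close> for \<open>D n = \<alpha>^n - \<beta>^n\<close>.\<close>

lemma power_difference_polys:
  "\<exists>q r :: real poly.
     degree q \<le> j \<and> coeff q j = 2 * (2 * real j + 1) \<and>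
     degree r \<le> j \<and> coeff r j = 2 * (2 * real j + 2) \<and>
     (\<forall>u. (u + 1) ^ (2 * j + 1) - (u - 1) ^ (2 * j + 1) = poly q (u\<^sup>2)) \<and>
     (\<forall>u. (u + 1) ^ (2 * j + 2) - (u - 1) ^ (2 * j + 2) = u * poly r (u\<^sup>2))"
proof (induction j)
  case 0
  show ?case
    by (intro exI[of _ "[:2:]"] exI[of _ "[:4:]"]) (auto simp: power2_eq_square algebra_simps)
next
  case (Suc j)
  then obtain q r :: "real poly" where
    q: "degree q \<le> j" "coeff q j = 2 * (2 * real j + 1)" and
    r: "degree r \<le> j" "coeff r j = 2 * (2 * real j + 2)" and
    eq: "\<And>u. (u + 1) ^ (2 * j + 1) - (u - 1) ^ (2 * j + 1) = poly q (u\<^sup>2)"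
      "\<And>u. (u + 1) ^ (2 * j + 2) - (u - 1) ^ (2 * j + 2) = u * poly r (u\<^sup>2)"
    by blast
  \<comment> \<open>\<open>pCons 0\<close> multiplies by the variable \<open>v\<close>, which stands
    for \<open>u^2\<close>. The recursion thus reads \<open>q' = 2 v r - (v - 1) q\<close> and
    \<open>r' = 2 q' - (v - 1) r\<close>.\<close>
  define q' where "q' = pCons 0 (smult 2 r - q) + q"
  define r' where "r' = smult 2 q' - pCons 0 r + r"
  have rec: "(u + 1) ^ (n + 2) - (u - 1) ^ (n + 2) =
      2 * u * ((u + 1) ^ (n + 1) - (u - 1) ^ (n + 1)) - (u\<^sup>2 - 1) * ((u + 1) ^ n - (u - 1) ^ n)"
    for u :: real and n
    by (simp add: algebra_simps power2_eq_square)
  have "degree (smult 2 r - q) \<le> j"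
    using q r by (intro degree_diff_le) auto
  then have q': "degree q' \<le> Suc j" "coeff q' (Suc j) = 2 * (2 * real (Suc j) + 1)"
    using q r by (auto simp: q'_def coeff_eq_0
      intro!: degree_add_le order.trans[OF degree_pCons_le])
  have r': "degree r' \<le> Suc j" "coeff r' (Suc j) = 2 * (2 * real (Suc j) + 2)"
    using q' r by (auto simp: r'_def coeff_eq_0
      intro!: degree_add_le degree_diff_le order.trans[OF degree_pCons_le])
  have eq': "(u + 1) ^ (2 * Suc j + 1) - (u - 1) ^ (2 * Suc j + 1) = poly q' (u\<^sup>2)" for u
    using rec[of u "2 * j + 1"] eq[of u]
    by (simp add: q'_def) (simp add: algebra_simps power2_eq_square)
  have "(u + 1) ^ (2 * Suc j + 2) - (u - 1) ^ (2 * Suc j + 2) = u * poly r' (u\<^sup>2)" for u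
    using rec[of u "2 * j + 2"] eq(2)[of u] eq'[of u]
    by (simp add: r'_def) (simp add: algebra_simps power2_eq_square)
  with q' r' eq' show ?case by blast
qed

section \<open>Tilings of a row\<close>

text \<open>Within a single row only neighbours can be paired, so the partner of the leftmost
  triangle is forced.\<close>

lemma num_tilings_row_interval: "num_tilings ({d} \<times> {p..<p + 2 * int j}) = 1"
proof (induction j arbitrary: p)
  case 0
  then show ?case by simp
next
  case (Suc j)
  let ?R = "{d} \<times> {p..<p + 2 * int (Suc j)}" and ?L = "{(d, p), (d, p + 1)}"
  have "num_tilings ?R = num_tilings (?R - ?L)"
  proof (rule num_tilings_forced)
    show "is_lozenge ?L" by (auto simp: is_lozenge_def)
    show "(d, p) \<in> ?L" by simp
    show "L' = ?L" if "is_lozenge L'" "(d, p) \<in> L'" "L' \<subseteq> ?R" for L'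
      using that by (auto simp: is_lozenge_def)
  qed auto
  also have "?R - ?L = {d} \<times> {p + 2..<(p + 2) + 2 * int j}" by auto
  finally show ?case using Suc.IH by simp
qed

lemma num_tilings_row_Un:
  fixes A B :: "int set"
  assumes "finite A" "finite B" "\<And>a b. a \<in> A \<Longrightarrow> b \<in> B \<Longrightarrow> a + 1 < b"
  shows "num_tilings ({d} \<times> (A \<union> B)) = num_tilings ({d} \<times> A) * num_tilings ({d} \<times> B)"
proof -
  have "num_tilings ({d} \<times> A \<union> {d} \<times> B) = num_tilings ({d} \<times> A) * num_tilings ({d} \<times> B)"
  proof (rule num_tilings_Un)
    show "{d} \<times> A \<inter> {d} \<times> B = {}" using assms(3) by fastforce
    fix L assume "is_lozenge L" "L \<subseteq> {d} \<times> A \<union> {d} \<times> B"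
    then show "L \<subseteq> {d} \<times> A \<or> L \<subseteq> {d} \<times> B"
      unfolding is_lozenge_def using assms(3) by fastforce
  qed (use assms in auto)
  then show ?thesis by (simp add: Sigma_Un_distrib2)
qed

lemma row_balanced:
  assumes "finite A" "num_tilings ({d} \<times> A) \<noteq> 0"
  shows "card {c\<in>A. even c} = card {c\<in>A. odd c}"
proof -
  have card: "card {(r, c)\<in>{d} \<times> A. P (r + c)} = card {c\<in>A. P (d + c)}" for P
    by (rule bij_betw_same_card[OF bij_betw_byWitness[where f = snd and f' = "Pair d"]]) auto
  show ?thesis
    using num_tilings_balanced[OF _ assms(2)] assms(1) card[of even] card[of odd]
    by (cases "even d") simp_all
qed

lemma card_interval_parity:
  "card {c\<in>{p..<p + 2 * int j}. even c} = j" "card {c\<in>{p..<p + 2 * int j}. odd c} = j"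
proof (induction j)
  case (Suc j)
  let ?q = "p + 2 * int j"
  have fin: "finite {c. p \<le> c \<and> c < ?q \<and> P c}" for P
    by (rule finite_subset[of _ "{p..<?q}"]) auto
  have "{c\<in>{p..<p + 2 * int (Suc j)}. even c} =
      insert (if even p then ?q else ?q + 1) {c\<in>{p..<?q}. even c}"
    by (auto; presburger)
  moreover have "{c\<in>{p..<p + 2 * int (Suc j)}. odd c} =
      insert (if even p then ?q + 1 else ?q) {c\<in>{p..<?q}. odd c}"
    by (auto; presburger)
  ultimately show "card {c\<in>{p..<p + 2 * int (Suc j)}. even c} = Suc j"
    "card {c\<in>{p..<p + 2 * int (Suc j)}. odd c} = Suc j"
    using Suc by (simp_all add: fin)
qed simp_all

text \<open>The set \<open>A - V\<close> is balanced and \<open>V\<close> lies in one parity class,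
  so the excess of that class in \<open>A\<close> is \<open>card V\<close>; \<open>a\<close> serves
  to name the class.\<close>

lemma card_Diff_parity:
  fixes V :: "int set"
  assumes "finite V" "V \<subseteq> A" "\<And>v. v \<in> V \<Longrightarrow> odd (v - a)"
    and "finite A" "card {c\<in>A - V. even c} = card {c\<in>A - V. odd c}"
  shows "card {c\<in>A. odd (c - a)} = card {c\<in>A. even (c - a)} + card V"
proof -
  have "{c\<in>A. odd (c - a)} = {c\<in>A - V. odd (c - a)} \<union> V"
    "{c\<in>A. even (c - a)} = {c\<in>A - V. even (c - a)}"
    using assms(2,3) by auto
  moreover have "card ({c\<in>A - V. odd (c - a)} \<union> V) = card {c\<in>A - V. odd (c - a)} + card V"
    using assms(1,4) by (intro card_Un_disjoint) auto
  moreover have "card {c\<in>A - V. odd (c - a)} = card {c\<in>A - V. even (c - a)}"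
    using assms(5) by (cases "even a") auto
  ultimately show ?thesis by simp
qed

text \<open>An interval of even length is balanced, and removing triangles of one orientation only
  destroys this unless nothing is removed.\<close>

lemma num_tilings_even_gap:
  assumes "V \<subseteq> {p..<p + 2 * int j}" "\<And>v. v \<in> V \<Longrightarrow> odd (v - a)"
  shows "num_tilings ({d} \<times> ({p..<p + 2 * int j} - V)) = (if V = {} then 1 else 0)"
proof (cases "V = {}")
  case True
  then show ?thesis by (simp add: num_tilings_row_interval)
next
  case False
  have fin: "finite V" using assms(1) by (rule finite_subset) simp
  have "num_tilings ({d} \<times> ({p..<p + 2 * int j} - V)) = 0"
  proof (rule ccontr)
    assume "num_tilings ({d} \<times> ({p..<p + 2 * int j} - V)) \<noteq> 0"
    from row_balanced[OF _ this]
    have "card {c\<in>{p..<p + 2 * int j}. odd (c - a)} =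
        card {c\<in>{p..<p + 2 * int j}. even (c - a)} + card V"
      using assms fin by (intro card_Diff_parity) auto
    then have "card V = 0"
      using card_interval_parity[of p j] by (cases "even a") simp_all
    with fin False show False by simp
  qed
  with False show ?thesis by simp
qed

text \<open>The open interval has odd length and one triangle in excess, of the orientation of those
  in \<open>V\<close>. Hence exactly one must be removed, and it leaves two intervals of even
  length. This is what makes the dents of adjacent rows interlace.\<close>

lemma num_tilings_odd_gap:
  fixes p q :: int
  assumes "V \<subseteq> {p<..<q}" "p < q" "even (q - p)" "\<And>v. v \<in> V \<Longrightarrow> odd (v - p)"
  shows "num_tilings ({d} \<times> ({p<..<q} - V)) = (if card V = 1 then 1 else 0)"
proof (cases "card V = 1")
  case True
  then obtain v where v: "V = {v}" by (auto simp: card_1_singleton_iff)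
  then have pv: "p < v" "v < q" "odd (v - p)" using assms(1,4) by auto
  define i j where "i = nat ((v - p - 1) div 2)" and "j = nat ((q - v - 1) div 2)"
  have ij: "v = p + 1 + 2 * int i" "q = v + 1 + 2 * int j"
    using pv assms(3) by (auto simp: i_def j_def)
  have "{p<..<q} - V = {p + 1..<p + 1 + 2 * int i} \<union> {v + 1..<v + 1 + 2 * int j}"
    using ij v by auto
  moreover have "num_tilings ({d} \<times> \<dots>) =
      num_tilings ({d} \<times> {p + 1..<p + 1 + 2 * int i}) *
      num_tilings ({d} \<times> {v + 1..<v + 1 + 2 * int j})"
    using ij(1) by (intro num_tilings_row_Un) auto
  ultimately show ?thesis using True by (simp add: num_tilings_row_interval)
next
  case False
  have fin: "finite V" using assms(1) by (rule finite_subset) simp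
  have "num_tilings ({d} \<times> ({p<..<q} - V)) = 0"
  proof (rule ccontr)
    assume "num_tilings ({d} \<times> ({p<..<q} - V)) \<noteq> 0"
    from row_balanced[OF _ this]
    have 1: "card {c\<in>{p<..<q}. odd (c - p)} = card {c\<in>{p<..<q}. even (c - p)} + card V"
      using assms fin by (intro card_Diff_parity) auto
    define j where "j = nat ((q - p) div 2)"
    have q: "q = p + 2 * int j" using assms(2,3) by (simp add: j_def)
    \<comment> \<open>Adding the endpoint \<open>p\<close> makes the length even, where the parity
      counts are known.\<close>
    have "{p..<p + 2 * int j} = insert p {p<..<q}" using assms(2) q by auto
    then have "{c\<in>{p..<p + 2 * int j}. even (c - p)} = insert p {c\<in>{p<..<q}. even (c - p)}"
      "{c\<in>{p..<p + 2 * int j}. odd (c - p)} = {c\<in>{p<..<q}. odd (c - p)}"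
      by auto
    moreover have "card (insert p {c\<in>{p<..<q}. even (c - p)}) = Suc (card {c\<in>{p<..<q}. even (c - p)})"
      by (rule card_insert_disjoint) (auto intro: finite_subset[of _ "{p<..<q}"])
    ultimately have "card {c\<in>{p<..<q}. odd (c - p)} = Suc (card {c\<in>{p<..<q}. even (c - p)})"
      using card_interval_parity[of p j] by (cases "even p") simp_all
    with 1 False show False by simp
  qed
  with False show ?thesis by simp
qed

text \<open>The columns between the dents \<open>p\<close> and \<open>q\<close> whose triangles have
  the orientation opposite to the dents, that is, those which a vertical lozenge from the row above
  can enter.\<close>

definition gap :: "int \<Rightarrow> int \<Rightarrow> int set" where
  "gap p q = {c. p < c \<and> c < q \<and> odd (c - p)}"

lemma finite_gap [simp]: "finite (gap p q)"
  by (rule finite_subset[of _ "{p<..<q}"]) (auto simp: gap_def)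

lemma sum_gap_telescope:
  fixes P :: "int \<Rightarrow> 'a::ab_group_add"
  assumes "p \<le> q" "even (q - p)"
  shows "(\<Sum>c\<in>gap p q. P (c + 1) - P (c - 1)) = P q - P p"
proof -
  have "(\<Sum>c\<in>gap p (p + 2 * int j). P (c + 1) - P (c - 1)) = P (p + 2 * int j) - P p" for j
  proof (induction j)
    case 0
    have "gap p p = {}" by (auto simp: gap_def)
    then show ?case by simp
  next
    case (Suc j)
    have "gap p (p + 2 * int (Suc j)) = insert (p + 2 * int j + 1) (gap p (p + 2 * int j))"
      by (auto simp: gap_def; presburger)
    moreover have "p + 2 * int j + 1 \<notin> gap p (p + 2 * int j)" by (simp add: gap_def)
    ultimately show ?case using Suc.IH by (simp add: algebra_simps)
  qed
  from this[of "nat ((q - p) div 2)"] assms show ?thesis by simp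
qed

section \<open>Interlacing of the dents of a row with those of the row above\<close>

lemma chain_mono:
  fixes t :: "nat \<Rightarrow> int"
  assumes "\<And>i. i < k \<Longrightarrow> t i < t (Suc i)" "i \<le> j" "j \<le> k"
  shows "t i \<le> t j"
  using assms(2,3)
proof (induction j rule: dec_induct)
  case (step n)
  with assms(1)[of n] show ?case by simp
qed simp

lemma chain_locate:
  fixes t :: "nat \<Rightarrow> int"
  assumes "t 0 \<le> c" "c < t k"
  shows "\<exists>i<k. t i \<le> c \<and> c < t (Suc i)"
  using assms(2)
proof (induction k)
  case 0
  with assms(1) show ?case by simp
next
  case (Suc k)
  then show ?case by (cases "c < t k") (auto intro: less_SucI)
qed

text \<open>The dents cut the row into an initial piece of even length, \<open>k\<close> gaps of odd
  length and a final piece of even length, each tiled on its own. For \<open>t 0 = -1\<close> the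
  initial piece is empty and the first gap starts at column 0.\<close>

lemma num_tilings_row:
  fixes t :: "nat \<Rightarrow> int"
  assumes mono: "\<And>i. i < k \<Longrightarrow> t i < t (Suc i)"
    and parity: "\<And>i. i \<le> k \<Longrightarrow> even (t i - e)"
    and "t k \<le> e" "t 0 = -1 \<or> 0 \<le> t 0 \<and> even (t 0)"
    and V: "V \<subseteq> {0..e}" "\<And>v. v \<in> V \<Longrightarrow> odd (v - e)"
  shows "num_tilings ({d} \<times> ({0..e} - t ` {..k} - V)) =
    (if V \<inter> {0..<t 0} = {} \<and> V \<inter> {t k<..e} = {} \<and> (\<forall>i<k. card (V \<inter> gap (t i) (t (Suc i))) = 1)
     then 1 else 0)"
proof -
  have VG: "V \<inter> {t i<..<t (Suc i)} = V \<inter> gap (t i) (t (Suc i))" if "i < k" for i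
    using parity[of i] V(2) that by (auto simp: gap_def)
  \<comment> \<open>\<open>G l\<close> is what remains of the row to the left of \<open>t l\<close>;
    each induction step adds one gap.\<close>
  define G where "G = (\<lambda>l. {0..<t l} - t ` {..<l} - V)"
  have G: "num_tilings ({d} \<times> G l) =
      (if V \<inter> {0..<t 0} = {} \<and> (\<forall>i<l. card (V \<inter> gap (t i) (t (Suc i))) = 1) then 1 else 0)"
    if "l \<le> k" for l
    using that
  proof (induction l)
    case 0
    define j where "j = nat (t 0 div 2)"
    have I: "{0..<t 0} = {0..<0 + 2 * int j}" using assms(4) by (auto simp: j_def)
    have "G 0 = {0..<0 + 2 * int j} - V \<inter> {0..<t 0}" unfolding G_def I by auto
    then have "num_tilings ({d} \<times> G 0) = (if V \<inter> {0..<t 0} = {} then 1 else 0)"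
      using V(2) I by (simp only:) (rule num_tilings_even_gap[where a = e]; auto)
    then show ?case by simp
  next
    case (Suc l)
    have tl: "t l < t (Suc l)" using mono Suc.prems by simp
    have le: "t i \<le> t l" if "i \<le> l" for i
      using chain_mono[of k t i l] mono that Suc.prems by simp
    have "-1 \<le> t l" using le[of 0] assms(4) by auto
    have "t i \<notin> {t l<..<t (Suc l)}" if "i \<le> l" for i using le[OF that] by simp
    then have "G (Suc l) = G l \<union> ({t l<..<t (Suc l)} - V \<inter> {t l<..<t (Suc l)})"
      using tl \<open>-1 \<le> t l\<close> by (fastforce simp: G_def less_Suc_eq)
    then have "num_tilings ({d} \<times> G (Suc l)) = num_tilings ({d} \<times> G l) *
        num_tilings ({d} \<times> ({t l<..<t (Suc l)} - V \<inter> {t l<..<t (Suc l)}))"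
      by (simp only:) (rule num_tilings_row_Un; auto simp: G_def)
    also have "num_tilings ({d} \<times> ({t l<..<t (Suc l)} - V \<inter> {t l<..<t (Suc l)})) =
        (if card (V \<inter> {t l<..<t (Suc l)}) = 1 then 1 else 0)"
    proof (rule num_tilings_odd_gap)
      show "even (t (Suc l) - t l)"
        using parity[of "Suc l"] parity[of l] Suc.prems by simp
      show "odd (v - t l)" if "v \<in> V \<inter> {t l<..<t (Suc l)}" for v
        using that V(2)[of v] parity[of l] Suc.prems by simp
    qed (use tl in auto)
    finally show ?case using Suc VG[of l] by (simp add: less_Suc_eq) 
  qed
  have le: "t i \<le> t k" if "i \<le> k" for i using chain_mono[of k t i k] mono that by simp
  have "-1 \<le> t k" using le[of 0] assms(4) by auto
  define j where "j = nat ((e - t k) div 2)"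
  have e: "e = t k + 2 * int j" using assms(3) parity[of k] by (simp add: j_def)
  then have I: "{t k<..e} = {t k + 1..<t k + 1 + 2 * int j}" by auto
  have "t i \<notin> {t k<..e}" if "i \<le> k" for i using le[OF that] by simp
  then have "{0..e} - t ` {..k} - V = G k \<union> ({t k<..e} - V \<inter> {t k<..e})"
    using assms(3) \<open>-1 \<le> t k\<close> by (fastforce simp: G_def le_less)
  then have "num_tilings ({d} \<times> ({0..e} - t ` {..k} - V)) =
      num_tilings ({d} \<times> G k) * num_tilings ({d} \<times> ({t k<..e} - V \<inter> {t k<..e}))"
    by (simp only:) (rule num_tilings_row_Un; auto simp: G_def)
  also have "num_tilings ({d} \<times> ({t k<..e} - V \<inter> {t k<..e})) =
      (if V \<inter> {t k<..e} = {} then 1 else 0)"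
    using V(2) I by (simp only:) (rule num_tilings_even_gap[where a = e]; auto)
  finally show ?thesis using G[of k] by simp
qed

text \<open>The sets \<open>V\<close> that contribute have exactly one element in each gap and none
  elsewhere, so they correspond to choice functions. The sum over \<open>PiE\<close> is the form to
  which row-wise summation of determinants applies.\<close>

lemma sum_interlacing:
  fixes t :: "nat \<Rightarrow> int" and f :: "int set \<Rightarrow> nat"
  assumes mono: "\<And>i. i < k \<Longrightarrow> t i < t (Suc i)"
    and parity: "\<And>i. i \<le> k \<Longrightarrow> even (t i - e)"
    and t: "t k \<le> e" "t 0 = -1 \<or> 0 \<le> t 0 \<and> even (t 0)"
  shows "(\<Sum>V\<in>Pow {c\<in>{0..e}. odd (c - e)}. f V * num_tilings ({d} \<times> ({0..e} - t ` {..k} - V))) =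
    (\<Sum>s\<in>PiE {..<k} (\<lambda>i. gap (t i) (t (Suc i))). f (s ` {..<k}))"
proof -
  let ?C = "{c\<in>{0..e}. odd (c - e)}" and ?g = "\<lambda>i. gap (t i) (t (Suc i))"
  define P where "P = (\<lambda>V. V \<inter> {0..<t 0} = {} \<and> V \<inter> {t k<..e} = {} \<and> (\<forall>i<k. card (V \<inter> ?g i) = 1))"
  have finC: "finite ?C" by (rule finite_subset[of _ "{0..e}"]) auto
  have le: "t i \<le> t j" if "i \<le> j" "j \<le> k" for i j
    using chain_mono[of k t i j] mono that by simp
  have "(\<Sum>V\<in>Pow ?C. f V * num_tilings ({d} \<times> ({0..e} - t ` {..k} - V))) =
      (\<Sum>V\<in>Pow ?C. if P V then f V else 0)"
  proof (rule sum.cong[OF refl])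
    fix V assume "V \<in> Pow ?C"
    then have "V \<subseteq> {0..e}" "\<And>v. v \<in> V \<Longrightarrow> odd (v - e)" by auto
    then have "num_tilings ({d} \<times> ({0..e} - t ` {..k} - V)) = (if P V then 1 else 0)"
      unfolding P_def by (intro num_tilings_row[OF mono parity t])
    then show "f V * num_tilings ({d} \<times> ({0..e} - t ` {..k} - V)) = (if P V then f V else 0)"
      by simp
  qed
  also have "\<dots> = (\<Sum>V\<in>{V\<in>Pow ?C. P V}. f V)"
    by (rule sum.inter_filter[symmetric]) (use finC in simp)
  also have "\<dots> = (\<Sum>s\<in>PiE {..<k} ?g. f (s ` {..<k}))"
  proof (rule sum.reindex_bij_betw[symmetric], rule bij_betw_byWitness
      [where f' = "\<lambda>V. \<lambda>i\<in>{..<k}. the_elem (V \<inter> ?g i)"])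
    have img: "s ` {..<k} \<inter> ?g i = {s i}" if s: "s \<in> PiE {..<k} ?g" and i: "i < k" for s i
    proof -
      have "s j \<notin> ?g i" if "j < k" "j \<noteq> i" for j
        using PiE_mem[OF s, of j] that i le[of "Suc i" j] le[of "Suc j" i]
        by (cases "i < j") (auto simp: gap_def)
      moreover have "s i \<in> ?g i" using PiE_mem[OF s, of i] i by simp
      ultimately show ?thesis using i by auto
    qed
    show "\<forall>s\<in>PiE {..<k} ?g. (\<lambda>i\<in>{..<k}. the_elem (s ` {..<k} \<inter> ?g i)) = s"
      using img by (auto simp: fun_eq_iff PiE_iff extensional_def restrict_def)
    show "(\<lambda>s. s ` {..<k}) ` PiE {..<k} ?g \<subseteq> {V\<in>Pow ?C. P V}"
    proof clarify
      fix s assume s: "s \<in> PiE {..<k} ?g"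
      have "0 \<le> s i \<and> s i \<le> e \<and> odd (s i - e) \<and> t 0 \<le> s i \<and> s i \<le> t k" if "i < k" for i
        using PiE_mem[OF s, of i] that le[of 0 i] le[of "Suc i" k] t parity[of i]
        by (auto simp: gap_def)
      then have "s ` {..<k} \<subseteq> ?C" "s ` {..<k} \<inter> {0..<t 0} = {}" "s ` {..<k} \<inter> {t k<..e} = {}"
        by force+
      with img[OF s] show "s ` {..<k} \<in> Pow ?C \<and> P (s ` {..<k})"
        by (simp add: P_def)
    qed
    have inv: "(\<lambda>i\<in>{..<k}. the_elem (V \<inter> ?g i)) ` {..<k} = V \<and>
        (\<lambda>i\<in>{..<k}. the_elem (V \<inter> ?g i)) \<in> PiE {..<k} ?g" if V: "V \<subseteq> ?C" "P V" for V
    proof -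
      have el: "V \<inter> ?g i = {the_elem (V \<inter> ?g i)}" if "i < k" for i
      proof -
        have "card (V \<inter> ?g i) = 1" using V(2) that by (simp add: P_def)
        then obtain x where "V \<inter> ?g i = {x}" by (rule card_1_singletonE)
        then show ?thesis by simp
      qed
      have "\<exists>i<k. c \<in> ?g i" if "c \<in> V" for c
      proof -
        have c: "0 \<le> c" "c \<le> e" "odd (c - e)" using V(1) that by auto
        have "t 0 \<le> c" "c \<le> t k" using V(2) that c by (auto simp: P_def not_less[symmetric])
        moreover have ne: "c \<noteq> t i" if "i \<le> k" for i using c parity[OF that] by auto
        ultimately obtain i where i: "i < k" "t i \<le> c" "c < t (Suc i)"
          using chain_locate[of t c k] by force
        moreover from this have "odd (c - t i)" "t i \<noteq> c"
          using c(3) parity[of i] ne[of i] by auto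
        ultimately show ?thesis by (auto simp: gap_def)
      qed
      then have "V = (\<Union>i<k. V \<inter> ?g i)" by auto
      also have "\<dots> = (\<Union>i<k. {the_elem (V \<inter> ?g i)})" using el by auto
      also have "\<dots> = (\<lambda>i\<in>{..<k}. the_elem (V \<inter> ?g i)) ` {..<k}" by auto
      finally have "(\<lambda>i\<in>{..<k}. the_elem (V \<inter> ?g i)) ` {..<k} = V" by (rule sym)
      moreover have "the_elem (V \<inter> ?g i) \<in> ?g i" if "i < k" for i
        using el[OF that] by blast
      ultimately show ?thesis by auto
    qed
    then show "\<forall>V\<in>{V\<in>Pow ?C. P V}. (\<lambda>i\<in>{..<k}. the_elem (V \<inter> ?g i)) ` {..<k} = V"
      "(\<lambda>V. \<lambda>i\<in>{..<k}. the_elem (V \<inter> ?g i)) ` {V\<in>Pow ?C. P V} \<subseteq> PiE {..<k} ?g"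
      by (simp, blast)
  qed
  finally show ?thesis .
qed

section \<open>Trapezoids with unit dents\<close>

definition trapezoid :: "nat \<Rightarrow> int \<Rightarrow> region" where
  "trapezoid N h = {(r, c). 0 \<le> r \<and> r < h \<and> 0 \<le> c \<and> c \<le> 2 * int N + r}"

definition dented_trapezoid :: "nat \<Rightarrow> int \<Rightarrow> int set \<Rightarrow> region" where
  "dented_trapezoid N h T = trapezoid N h - {h - 1} \<times> T"

lemma finite_trapezoid [simp]: "finite (trapezoid N h)"
  by (rule finite_subset[of _ "{0..h} \<times> {0..2 * int N + h}"]) (auto simp: trapezoid_def)

lemma finite_dented_trapezoid [simp]: "finite (dented_trapezoid N h T)"
  by (simp add: dented_trapezoid_def)

text \<open>If the new bottom row starts with a down-pointing triangle, then \<open>t 0 = -1\<close> is a virtual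
  dent just outside the region.\<close>

lemma num_tilings_dented_trapezoid_Suc:
  fixes t :: "nat \<Rightarrow> int"
  assumes "\<And>i. i < k \<Longrightarrow> t i < t (Suc i)" "\<And>i. i \<le> k \<Longrightarrow> even (t i - int h)"
    and "t k \<le> 2 * int N + int h" "t 0 = -1 \<or> 0 \<le> t 0 \<and> even (t 0)"
    and "0 < h \<or> k = 0"
  shows "num_tilings (dented_trapezoid N (int (Suc h)) (t ` {..k})) =
    (\<Sum>s\<in>PiE {..<k} (\<lambda>i. gap (t i) (t (Suc i))).
       num_tilings (dented_trapezoid N (int h) (s ` {..<k})))"
\<comment> \<open>A single row has no row above it; then \<open>k = 0\<close>, and both sides equal
  1 because the only remaining region on the right is empty.\<close>
proof (cases "h = 0")
  case True
  then have k: "k = 0" using assms(5) by simp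
  have "dented_trapezoid N (int (Suc h)) (t ` {..k}) = {0} \<times> ({0..2 * int N} - t ` {..0} - {})"
    using True k by (auto simp: dented_trapezoid_def trapezoid_def)
  moreover have "num_tilings \<dots> = 1"
    using assms True k by (subst num_tilings_row[where e = "2 * int N"]) auto
  moreover have "dented_trapezoid N (int h) T = {}" for T
    using True by (auto simp: dented_trapezoid_def trapezoid_def)
  ultimately show ?thesis using k by simp
next
  case False
  define e where "e = 2 * int N + int h"
  let ?B = "{int h} \<times> ({0..e} - t ` {..k})"
  let ?C = "{c\<in>{0..e}. odd (c - e)}"
  have te: "even (t i - e)" if "i \<le> k" for i using assms(2)[OF that] by (simp add: e_def)
  have "dented_trapezoid N (int (Suc h)) (t ` {..k}) = trapezoid N (int h) \<union> ?B"
    by (auto simp: dented_trapezoid_def trapezoid_def e_def)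
  moreover have "{c. (int h - 1, c) \<in> trapezoid N (int h) \<and> (int h, c) \<in> ?B \<and> even (int h - 1 + c)} = ?C"
  proof -
    have "c < e" if "c \<le> e" "odd (c - e)" for c using that by (cases "c = e") auto
    then show ?thesis using te False by (auto simp: trapezoid_def e_def; fastforce)
  qed
  moreover have "num_tilings (trapezoid N (int h) \<union> ?B) =
      (\<Sum>V\<in>Pow {c. (int h - 1, c) \<in> trapezoid N (int h) \<and> (int h, c) \<in> ?B \<and> even (int h - 1 + c)}.
         num_tilings (trapezoid N (int h) - {int h - 1} \<times> V) * num_tilings (?B - {int h} \<times> V))"
  proof (rule num_tilings_cut)
    show "r < int h" if "(r, c) \<in> trapezoid N (int h)" for r c
      using that by (simp add: trapezoid_def)
  qed auto
  ultimately have "num_tilings (dented_trapezoid N (int (Suc h)) (t ` {..k})) =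
      (\<Sum>V\<in>Pow ?C. num_tilings (trapezoid N (int h) - {int h - 1} \<times> V) *
         num_tilings (?B - {int h} \<times> V))"
    by (simp only:)
  also have "\<dots> = (\<Sum>V\<in>Pow ?C. num_tilings (dented_trapezoid N (int h) V) *
         num_tilings ({int h} \<times> ({0..e} - t ` {..k} - V)))"
    by (intro sum.cong refl arg_cong2[of _ _ _ _ "(*)"] arg_cong[of _ _ num_tilings])
      (auto simp: dented_trapezoid_def)
  also have "\<dots> = (\<Sum>s\<in>PiE {..<k} (\<lambda>i. gap (t i) (t (Suc i))).
       num_tilings (dented_trapezoid N (int h) (s ` {..<k})))"
    using assms te by (intro sum_interlacing) (auto simp: e_def)
  finally show ?thesis .
qed

text \<open>The value \<open>t j + 1\<close> is the \<open>u\<close> of the overview: columns are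
  measured from \<open>-1\<close>, the place of the virtual dent, and the functions below are even
  or odd about it.\<close>

definition vdm2 :: "nat \<Rightarrow> (nat \<Rightarrow> int) \<Rightarrow> real" where
  "vdm2 k t = (\<Prod>j<k. \<Prod>i<j. (real_of_int (t j + 1))\<^sup>2 - (real_of_int (t i + 1))\<^sup>2)"

text \<open>With differences of \<open>P j\<close> as entries, each sum over a gap telescopes to its
  end points, and row operations then refer all lower end points to \<open>t 0\<close>.\<close>

lemma sum_PiE_gap_det:
  fixes P :: "nat \<Rightarrow> int \<Rightarrow> real"
  assumes "\<And>i. i < k \<Longrightarrow> t i < t (Suc i)" "\<And>i. i < k \<Longrightarrow> even (t (Suc i) - t i)"
  shows "(\<Sum>s\<in>PiE {..<k} (\<lambda>i. gap (t i) (t (Suc i))).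
      det (mat k k (\<lambda>(i, j). P j (s i + 1) - P j (s i - 1)))) =
    det (mat k k (\<lambda>(i, j). P j (t (Suc i)) - P j (t 0)))"
proof -
  have "(\<Sum>s\<in>PiE {..<k} (\<lambda>i. gap (t i) (t (Suc i))).
      det (mat k k (\<lambda>(i, j). P j (s i + 1) - P j (s i - 1)))) =
    det (mat k k (\<lambda>(i, j). \<Sum>c\<in>gap (t i) (t (Suc i)). P j (c + 1) - P j (c - 1)))"
    by (rule sum_det_rows) simp
  also have "mat k k (\<lambda>(i, j). \<Sum>c\<in>gap (t i) (t (Suc i)). P j (c + 1) - P j (c - 1)) =
      mat k k (\<lambda>(i, j). P j (t (Suc i)) - P j (t i))"
    using assms by (intro cong_mat refl) (auto intro!: sum_gap_telescope less_imp_le)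
  also have "det \<dots> = det (mat k k (\<lambda>(i, j). P j (t (Suc i)) - P j (t 0)))"
    by (rule det_row_differences)
  finally show ?thesis .
qed

text \<open>The step from odd to even height. Odd powers of \<open>t + 1\<close> vanish at the
  virtual dent \<open>-1\<close>, so the lower end points drop out, a factor \<open>t + 1\<close>
  leaves every row, and a Vandermonde determinant in the squares remains. The prefactors are leading
  coefficients from \<open>power_difference_polys\<close>.\<close>

lemma sum_gaps_odd_power:
  assumes "\<And>i. i < k \<Longrightarrow> t i < t (Suc i)" "\<And>i. i < k \<Longrightarrow> even (t (Suc i) - t i)" "t 0 = -1"
  shows "(\<Prod>j<k. 2 * (2 * real j + 1)) *
      (\<Sum>s\<in>PiE {..<k} (\<lambda>i. gap (t i) (t (Suc i))). vdm2 k s) =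
    (\<Prod>j<k. real_of_int (t (Suc j) + 1)) * vdm2 k (\<lambda>i. t (Suc i))"
proof -
  define P where "P = (\<lambda>j c. (real_of_int (c + 1)) ^ (2 * j + 1))"
  obtain q where q: "\<And>j. degree (q j) \<le> j" "\<And>j. coeff (q j) j = 2 * (2 * real j + 1)"
    "\<And>j u. (u + 1) ^ (2 * j + 1) - (u - 1) ^ (2 * j + 1) = poly (q j) (u\<^sup>2)"
    using power_difference_polys by metis
  have "(\<Prod>j<k. 2 * (2 * real j + 1)) * vdm2 k s =
      det (mat k k (\<lambda>(i, j). P j (s i + 1) - P j (s i - 1)))" for s
  proof -
    have "P j (s i + 1) - P j (s i - 1) = poly (q j) ((real_of_int (s i + 1))\<^sup>2)" for i j
      using q(3)[of "real_of_int (s i + 1)" j] by (simp add: P_def algebra_simps)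
    then show ?thesis
      using det_poly_vandermonde[of k q "\<lambda>i. (real_of_int (s i + 1))\<^sup>2"] q(1,2)
      by (simp add: vdm2_def)
  qed
  then have "(\<Prod>j<k. 2 * (2 * real j + 1)) *
      (\<Sum>s\<in>PiE {..<k} (\<lambda>i. gap (t i) (t (Suc i))). vdm2 k s) =
      det (mat k k (\<lambda>(i, j). P j (t (Suc i)) - P j (t 0)))"
    unfolding sum_distrib_left using sum_PiE_gap_det[of k t P] assms(1,2) by simp
  also have "\<dots> = det (mat k k (\<lambda>(i, j). real_of_int (t (Suc i) + 1) *
      poly (monom 1 j) ((real_of_int (t (Suc i) + 1))\<^sup>2)))"
    using assms(3) by (intro arg_cong[of _ _ det] cong_mat refl) (auto simp: P_def poly_monom power_mult[symmetric])
  also have "\<dots> = (\<Prod>j<k. real_of_int (t (Suc j) + 1)) *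
      det (mat k k (\<lambda>(i, j). poly (monom 1 j) ((real_of_int (t (Suc i) + 1))\<^sup>2)))"
    by (rule det_scale_rows)
  also have "det (mat k k (\<lambda>(i, j). poly (monom 1 j) ((real_of_int (t (Suc i) + 1))\<^sup>2))) =
      vdm2 k (\<lambda>i. t (Suc i))"
    by (subst det_poly_vandermonde) (auto simp: degree_monom_eq vdm2_def)
  finally show ?thesis .
qed

text \<open>The step from even to odd height. Here \<open>t 0\<close> is a genuine dent: the
  differences of even powers from their value at \<open>t 0\<close> yield exactly the factors that
  extend the Vandermonde product by this node.\<close>

lemma sum_gaps_even_power:
  assumes "\<And>i. i < k \<Longrightarrow> t i < t (Suc i)" "\<And>i. i < k \<Longrightarrow> even (t (Suc i) - t i)"
  shows "(\<Prod>j<k. 2 * (2 * real j + 2)) *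
      (\<Sum>s\<in>PiE {..<k} (\<lambda>i. gap (t i) (t (Suc i))). (\<Prod>j<k. real_of_int (s j + 1)) * vdm2 k s) =
    vdm2 (Suc k) t"
proof -
  define P where "P = (\<lambda>j c. (real_of_int (c + 1)) ^ (2 * j + 2))"
  define c where "c = (real_of_int (t 0 + 1))\<^sup>2"
  obtain q where q: "\<And>j. degree (q j) \<le> j" "\<And>j. coeff (q j) j = 2 * (2 * real j + 2)"
    "\<And>j u. (u + 1) ^ (2 * j + 2) - (u - 1) ^ (2 * j + 2) = u * poly (q j) (u\<^sup>2)"
    using power_difference_polys by metis
  have "(\<Prod>j<k. 2 * (2 * real j + 2)) * ((\<Prod>j<k. real_of_int (s j + 1)) * vdm2 k s) =
      det (mat k k (\<lambda>(i, j). P j (s i + 1) - P j (s i - 1)))" for s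
  proof -
    have "P j (s i + 1) - P j (s i - 1) =
        real_of_int (s i + 1) * poly (q j) ((real_of_int (s i + 1))\<^sup>2)" for i j
      using q(3)[of "real_of_int (s i + 1)" j] by (simp add: P_def algebra_simps)
    then show ?thesis
      using det_poly_vandermonde[of k q "\<lambda>i. (real_of_int (s i + 1))\<^sup>2"] q(1,2)
      by (simp add: det_scale_rows vdm2_def)
  qed
  then have "(\<Prod>j<k. 2 * (2 * real j + 2)) *
      (\<Sum>s\<in>PiE {..<k} (\<lambda>i. gap (t i) (t (Suc i))). (\<Prod>j<k. real_of_int (s j + 1)) * vdm2 k s) =
      det (mat k k (\<lambda>(i, j). P j (t (Suc i)) - P j (t 0)))"
    unfolding sum_distrib_left using sum_PiE_gap_det[of k t P] assms(1,2) by simp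
  also have "\<dots> = det (mat k k (\<lambda>(i, j). ((real_of_int (t (Suc i) + 1))\<^sup>2 - c) *
      poly (\<Sum>l\<le>j. monom (c ^ (j - l)) l) ((real_of_int (t (Suc i) + 1))\<^sup>2)))"
  proof (intro arg_cong[of _ _ det] cong_mat refl, clarify)
    \<comment> \<open>With \<open>v\<close> for the square, \<open>v^(j+1) - c^(j+1)\<close> is
      \<open>v - c\<close> times a monic polynomial of degree \<open>j\<close> in
      \<open>v\<close>.\<close>
    fix i j
    have "((real_of_int (t (Suc i) + 1))\<^sup>2) ^ Suc j - c ^ Suc j =
        ((real_of_int (t (Suc i) + 1))\<^sup>2 - c) *
        poly (\<Sum>l\<le>j. monom (c ^ (j - l)) l) ((real_of_int (t (Suc i) + 1))\<^sup>2)"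
      by (subst power_diff_sumr2) (simp add: poly_sum poly_monom lessThan_Suc_atMost mult.commute)
    then show "P j (t (Suc i)) - P j (t 0) = ((real_of_int (t (Suc i) + 1))\<^sup>2 - c) *
        poly (\<Sum>l\<le>j. monom (c ^ (j - l)) l) ((real_of_int (t (Suc i) + 1))\<^sup>2)"
      unfolding c_def P_def power_mult[symmetric] by (simp only: mult_Suc_right add.commute)
  qed
  also have "\<dots> = (\<Prod>j<k. (real_of_int (t (Suc j) + 1))\<^sup>2 - c) *
      det (mat k k (\<lambda>(i, j). poly (\<Sum>l\<le>j. monom (c ^ (j - l)) l) ((real_of_int (t (Suc i) + 1))\<^sup>2)))"
    by (rule det_scale_rows)
  also have "det (mat k k (\<lambda>(i, j). poly (\<Sum>l\<le>j. monom (c ^ (j - l)) l) ((real_of_int (t (Suc i) + 1))\<^sup>2))) =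
      vdm2 k (\<lambda>i. t (Suc i))"
  proof (subst det_poly_vandermonde)
    show "degree (\<Sum>l\<le>j. monom (c ^ (j - l)) l) \<le> j" for j
      by (intro degree_sum_le) (auto intro: order.trans[OF degree_monom_le])
    have "coeff (\<Sum>l\<le>j. monom (c ^ (j - l)) l) j = 1" for j
      by (simp add: coeff_sum if_distrib cong: if_cong)
    then show "(\<Prod>j<k. coeff (\<Sum>l\<le>j. monom (c ^ (j - l)) l) j) *
        (\<Prod>j<k. \<Prod>i<j. (real_of_int (t (Suc j) + 1))\<^sup>2 - (real_of_int (t (Suc i) + 1))\<^sup>2) =
        vdm2 k (\<lambda>i. t (Suc i))"
      by (simp add: vdm2_def)
  qed
  also have "(\<Prod>j<k. (real_of_int (t (Suc j) + 1))\<^sup>2 - c) * vdm2 k (\<lambda>i. t (Suc i)) = vdm2 (Suc k) t"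
    unfolding vdm2_def c_def
    by (simp add: prod.lessThan_Suc_shift prod.distrib del: prod.lessThan_Suc)
  finally show ?thesis .
qed

text \<open>Each new row divides by the leading coefficients of the polynomials used in its step:
  the even powers for even \<open>h\<close>, the odd ones for odd \<open>h\<close>.\<close>

primrec dent_const :: "nat \<Rightarrow> real" where
  "dent_const 0 = 1"
| "dent_const (Suc h) =
     dent_const h / (\<Prod>j<Suc h div 2. 2 * (2 * real j + (if even h then 2 else 1)))"

text \<open>Induction on the height, alternating between the two summation lemmas. A step to odd
  height raises the number of dents by one; a step to even height keeps it and brings in the linear
  factors.\<close>

lemma num_tilings_dented_trapezoid_chain:
  fixes t :: "nat \<Rightarrow> int"
  assumes "k = Suc h div 2" "\<And>i. Suc i < k \<Longrightarrow> t i < t (Suc i)"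
    and "\<And>i. i < k \<Longrightarrow> even (t i + 1 - int h) \<and> 0 \<le> t i \<and> t i < 2 * int N + int h"
  shows "real (num_tilings (dented_trapezoid N (int h) (t ` {..<k}))) =
    dent_const h * (if even h then \<Prod>j<k. real_of_int (t j + 1) else 1) * vdm2 k t"
  using assms
proof (induction h arbitrary: k t)
  case 0
  then have "dented_trapezoid N (int 0) (t ` {..<k}) = {}" "k = 0"
    by (auto simp: dented_trapezoid_def trapezoid_def)
  then show ?case by (simp add: vdm2_def)
next
  case (Suc h)
  define w where "w = (\<lambda>(k :: nat) s. if even h then \<Prod>j<k. real_of_int (s j + 1) else 1)"
  \<comment> \<open>Peels off the bottom row and applies the induction hypothesis to every
    interlacing \<open>s\<close>; here \<open>t\<close> may start with the virtual dent.\<close>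
  have step: "real (num_tilings (dented_trapezoid N (int (Suc h)) (t ` {..k}))) =
      dent_const h * (\<Sum>s\<in>PiE {..<k} (\<lambda>i. gap (t i) (t (Suc i))). w k s * vdm2 k s)"
    if "k = Suc h div 2" "\<And>i. i < k \<Longrightarrow> t i < t (Suc i)" "\<And>i. i \<le> k \<Longrightarrow> even (t i - int h)"
      "t k \<le> 2 * int N + int h" "t 0 = -1 \<or> 0 \<le> t 0 \<and> even (t 0)" for k and t :: "nat \<Rightarrow> int"
  proof -
    have "real (num_tilings (dented_trapezoid N (int h) (s ` {..<k}))) =
        dent_const h * w k s * vdm2 k s" if s: "s \<in> PiE {..<k} (\<lambda>i. gap (t i) (t (Suc i)))" for s
    proof -
      have sg: "t i < s i \<and> s i < t (Suc i) \<and> odd (s i - t i)" if "i < k" for i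
        using PiE_mem[OF s, of i] that by (simp add: gap_def)
      have bnd: "-1 \<le> t i \<and> t i \<le> 2 * int N + int h" if "i \<le> k" for i
        using chain_mono[of k t 0 i] chain_mono[of k t i k] \<open>\<And>i. i < k \<Longrightarrow> t i < t (Suc i)\<close> that
          \<open>t k \<le> 2 * int N + int h\<close> \<open>t 0 = -1 \<or> 0 \<le> t 0 \<and> even (t 0)\<close> by fastforce
      have "even (s i + 1 - int h) \<and> 0 \<le> s i \<and> s i < 2 * int N + int h" if "i < k" for i
        using sg[OF that] \<open>\<And>i. i \<le> k \<Longrightarrow> even (t i - int h)\<close>[of i] bnd[of i] bnd[of "Suc i"] that
        by auto
      moreover have "s i < s (Suc i)" if "Suc i < k" for i
        using sg[of i] sg[of "Suc i"] that by linarith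
      ultimately show ?thesis
        unfolding w_def using \<open>k = Suc h div 2\<close> by (intro Suc.IH) auto
    qed
    then show ?thesis
      using that(1) by (subst num_tilings_dented_trapezoid_Suc[OF that(2-5)]) (auto simp: sum_distrib_left mult.assoc)
  qed
  have combine: "M = c' * V" if "M = c * S" "X * S = V" "X \<noteq> 0" "c' = c / X" for M c S X V c' :: real
    using that by auto
  show ?case
  proof (cases "even h")
    case True
    define k' where "k' = Suc h div 2"
    have k: "k = Suc k'" using Suc.prems(1) True by (auto simp: k'_def)
    have "real (num_tilings (dented_trapezoid N (int (Suc h)) (t ` {..k'}))) =
        dent_const h * (\<Sum>s\<in>PiE {..<k'} (\<lambda>i. gap (t i) (t (Suc i))). w k' s * vdm2 k' s)"
    proof (rule step)
      show "t i < t (Suc i)" if "i < k'" for i using Suc.prems(2) that k by simp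
      show "even (t i - int h)" if "i \<le> k'" for i using Suc.prems(3)[of i] that k by simp
      show "t k' \<le> 2 * int N + int h" using Suc.prems(3)[of k'] k by simp
      show "t 0 = -1 \<or> 0 \<le> t 0 \<and> even (t 0)" using Suc.prems(3)[of 0] k True by simp
    qed (simp add: k'_def)
    moreover have "(\<Prod>j<k'. 2 * (2 * real j + 2)) *
        (\<Sum>s\<in>PiE {..<k'} (\<lambda>i. gap (t i) (t (Suc i))). w k' s * vdm2 k' s) = vdm2 k t"
      unfolding w_def k using True
    proof (simp only: if_True, intro sum_gaps_even_power)
      show "t i < t (Suc i)" if "i < k'" for i using Suc.prems(2) that k by simp
      show "even (t (Suc i) - t i)" if "i < k'" for i
        using Suc.prems(3)[of i] Suc.prems(3)[of "Suc i"] that k by simp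
    qed
    moreover have "(\<Prod>j<k'. 2 * (2 * real j + 2)) \<noteq> 0" by (simp add: add_eq_0_iff)
    moreover have "dent_const (Suc h) = dent_const h / (\<Prod>j<k'. 2 * (2 * real j + 2))"
      using True by (simp add: k'_def)
    ultimately have "real (num_tilings (dented_trapezoid N (int (Suc h)) (t ` {..k'}))) =
        dent_const (Suc h) * vdm2 k t"
      by (rule combine)
    then show ?thesis using True by (simp add: k lessThan_Suc_atMost del: dent_const.simps)
  next
    case False
    \<comment> \<open>The index \<open>h\<close> of the bottom row is odd, so that row starts with a
      down-pointing triangle and the virtual dent \<open>-1\<close> is put in front. It lies outside
      the trapezoid and does not change the region.\<close>
    define t' where "t' = case_nat (-1) t"
    have k: "k = Suc h div 2" using Suc.prems(1) False by presburger
    have t'_less: "t' i < t' (Suc i)" if "i < k" for i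
      using Suc.prems(2)[of "i - 1"] Suc.prems(3)[of i] that by (cases i) (auto simp: t'_def)
    have t'_par: "even (t' i - int h)" if "i \<le> k" for i
      using Suc.prems(3)[of "i - 1"] that False by (cases i) (auto simp: t'_def)
    have eq: "dented_trapezoid N (int (Suc h)) (t ` {..<k}) = dented_trapezoid N (int (Suc h)) (t' ` {..k})"
      by (auto simp: dented_trapezoid_def t'_def lessThan_Suc_atMost[symmetric] lessThan_Suc_eq_insert_0
        trapezoid_def image_image)
    have "real (num_tilings (dented_trapezoid N (int (Suc h)) (t' ` {..k}))) =
        dent_const h * (\<Sum>s\<in>PiE {..<k} (\<lambda>i. gap (t' i) (t' (Suc i))). w k s * vdm2 k s)"
    proof (rule step)
      show "k = Suc h div 2" by (rule k)
      show "t' i < t' (Suc i)" if "i < k" for i using that by (rule t'_less)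
      show "even (t' i - int h)" if "i \<le> k" for i using that by (rule t'_par)
      show "t' k \<le> 2 * int N + int h" using Suc.prems(3)[of "k - 1"] by (cases k) (auto simp: t'_def)
      show "t' 0 = -1 \<or> 0 \<le> t' 0 \<and> even (t' 0)" by (simp add: t'_def)
    qed
    moreover have "(\<Prod>j<k. 2 * (2 * real j + 1)) *
        (\<Sum>s\<in>PiE {..<k} (\<lambda>i. gap (t' i) (t' (Suc i))). w k s * vdm2 k s) =
        (\<Prod>j<k. real_of_int (t' (Suc j) + 1)) * vdm2 k (\<lambda>i. t' (Suc i))"
    proof -
      have "even (t' (Suc i) - t' i)" if "i < k" for i
        using t'_par[of i] t'_par[of "Suc i"] that by simp
      moreover have "t' 0 = -1" by (simp add: t'_def)
      ultimately show ?thesis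
        using sum_gaps_odd_power[of k t'] t'_less False by (simp add: w_def)
    qed
    moreover have "(\<Prod>j<k. 2 * (2 * real j + 1)) \<noteq> 0" by (simp add: add_eq_0_iff)
    moreover have "dent_const (Suc h) = dent_const h / (\<Prod>j<k. 2 * (2 * real j + 1))"
      using False by (simp add: k)
    ultimately have "real (num_tilings (dented_trapezoid N (int (Suc h)) (t' ` {..k}))) =
        dent_const (Suc h) * ((\<Prod>j<k. real_of_int (t' (Suc j) + 1)) * vdm2 k (\<lambda>i. t' (Suc i)))"
      by (rule combine)
    then show ?thesis using False eq by (simp add: t'_def del: dent_const.simps)
  qed
qed

section \<open>Removed triangles\<close>

text \<open>Just the up-pointing triangles of the bottom row of \<open>up_triangle X d t\<close>
  (for \<open>X + d\<close> even): \<open>t\<close> unit dents.\<close>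

definition up_base :: "int \<Rightarrow> int \<Rightarrow> int \<Rightarrow> region" where
  "up_base X d t = {d - 1} \<times> {c. X < c \<and> c < X + 2 * t \<and> odd (c - X)}"

text \<open>Once the base row of up-pointing triangles is gone, the vertical lozenges above it are
  forced row by row.\<close>

lemma num_tilings_up_base:
  assumes "up_triangle X d (int t) \<subseteq> R" "even (X + d)"
  shows "num_tilings (R - up_base X d (int t)) = num_tilings (R - up_triangle X d (int t))"
  using assms
proof (induction t arbitrary: X d R)
  case 0
  have "up_base X d (int 0) = {}" "up_triangle X d (int 0) = {}"
    by (auto simp: up_base_def up_triangle_def)
  then show ?case by simp
next
  case (Suc t)
  \<comment> \<open>The down-pointing triangle in column \<open>X + 2 * j\<close> of the base row
    has lost both neighbours, so its partner is the triangle above it.\<close>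
  define L where "L = (\<lambda>j :: nat. {(d - 2, X + 2 * int j), (d - 1, X + 2 * int j)})"
  define R' where "R' = R - up_base X d (int (Suc t))"
  define Row where "Row = {d - 1} \<times> {X + 1..X + 2 * int t + 1}"
  have U: "up_triangle X d (int (Suc t)) = Row \<union> up_triangle (X + 1) (d - 1) (int t)"
    by (auto simp: up_triangle_def Row_def)
  have forced: "num_tilings R' = num_tilings (R' - (\<Union>j\<in>{1..m}. L j))" if "m \<le> t" for m
    using that
  proof (induction m)
    case (Suc m)
    let ?R = "R' - (\<Union>j\<in>{1..m}. L j)"
    have "num_tilings ?R = num_tilings (?R - L (Suc m))"
    proof (rule num_tilings_forced)
      have "L (Suc m) \<subseteq> up_triangle X d (int (Suc t))"
        using Suc.prems by (auto simp: L_def up_triangle_def)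
      moreover have "L (Suc m) \<inter> up_base X d (int (Suc t)) = {}" by (auto simp: L_def up_base_def)
      moreover have "L (Suc m) \<inter> (\<Union>j\<in>{1..m}. L j) = {}" by (auto simp: L_def)
      ultimately show "L (Suc m) \<subseteq> ?R" using \<open>up_triangle X d (int (Suc t)) \<subseteq> R\<close> by (auto simp: R'_def)
      show "is_lozenge (L (Suc m))"
        using \<open>even (X + d)\<close> unfolding is_lozenge_def L_def
        by (intro exI[of _ "d - 2"] exI[of _ "X + 2 * int (Suc m)"]) auto
      show "(d - 1, X + 2 * int (Suc m)) \<in> L (Suc m)" by (simp add: L_def)
      fix L' assume L': "is_lozenge L'" "(d - 1, X + 2 * int (Suc m)) \<in> L'" "L' \<subseteq> ?R"
      have "(d - 1, X + 2 * int (Suc m) - 1) \<notin> ?R" "(d - 1, X + 2 * int (Suc m) + 1) \<notin> ?R"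
        using Suc.prems by (auto simp: R'_def up_base_def)
      then have side: "(d - 1, X + 2 * int (Suc m) - 1) \<notin> L'" "(d - 1, X + 2 * int (Suc m) + 1) \<notin> L'"
        using L'(3) by blast+
      from L'(1) show "L' = L (Suc m)" unfolding is_lozenge_def
      proof (elim exE disjE conjE)
        fix r c assume "L' = {(r, c), (r, c + 1)}"
        with L'(2) side show ?thesis by auto
      next
        fix r c assume "even (r + c)" "L' = {(r, c), (r + 1, c)}"
        with L'(2) \<open>even (X + d)\<close> show ?thesis by (auto simp: L_def)
      qed
    qed
    also have "?R - L (Suc m) = R' - (\<Union>j\<in>{1..Suc m}. L j)"
      by (auto simp: atLeastAtMostSuc_conv)
    finally show ?case using Suc by simp
  qed simp
  have "R' - (\<Union>j\<in>{1..t}. L j) = (R - Row) - up_base (X + 1) (d - 1) (int t)"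
  proof -
    \<comment> \<open>The forced lozenges complete the base row and take from the row above exactly
      the base of the triangle of side \<open>t\<close>, so the induction can go on.\<close>
    have "up_base X d (int (Suc t)) \<union> (\<Union>j\<in>{1..t}. L j) = Row \<union> up_base (X + 1) (d - 1) (int t)"
    proof (intro equalityI subsetI)
      fix a assume "a \<in> up_base X d (int (Suc t)) \<union> (\<Union>j\<in>{1..t}. L j)"
      then show "a \<in> Row \<union> up_base (X + 1) (d - 1) (int t)"
        by (auto simp: up_base_def L_def Row_def)
    next
      fix a assume "a \<in> Row \<union> up_base (X + 1) (d - 1) (int t)"
      then obtain c where c: "a = (d - 1, c) \<and> X + 1 \<le> c \<and> c \<le> X + 2 * int t + 1 \<or>
          a = (d - 2, c) \<and> X + 1 < c \<and> c < X + 1 + 2 * int t \<and> even (c - X)"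
        by (auto simp: up_base_def Row_def)
      show "a \<in> up_base X d (int (Suc t)) \<union> (\<Union>j\<in>{1..t}. L j)"
      proof (cases "odd (c - X)")
        case True
        with c show ?thesis by (auto simp: up_base_def)
      next
        case False
        then have "even (c - X)" by simp
        then obtain b where b: "c - X = 2 * b" by (rule evenE)
        moreover have "X + 1 \<le> c" "c \<le> X + 2 * int t + 1" using c by auto
        ultimately have "c = X + 2 * int (nat b)" "nat b \<in> {1..t}" by auto
        moreover from this(1) c have "a \<in> L (nat b)" by (auto simp: L_def)
        ultimately show ?thesis by blast
      qed
    qed
    then show ?thesis unfolding R'_def by blast
  qed
  moreover have "num_tilings ((R - Row) - up_base (X + 1) (d - 1) (int t)) =
      num_tilings ((R - Row) - up_triangle (X + 1) (d - 1) (int t))"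
  proof (rule Suc.IH)
    have "Row \<inter> up_triangle (X + 1) (d - 1) (int t) = {}" by (auto simp: Row_def up_triangle_def)
    then show "up_triangle (X + 1) (d - 1) (int t) \<subseteq> R - Row" using Suc.prems(1) U by blast
    show "even (X + 1 + (d - 1))" using Suc.prems(2) by simp
  qed
  moreover have "R - Row - up_triangle (X + 1) (d - 1) (int t) = R - up_triangle X d (int (Suc t))"
    using U by blast
  ultimately show ?case using forced[of t] by (simp add: R'_def)
qed

lemma up_base_subset: "up_base X d t \<subseteq> up_triangle X d t"
  by (auto simp: up_base_def up_triangle_def)

lemma num_tilings_up_bases:
  assumes "finite I" "\<And>i. i \<in> I \<Longrightarrow> up_triangle (X i) d (int (t i)) \<subseteq> R" "\<And>i. i \<in> I \<Longrightarrow> even (X i + d)"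
    and "\<And>i j. i \<in> I \<Longrightarrow> j \<in> I \<Longrightarrow> i \<noteq> j \<Longrightarrow>
      up_triangle (X i) d (int (t i)) \<inter> up_triangle (X j) d (int (t j)) = {}"
  shows "num_tilings (R - (\<Union>i\<in>I. up_base (X i) d (int (t i)))) =
    num_tilings (R - (\<Union>i\<in>I. up_triangle (X i) d (int (t i))))"
  using assms
proof (induction I arbitrary: R rule: finite_induct)
  case (insert i I)
  let ?b = "\<lambda>i. up_base (X i) d (int (t i))" and ?u = "\<lambda>i. up_triangle (X i) d (int (t i))"
  have disj: "?u i \<inter> ?u j = {}" if "j \<in> I" for j
    using insert.prems(3)[of i j] insert.hyps(2) that by auto
  have "R - (\<Union>j\<in>insert i I. ?b j) = (R - ?b i) - (\<Union>j\<in>I. ?b j)" by auto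
  also have "num_tilings \<dots> = num_tilings ((R - ?b i) - (\<Union>j\<in>I. ?u j))"
  proof (rule insert.IH)
    show "?u j \<subseteq> R - ?b i" if "j \<in> I" for j
      using insert.prems(1)[of j] that disj[OF that] up_base_subset by blast
  qed (use insert.prems in auto)
  also have "(R - ?b i) - (\<Union>j\<in>I. ?u j) = (R - (\<Union>j\<in>I. ?u j)) - ?b i" by auto
  also have "num_tilings \<dots> = num_tilings ((R - (\<Union>j\<in>I. ?u j)) - ?u i)"
  proof (rule num_tilings_up_base)
    show "?u i \<subseteq> R - (\<Union>j\<in>I. ?u j)" using insert.prems(1)[of i] disj by blast
    show "even (X i + d)" using insert.prems(2) by simp
  qed
  also have "(R - (\<Union>j\<in>I. ?u j)) - ?u i = R - (\<Union>j\<in>insert i I. ?u j)" by auto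
  finally show ?case .
qed simp

text \<open>The \<open>k\<close>-th unit segment (from the left, starting with 0) of a lattice line of depth
  congruent to \<open>p\<close> modulo 2 is the base of the unit triangle in this column.\<close>

definition dent_col :: "nat \<Rightarrow> nat \<Rightarrow> int" where
  "dent_col p k = 2 * int k + 1 - int p"

lemma inj_dent_col: "inj (dent_col p)"
  by (auto simp: dent_col_def inj_def)

text \<open>For \<open>k >= 1\<close> and \<open>p <= 1\<close>, the height \<open>2 * k - p\<close>
  is the one of parity \<open>p\<close> at which exactly \<open>k\<close> dents are needed for
  balance.\<close>

definition dented :: "nat \<Rightarrow> nat \<Rightarrow> nat \<Rightarrow> nat set \<Rightarrow> region" where
  "dented p N k K = dented_trapezoid N (2 * int k - int p) (dent_col p ` K)"

lemma up_base_col: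
  "up_base (2 * int P - int p) d (int e) = {d - 1} \<times> dent_col p ` {P..<P + e}"
proof -
  have "{c. 2 * int P - int p < c \<and> c < 2 * int P - int p + 2 * int e \<and>
      odd (c - (2 * int P - int p))} = dent_col p ` {P..<P + e}"
  proof (intro equalityI subsetI)
    fix c assume c: "c \<in> {c. 2 * int P - int p < c \<and> c < 2 * int P - int p + 2 * int e \<and>
      odd (c - (2 * int P - int p))}"
    define k where "k = nat ((c - 1 + int p) div 2)"
    have "c = dent_col p k" "P \<le> k" "k < P + e" using c by (auto simp: k_def dent_col_def; presburger)+
    then show "c \<in> dent_col p ` {P..<P + e}" by auto
  qed (auto simp: dent_col_def)
  then show ?thesis by (simp add: up_base_def)
qed

text \<open>Turns removed triangles into sets of unit dents, for which the product formula is
  available; \<open>S\<close> collects further unit dents along the same line.\<close>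

lemma num_tilings_dented_triangles:
  assumes "finite I" "p \<le> 1" "\<And>i. i \<in> I \<Longrightarrow> P i + e i \<le> N + k" "\<And>i. i \<in> I \<Longrightarrow> e i \<le> k"
    and disj: "\<And>i j. i \<in> I \<Longrightarrow> j \<in> I \<Longrightarrow> i \<noteq> j \<Longrightarrow> {P i..<P i + e i} \<inter> {P j..<P j + e j} = {}"
    and S: "\<And>i. i \<in> I \<Longrightarrow> S \<inter> {P i..<P i + e i} = {}"
  shows "num_tilings (dented p N k S - (\<Union>i\<in>I. up_triangle (2 * int (P i) - int p) (2 * int k - int p) (int (e i)))) =
    num_tilings (dented p N k (S \<union> (\<Union>i\<in>I. {P i..<P i + e i})))"
proof -
  let ?h = "2 * int k - int p"
  let ?u = "\<lambda>i. up_triangle (2 * int (P i) - int p) ?h (int (e i))"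
  have "num_tilings (dented p N k S - (\<Union>i\<in>I. ?u i)) =
      num_tilings (dented p N k S - (\<Union>i\<in>I. up_base (2 * int (P i) - int p) ?h (int (e i))))"
  proof (rule num_tilings_up_bases[symmetric])
    show "?u i \<subseteq> dented p N k S" if "i \<in> I" for i
    proof
      fix a assume "a \<in> ?u i"
      then obtain r c where a: "a = (r, c)" "r < ?h" "2 * int (P i) - int p + (?h - r) \<le> c"
        "c \<le> 2 * int (P i) - int p + 2 * int (e i) - (?h - r)"
        by (auto simp: up_triangle_def)
      have e: "e i \<ge> 1" using a(2-4) by linarith
      have "c \<notin> dent_col p ` S" if "r = ?h - 1"
      proof
        assume "c \<in> dent_col p ` S"
        then obtain s where s: "s \<in> S" "c = dent_col p s" by auto
        then have "P i \<le> s" "s < P i + e i" using a(3,4) that by (auto simp: dent_col_def)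
        with S[OF \<open>i \<in> I\<close>] s(1) show False by auto
      qed
      moreover have "(r, c) \<in> trapezoid N ?h"
        using a assms(2) assms(3,4)[OF \<open>i \<in> I\<close>] e by (auto simp: trapezoid_def)
      ultimately show "a \<in> dented p N k S" by (auto simp: a(1) dented_def dented_trapezoid_def)
    qed
    show "?u i \<inter> ?u j = {}" if "i \<in> I" "j \<in> I" "i \<noteq> j" for i j
    proof -
      have "P i + e i \<le> P j \<or> P j + e j \<le> P i \<or> e i = 0 \<or> e j = 0"
        using disj[OF that] by (auto simp: ivl_disj_int_two) 
      then show ?thesis by (auto simp: up_triangle_def)
    qed
  qed (use assms in auto)
  also have "dented p N k S - (\<Union>i\<in>I. up_base (2 * int (P i) - int p) ?h (int (e i))) =
      dented p N k (S \<union> (\<Union>i\<in>I. {P i..<P i + e i}))"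
    unfolding dented_def dented_trapezoid_def up_base_col by auto
  finally show ?thesis .
qed

text \<open>The product for an increasing chain of dents, rewritten for the set of its positions, so
  that unions of dents need no common enumeration.\<close>

definition dent_weight :: "nat \<Rightarrow> nat set \<Rightarrow> real" where
  "dent_weight p K = (\<Prod>b\<in>K. (if p = 0 then 2 * real b + 2 else 1) *
     (\<Prod>a\<in>{a\<in>K. a < b}. (2 * real b + 2 - real p)\<^sup>2 - (2 * real a + 2 - real p)\<^sup>2))"

text \<open>Closed form of \<open>dent_const\<close> at height \<open>2 * k - p\<close>.\<close>

definition dent_factor :: "nat \<Rightarrow> nat \<Rightarrow> real" where
  "dent_factor p k = (if p = 0 then 1 / (2 ^ (k * k) * real (hyper2 (2 * k + 1)))
     else 1 / (2 ^ (k * (k - 1)) * real (hyper2 (2 * k))))"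

lemma prod_two_step_fact: "(\<Prod>j<k. 2 * (2 * real j + 1)) * (\<Prod>j<k. 2 * (2 * real j + 2)) = 4 ^ k * fact (2 * k)"
  by (induction k) (simp_all add: field_simps)

lemma hyper2_Suc: "hyper2 (2 * Suc k) = hyper2 (2 * k) * fact (2 * k)"
  "hyper2 (2 * Suc k + 1) = hyper2 (2 * k + 1) * fact (2 * k + 1)"
  by (simp_all add: hyper2_def)

text \<open>Two consecutive rows together divide by a power of 4 times a factorial, by
  \<open>prod_two_step_fact\<close>; this is the ratio of successive values of
  \<open>dent_factor 1\<close>. The even heights in between need only the odd product.\<close>

lemma dent_const_eq:
  "dent_const (2 * k) = dent_factor 0 k \<and> dent_const (2 * k + 1) = dent_factor 1 (Suc k)"
proof (induction k)
  case 0
  then show ?case by (simp add: dent_factor_def hyper2_def)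
next
  case (Suc k)
  have hyp: "real (hyper2 n) \<noteq> 0" for n by (simp add: hyper2_def)
  have nz: "(\<Prod>j<k. 2 * (2 * real j + 1)) \<noteq> 0" "(\<Prod>j<k. 2 * (2 * real j + 2)) \<noteq> 0" for k
    by (simp_all add: add_eq_0_iff)
  \<comment> \<open>The odd product turns \<open>hyper2\<close> at an even argument into
    \<open>hyper2\<close> at the next odd one, which relates the two parities of the height.\<close>
  have p: "(\<Prod>j<k. 2 * (2 * real j + 1)) * 2 ^ (k * (k - 1)) * hyper2 (2 * k) =
      (2 :: real) ^ (k * k) * real (hyper2 (2 * k + 1))" for k
  proof (induction k)
    case (Suc k)
    have "2 ^ (Suc k * (Suc k - 1)) = (2 ^ (k * (k - 1)) * 2 ^ (2 * k) :: real)"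
      by (cases k) (simp_all add: power_add[symmetric] algebra_simps)
    moreover have "real (hyper2 (2 * Suc k)) = real (hyper2 (2 * k)) * fact (2 * k)"
      unfolding hyper2_Suc by simp
    ultimately have "(\<Prod>j<Suc k. 2 * (2 * real j + 1)) * 2 ^ (Suc k * (Suc k - 1)) * hyper2 (2 * Suc k) =
        ((\<Prod>j<k. 2 * (2 * real j + 1)) * 2 ^ (k * (k - 1)) * hyper2 (2 * k)) *
        (2 * (2 * real k + 1) * 2 ^ (2 * k) * fact (2 * k))"
      by (simp only: prod.lessThan_Suc mult_ac)
    also have "\<dots> = (2 :: real) ^ (k * k) * real (hyper2 (2 * k + 1)) * (2 * (2 * real k + 1) * 2 ^ (2 * k) * fact (2 * k))"
      by (simp only: Suc)
    also have "\<dots> = (2 ^ (k * k) * 2 ^ (2 * k) * 2) * (hyper2 (2 * k + 1) * ((2 * real k + 1) * fact (2 * k)))"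
      by simp
    also have "2 ^ (k * k) * 2 ^ (2 * k) * 2 = (2 ^ (Suc k * Suc k) :: real)"
      by (simp add: power_add[symmetric] algebra_simps)
    also have "hyper2 (2 * k + 1) * ((2 * real k + 1) * fact (2 * k)) = hyper2 (2 * Suc k + 1)"
      unfolding hyper2_Suc by (simp add: algebra_simps)
    finally show ?case .
  qed (simp add: hyper2_def)
  have q: "dent_factor 0 k = dent_factor 1 k / (\<Prod>j<k. 2 * (2 * real j + 1))" for k
    using p[of k] nz[of k] hyp by (simp add: dent_factor_def field_simps del: prod_zero_iff)
  have "dent_const (2 * Suc k) = dent_const (2 * k + 1) / (\<Prod>j<Suc k. 2 * (2 * real j + 1))"
    by simp
  then have 1: "dent_const (2 * Suc k) = dent_factor 0 (Suc k)"
    unfolding q[of "Suc k"] using Suc by (simp del: dent_const.simps)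
  have "dent_const (2 * Suc k + 1) = dent_const (2 * Suc k) / (\<Prod>j<Suc k. 2 * (2 * real j + 2))"
    by simp
  also have "\<dots> = dent_factor 1 (Suc k) / (4 ^ Suc k * fact (2 * Suc k))"
    using nz[of "Suc k"] unfolding 1 q[of "Suc k"] prod_two_step_fact[symmetric]
    by (simp del: prod_zero_iff)
  also have "\<dots> = dent_factor 1 (Suc (Suc k))"
  proof -
    have "2 ^ (Suc (Suc k) * (Suc (Suc k) - 1)) = (2 ^ (Suc k * (Suc k - 1)) * 4 ^ Suc k :: real)"
    proof -
      have "(4 :: real) ^ Suc k = 2 ^ (2 * Suc k)" by (simp only: power_mult) simp
      then show ?thesis by (simp only: power_add[symmetric]) (simp add: algebra_simps)
    qed
    moreover have "real (hyper2 (2 * Suc (Suc k))) = real (hyper2 (2 * Suc k)) * fact (2 * Suc k)"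
      by (simp only: hyper2_Suc(1)[of "Suc k"] of_nat_mult of_nat_fact)
    ultimately show ?thesis
      by (simp only: dent_factor_def) (simp only: one_neq_zero if_False divide_divide_eq_left mult_ac)
  qed
  finally show ?case using 1 by (rule conjI[rotated])
qed

text \<open>The chain formula is applied to the increasing enumeration of \<open>K\<close>. The
  bottom line has \<open>N + card K\<close> unit segments, which bounds the positions.\<close>

lemma num_tilings_dented:
  assumes "p \<le> 1" "finite K" "K \<subseteq> {..<N + card K}"
  shows "real (num_tilings (dented p N (card K) K)) = dent_factor p (card K) * dent_weight p K"
\<comment> \<open>Without dents the height is 0 or \<open>-1\<close>; the region is empty in both
  cases.\<close>
proof (cases "card K = 0")
  case True
  then have K: "K = {}" using assms(2) by simp
  have "dented p N 0 {} = {}" by (auto simp: dented_def dented_trapezoid_def trapezoid_def)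
  then show ?thesis by (simp add: K dent_factor_def hyper2_def dent_weight_def)
next
  case False
  define k where "k = card K"
  define h where "h = 2 * k - p"
  define l where "l = (\<lambda>i. sorted_list_of_set K ! i)"
  define t where "t = dent_col p \<circ> l"
  have k: "k \<ge> 1" using False by (simp add: k_def)
  have h: "int h = 2 * int k - int p" using k assms(1) by (simp add: h_def)
  have len: "length (sorted_list_of_set K) = k" using assms(2) by (simp add: k_def)
  have l_mono: "l i < l j" if "i < j" "j < k" for i j
    unfolding l_def using that strict_sorted_list_of_set[of K] len
    by (simp add: sorted_wrt_nth_less)
  have l_img: "l ` {..<k} = K"
  proof -
    have "set (sorted_list_of_set K) = l ` {..<k}" unfolding l_def set_conv_nth len by auto
    then show ?thesis using assms(2) by simp
  qed
  have inj: "inj_on l {..<k}"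
    by (rule linorder_inj_onI) (use l_mono in fastforce)+
  have "real (num_tilings (dented_trapezoid N (int h) (t ` {..<k}))) =
      dent_const h * (if even h then \<Prod>j<k. real_of_int (t j + 1) else 1) * vdm2 k t"
  proof (rule num_tilings_dented_trapezoid_chain)
    show "k = Suc h div 2" using k assms(1) by (auto simp: h_def le_Suc_eq)
    show "t i < t (Suc i)" if "Suc i < k" for i using l_mono[of i "Suc i"] that by (simp add: t_def dent_col_def)
    fix i assume "i < k"
    then have "l i < N + k" using l_img assms(3) by (auto simp: k_def)
    then show "even (t i + 1 - int h) \<and> 0 \<le> t i \<and> t i < 2 * int N + int h"
      using assms(1) h by (auto simp: t_def dent_col_def)
  qed
  moreover have "dented_trapezoid N (int h) (t ` {..<k}) = dented p N k K"
    by (simp add: dented_def h t_def l_img[symmetric] image_image)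
  moreover have "dent_const h = dent_factor p k"
  proof (cases "p = 0")
    case True
    then show ?thesis using dent_const_eq[of k] by (simp add: h_def)
  next
    case False
    then have "p = 1" "h = 2 * (k - 1) + 1" "k = Suc (k - 1)" using assms(1) k by (auto simp: h_def)
    then show ?thesis using dent_const_eq[of "k - 1"] by (simp del: dent_const.simps)
  qed
  moreover have "(if even h then \<Prod>j<k. real_of_int (t j + 1) else 1) * vdm2 k t = dent_weight p K"
  proof -
    have "dent_weight p K = (\<Prod>j<k. (if p = 0 then 2 * real (l j) + 2 else 1) *
        (\<Prod>a\<in>{a\<in>K. a < l j}. (2 * real (l j) + 2 - real p)\<^sup>2 - (2 * real a + 2 - real p)\<^sup>2))"
      unfolding dent_weight_def by (subst prod.reindex[OF inj, unfolded l_img]) simp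
    also have "\<dots> = (\<Prod>j<k. (if p = 0 then 2 * real (l j) + 2 else 1) *
        (\<Prod>i<j. (2 * real (l j) + 2 - real p)\<^sup>2 - (2 * real (l i) + 2 - real p)\<^sup>2))"
    proof (rule prod.cong[OF refl], rule arg_cong2[where f = "(*)", OF refl])
      fix j assume "j \<in> {..<k}"
      moreover have "i < j" if "l i < l j" "i < k" for i
        using that l_mono[of j i] by (cases i j rule: linorder_cases) auto
      ultimately have "{a\<in>K. a < l j} = l ` {..<j}"
        using l_mono by (auto simp flip: l_img)
      moreover have "inj_on l {..<j}" using inj \<open>j \<in> {..<k}\<close> by (auto intro: inj_on_subset)
      ultimately show "(\<Prod>a\<in>{a\<in>K. a < l j}. (2 * real (l j) + 2 - real p)\<^sup>2 - (2 * real a + 2 - real p)\<^sup>2) =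
          (\<Prod>i<j. (2 * real (l j) + 2 - real p)\<^sup>2 - (2 * real (l i) + 2 - real p)\<^sup>2)"
        by (simp add: prod.reindex)
    qed
    also have "\<dots> = (if even h then \<Prod>j<k. real_of_int (t j + 1) else 1) * vdm2 k t"
    proof -
      have "even h \<longleftrightarrow> p = 0" using assms(1) k by (auto simp: h_def le_Suc_eq)
      then show ?thesis by (simp add: prod.distrib vdm2_def t_def dent_col_def algebra_simps)
    qed
    finally show ?thesis by simp
  qed
  ultimately show ?thesis by (simp add: k_def)
qed

lemma hyper2_pos: "0 < hyper2 n"
  by (simp add: hyper2_def prod_pos)

lemma dent_factor_pos: "0 < dent_factor p k"
  by (simp add: dent_factor_def hyper2_pos)

lemma dent_weight_pos:
  assumes "p \<le> 1"
  shows "0 < dent_weight p K"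
  unfolding dent_weight_def
proof (intro prod_pos mult_pos_pos)
  fix a b assume "a \<in> {a\<in>K. a < b}"
  then have "(2 * real a + 2 - real p)\<^sup>2 < (2 * real b + 2 - real p)\<^sup>2"
    using assms by (intro power_strict_mono) auto
  then show "0 < (2 * real b + 2 - real p)\<^sup>2 - (2 * real a + 2 - real p)\<^sup>2" by simp
qed (auto simp: add_pos_nonneg)

text \<open>Balance determines the number of dents. Instead of counting the triangles of the
  trapezoid, \<open>K\<close> is compared with \<open>{..<k}\<close>, whose number of tilings is
  positive by the product formula.\<close>

lemma card_dented:
  assumes "p \<le> 1" "1 \<le> k" "K \<subseteq> {..<N + k}" "num_tilings (dented p N k K) \<noteq> 0"
  shows "card K = k"
proof -
  let ?T = "trapezoid N (2 * int k - int p)"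
  have count: "card K + card {(r, c)\<in>?T. odd (r + c)} = card {(r, c)\<in>?T. even (r + c)}"
    if K: "K \<subseteq> {..<N + k}" "num_tilings (dented p N k K) \<noteq> 0" for K
  proof -
    let ?D = "{2 * int k - int p - 1} \<times> dent_col p ` K"
    have fin: "finite K" using K(1) by (rule finite_subset) simp
    have "card {(r, c)\<in>dented p N k K. even (r + c)} = card {(r, c)\<in>dented p N k K. odd (r + c)}"
      using K(2) by (intro num_tilings_balanced) (simp_all add: dented_def)
    moreover have "{(r, c)\<in>dented p N k K. odd (r + c)} = {(r, c)\<in>?T. odd (r + c)}"
      by (auto simp: dented_def dented_trapezoid_def dent_col_def)
    moreover have "{(r, c)\<in>?T. even (r + c)} = {(r, c)\<in>dented p N k K. even (r + c)} \<union> ?D"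
      using assms(1,2) K(1) by (auto simp: dented_def dented_trapezoid_def dent_col_def trapezoid_def)
    moreover have "card ({(r, c)\<in>dented p N k K. even (r + c)} \<union> ?D) =
        card {(r, c)\<in>dented p N k K. even (r + c)} + card ?D"
    proof (rule card_Un_disjoint)
      show "finite {(r, c)\<in>dented p N k K. even (r + c)}"
        by (rule finite_subset[of _ ?T]) (auto simp: dented_def dented_trapezoid_def)
    qed (use fin in \<open>auto simp: dented_def dented_trapezoid_def\<close>)
    moreover have "card ?D = card K"
      by (simp add: card_cartesian_product card_image inj_on_subset[OF inj_dent_col])
    ultimately show ?thesis by simp
  qed
  have "real (num_tilings (dented p N k {..<k})) \<noteq> 0"
    using num_tilings_dented[of p "{..<k}" N] assms(1) dent_factor_pos[of p k] dent_weight_pos[of p "{..<k}"]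
    by simp
  then have "card K = card {..<k}"
    using count[of K] count[of "{..<k}"] assms(3,4) by auto
  then show ?thesis by simp
qed

section \<open>Partial sums and the positions of the removed triangles\<close>

lemma part_sum_0 [simp]: "part_sum t 0 = 0"
  by (simp add: part_sum_def)

lemma part_sum_Suc: "part_sum t (Suc i) = part_sum t i + entry t (Suc i)"
  by (simp add: part_sum_def)

lemma part_sum_mono: "i \<le> j \<Longrightarrow> part_sum t i \<le> part_sum t j"
  by (rule lift_Suc_mono_le) (simp_all add: part_sum_Suc)

lemma part_sum_pred: "1 \<le> i \<Longrightarrow> part_sum t i = part_sum t (i - 1) + entry t i"
  using part_sum_Suc[of t "i - 1"] by simp

lemma part_sum_beyond:
  assumes "length t \<le> c"
  shows "part_sum t c = part_sum t (length t)"
  unfolding part_sum_def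
  by (rule sum.mono_neutral_right) (use assms in \<open>auto simp: entry_def\<close>)

lemma part_sum_length: "part_sum t (length t) = odd_sum t + even_sum t"
proof -
  have "{1..length t} = {i \<in> {1..length t}. odd i} \<union> {i \<in> {1..length t}. even i}" by auto
  then have "part_sum t (length t) =
      sum (entry t) ({i \<in> {1..length t}. odd i} \<union> {i \<in> {1..length t}. even i})"
    by (simp only: part_sum_def)
  also have "\<dots> = odd_sum t + even_sum t"
    unfolding odd_sum_def even_sum_def by (rule sum.union_disjoint) auto
  finally show ?thesis .
qed

lemma part_sum_le: "part_sum t i \<le> odd_sum t + even_sum t"
  using part_sum_mono[of i "length t" t] part_sum_beyond[of t i] part_sum_length[of t]
  by (cases "i \<le> length t") auto

lemma entry_le_odd_sum: "odd i \<Longrightarrow> entry t i \<le> odd_sum t"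
  unfolding odd_sum_def
  by (cases "i \<in> {1..length t}") (auto simp: entry_def intro: member_le_sum)

lemma entry_le_even_sum: "even i \<Longrightarrow> entry t i \<le> even_sum t"
  unfolding even_sum_def
  by (cases "i \<in> {1..length t}") (auto simp: entry_def intro: member_le_sum)

definition even_blocks :: "nat list \<Rightarrow> nat set" where
  "even_blocks t = (\<Union>i\<in>{i\<in>{1..length t}. even i}. {part_sum t (i - 1)..<part_sum t (i - 1) + entry t i})"

lemma blocks_disjoint:
  assumes "1 \<le> i" "1 \<le> j" "i \<noteq> j"
  shows "{part_sum t (i - 1)..<part_sum t (i - 1) + entry t i} \<inter>
    {part_sum t (j - 1)..<part_sum t (j - 1) + entry t j} = {}"
proof -
  have "part_sum t i \<le> part_sum t (j - 1) \<or> part_sum t j \<le> part_sum t (i - 1)"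
    using assms part_sum_mono[of i "j - 1" t] part_sum_mono[of j "i - 1" t] by fastforce
  then show ?thesis using part_sum_pred[of i t] part_sum_pred[of j t] assms by auto
qed

lemma card_even_blocks: "card (even_blocks t) = even_sum t"
proof -
  have "card (even_blocks t) = (\<Sum>i\<in>{i\<in>{1..length t}. even i}.
      card {part_sum t (i - 1)..<part_sum t (i - 1) + entry t i})"
    unfolding even_blocks_def by (rule card_UN_disjoint) (use blocks_disjoint in auto)
  then show ?thesis by (simp add: even_sum_def)
qed

lemma even_blocks_subset: "even_blocks t \<subseteq> {..<odd_sum t + even_sum t}"
proof
  fix k assume "k \<in> even_blocks t"
  then obtain i where "1 \<le> i" "k < part_sum t (i - 1) + entry t i" by (auto simp: even_blocks_def)
  then show "k \<in> {..<odd_sum t + even_sum t}"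
    using part_sum_pred[of i t] part_sum_le[of t i] by auto
qed

lemma finite_even_blocks [simp]: "finite (even_blocks t)"
  by (rule finite_subset[OF even_blocks_subset]) simp

text \<open>Covers both counts of the theorem at once: \<open>p = 0\<close> gives Q and
  \<open>p = 1\<close> gives K.\<close>

lemma num_tilings_dented_quarter:
  assumes "p \<le> 1"
  shows "real (num_tilings (dented_quarter (2 * int (even_sum t) - int p) t)) =
    dent_factor p (even_sum t) * dent_weight p (even_blocks t)"
proof -
  let ?I = "{i\<in>{1..length t}. even i}" and ?h = "2 * int (even_sum t) - int p"
  \<comment> \<open>The southern side starts at minus the parity of its depth, that is at
    \<open>-p\<close>, which is the origin used by \<open>dent_col p\<close>.\<close>
  have "(2 * int k - 1) mod 2 = 1" for k by presburger
  then have mod: "?h mod 2 = int p" using assms by (auto simp: le_Suc_eq)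
  let ?B = "\<lambda>i. {part_sum t (i - 1)..<part_sum t (i - 1) + entry t i}"
  have "dented_quarter ?h t = dented p (odd_sum t) (even_sum t) {} -
      (\<Union>i\<in>?I. up_triangle (2 * int (part_sum t (i - 1)) - int p) ?h (int (entry t i)))"
    unfolding dented_quarter_def mod by (simp add: dented_def dented_trapezoid_def trapezoid_def)
  moreover have "num_tilings (dented p (odd_sum t) (even_sum t) {} -
      (\<Union>i\<in>?I. up_triangle (2 * int (part_sum t (i - 1)) - int p) ?h (int (entry t i)))) =
    num_tilings (dented p (odd_sum t) (even_sum t) ({} \<union> (\<Union>i\<in>?I. ?B i)))"
  proof (rule num_tilings_dented_triangles)
    show "part_sum t (i - 1) + entry t i \<le> odd_sum t + even_sum t" if "i \<in> ?I" for i
      using that part_sum_pred[of i t] part_sum_le[of t i] by auto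
    show "entry t i \<le> even_sum t" if "i \<in> ?I" for i using that entry_le_even_sum by auto
    show "?B i \<inter> ?B j = {}" if "i \<in> ?I" "j \<in> ?I" "i \<noteq> j" for i j
      using that by (intro blocks_disjoint) auto
    show "finite ?I" by simp
    show "p \<le> 1" by (rule assms)
    show "{} \<inter> ?B i = {}" for i by (rule Int_empty_left)
  qed
  moreover have "{} \<union> (\<Union>i\<in>?I. ?B i) = even_blocks t"
    by (simp only: even_blocks_def Un_empty_left)
  ultimately have "num_tilings (dented_quarter ?h t) =
      num_tilings (dented p (odd_sum t) (card (even_blocks t)) (even_blocks t))"
    by (simp only: card_even_blocks)
  moreover have "real (num_tilings (dented p (odd_sum t) (card (even_blocks t)) (even_blocks t))) =
      dent_factor p (card (even_blocks t)) * dent_weight p (even_blocks t)"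
    by (rule num_tilings_dented) (use assms even_blocks_subset[of t] in \<open>simp_all add: card_even_blocks\<close>)
  ultimately show ?thesis by (simp only: card_even_blocks)
qed

text \<open>The removed triangles of \<open>R_region\<close> sit on the last segments before \<open>X\<close>, read from right to left.\<close>

definition fern_block :: "nat list \<Rightarrow> nat \<Rightarrow> nat \<Rightarrow> nat set" where
  "fern_block a X i = {X - part_sum a i..<X - part_sum a i + entry a i}"

definition odd_fern :: "nat list \<Rightarrow> nat \<Rightarrow> nat set" where
  "odd_fern a X = (\<Union>i\<in>{i\<in>{1..length a}. odd i}. fern_block a X i)"

definition even_fern :: "nat list \<Rightarrow> nat \<Rightarrow> nat set" where
  "even_fern a X = (\<Union>i\<in>{i\<in>{1..length a}. even i}. fern_block a X i)"

lemma fern_block_eq: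
  assumes "1 \<le> i" "odd_sum a + even_sum a \<le> X"
  shows "fern_block a X i = {X - part_sum a i..<X - part_sum a (i - 1)}"
  using part_sum_pred[of i a] part_sum_le[of a i] assms by (simp add: fern_block_def)

lemma fern_block_disjoint:
  assumes "1 \<le> i" "1 \<le> j" "i \<noteq> j" "odd_sum a + even_sum a \<le> X"
  shows "fern_block a X i \<inter> fern_block a X j = {}"
proof -
  have "part_sum a i \<le> part_sum a (j - 1) \<or> part_sum a j \<le> part_sum a (i - 1)"
    using assms part_sum_mono[of i "j - 1" a] part_sum_mono[of j "i - 1" a] by fastforce
  then have "X - part_sum a (j - 1) \<le> X - part_sum a i \<or> X - part_sum a (i - 1) \<le> X - part_sum a j"
    by auto
  then show ?thesis using fern_block_eq assms by fastforce
qed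

lemma fern_Un:
  assumes "odd_sum a + even_sum a \<le> X"
  shows "odd_fern a X \<union> even_fern a X = {X - (odd_sum a + even_sum a)..<X}"
proof -
  have "(\<Union>i\<in>{1..n}. fern_block a X i) = {X - part_sum a n..<X}" for n
  proof (induction n)
    case (Suc n)
    have "(\<Union>i\<in>{1..Suc n}. fern_block a X i) = fern_block a X (Suc n) \<union> {X - part_sum a n..<X}"
      using Suc by (auto simp: atLeastAtMostSuc_conv)
    also have "\<dots> = {X - part_sum a (Suc n)..<X - part_sum a n} \<union> {X - part_sum a n..<X}"
      using fern_block_eq[OF _ assms, of "Suc n"] by simp
    also have "\<dots> = {X - part_sum a (Suc n)..<X}"
      using part_sum_mono[of n "Suc n" a] by (intro ivl_disj_un_two) auto
    finally show ?case .
  qed simp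
  from this[of "length a"] have "(\<Union>i\<in>{1..length a}. fern_block a X i) = {X - (odd_sum a + even_sum a)..<X}"
    by (simp add: part_sum_length)
  moreover have "odd_fern a X \<union> even_fern a X = (\<Union>i\<in>{1..length a}. fern_block a X i)"
    by (auto simp: odd_fern_def even_fern_def)
  ultimately show ?thesis by simp
qed

lemma fern_Int:
  assumes "odd_sum a + even_sum a \<le> X"
  shows "odd_fern a X \<inter> even_fern a X = {}"
proof -
  have "fern_block a X i \<inter> fern_block a X j = {}" if "odd i" "even j" "1 \<le> i" "1 \<le> j" for i j
    using that assms by (intro fern_block_disjoint) auto
  then show ?thesis unfolding odd_fern_def even_fern_def by fastforce
qed

lemma card_fern:
  assumes "odd_sum a + even_sum a \<le> X"
  shows "card (odd_fern a X) = odd_sum a" "card (even_fern a X) = even_sum a"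
proof -
  have *: "card (\<Union>i\<in>I. fern_block a X i) = (\<Sum>i\<in>I. entry a i)" if "I \<subseteq> {1..length a}" for I
  proof -
    have "card (\<Union>i\<in>I. fern_block a X i) = (\<Sum>i\<in>I. card (fern_block a X i))"
    proof (rule card_UN_disjoint)
      show "finite I" using that by (rule finite_subset) simp
      show "\<forall>i\<in>I. \<forall>j\<in>I. i \<noteq> j \<longrightarrow> fern_block a X i \<inter> fern_block a X j = {}"
        using that assms by (intro ballI impI fern_block_disjoint) auto
    qed (simp add: fern_block_def)
    then show ?thesis by (simp add: fern_block_def)
  qed
  show "card (odd_fern a X) = odd_sum a" "card (even_fern a X) = even_sum a"
    unfolding odd_fern_def even_fern_def odd_sum_def even_sum_def by (intro *; auto)+
qed

section \<open>Cutting the region along the fern\<close>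

lemma finite_fern [simp]: "finite (odd_fern a X)" "finite (even_fern a X)"
  by (simp_all add: odd_fern_def even_fern_def fern_block_def)

text \<open>The lower triangle of a vertical lozenge becomes the upper one, in row
  \<open>h - 2 - r\<close>; its parity is again the right one because \<open>h\<close> is
  even.\<close>

lemma is_lozenge_reflect:
  assumes "even h" "is_lozenge L"
  shows "is_lozenge ((\<lambda>(r, c). (h - 1 - r, c)) ` L)"
proof -
  let ?f = "\<lambda>(r, c). (h - 1 - r, c)"
  from assms(2)[unfolded is_lozenge_def] show ?thesis
  proof (elim exE disjE conjE)
    fix r c assume "L = {(r, c), (r, c + 1)}"
    then have "?f ` L = {(h - 1 - r, c), (h - 1 - r, c + 1)}" by simp
    then show ?thesis unfolding is_lozenge_def by blast
  next
    fix r c assume "even (r + c)" "L = {(r, c), (r + 1, c)}"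
    then have "?f ` L = {(h - 2 - r, c), (h - 2 - r + 1, c)}" "even (h - 2 - r + c)"
      using assms(1) by auto
    then show ?thesis unfolding is_lozenge_def by blast
  qed
qed

text \<open>The region is cut along the line of the removed triangles; the part below is reflected. The
  corner of the lower part beyond the right end of that line becomes one more removed triangle,
  of side \<open>z\<close>.\<close>

lemma R_region_split:
  fixes x y z m p :: nat and a :: "nat list"
  assumes "y + p = 2 * m + 1" "p \<le> 1"
  defines "X \<equiv> x + m + odd_sum a + even_sum a"
  defines "l \<equiv> 2 * int (odd_sum a + m) - int p" and "l' \<equiv> 2 * int (even_sum a + z + m) - int p"
  defines "A \<equiv> trapezoid (x + even_sum a) l -
      (\<Union>i\<in>{i\<in>{1..length a}. odd i}. up_triangle (2 * int (X - part_sum a i) - int p) l (int (entry a i)))"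
    and "B' \<equiv> trapezoid (x + odd_sum a) l' -
      (\<Union>i\<in>{i\<in>{1..length a}. even i}. up_triangle (2 * int (X - part_sum a i) - int p) l' (int (entry a i))) -
      up_triangle (2 * int X - int p) l' (int z)"
  assumes "0 \<le> l" "0 \<le> l'"
  shows "R_region x y z a = A \<union> (\<lambda>(r, c). (l + l' - 1 - r, c)) ` B'"
proof -
  define N v h where "N = int x + int (even_sum a)"
    and "v = int y + int z + 2 * int (odd_sum a) - 1"
    and "h = 2 * (int y + int z + int (part_sum a (length a)) - 1)"
  have y: "int y = 2 * int m + 1 - int p" using assms(1) by linarith
  have v: "v = l + int z" and h: "h = l + l'" and VN: "2 * N + 2 * v - h = 2 * int (x + odd_sum a)"
    and XN: "2 * N + l = 2 * int X - int p"
    by (simp_all add: N_def v_def h_def l_def l'_def y part_sum_length X_def)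
  have left: "2 * N + (v - int z) - 2 * int (part_sum a i) = 2 * int (X - part_sum a i) - int p" for i
  proof -
    have "part_sum a i \<le> X" using part_sum_le[of a i] by (simp add: X_def)
    then show ?thesis using XN v by (simp add: of_nat_diff)
  qed
  have vl: "v - int z = l" using v by simp
  let ?U = "\<lambda>i. up_triangle (2 * int (X - part_sum a i) - int p) l (int (entry a i))"
  let ?D = "\<lambda>i. down_triangle (2 * int (X - part_sum a i) - int p) l (int (entry a i))"
  let ?U' = "\<lambda>i. up_triangle (2 * int (X - part_sum a i) - int p) l' (int (entry a i))"
  have "R_region x y z a = {(r, c). 0 \<le> r \<and> r < h \<and> 0 \<le> c \<and> c \<le> 2 * N + r \<and> c \<le> 2 * N + 2 * v - r - 1}
      - (\<Union>i\<in>{i\<in>{1..length a}. odd i}. ?U i) - (\<Union>i\<in>{i\<in>{1..length a}. even i}. ?D i)"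
    unfolding R_region_def Let_def N_def[symmetric] v_def[symmetric] h_def[symmetric] left
    unfolding vl by simp
  then have R: "(r, c) \<in> R_region x y z a \<longleftrightarrow>
      0 \<le> r \<and> r < h \<and> 0 \<le> c \<and> c \<le> 2 * N + r \<and> c \<le> 2 * N + 2 * v - r - 1 \<and>
      (\<forall>i\<in>{i\<in>{1..length a}. odd i}. (r, c) \<notin> ?U i) \<and>
      (\<forall>i\<in>{i\<in>{1..length a}. even i}. (r, c) \<notin> ?D i)" for r c
    by auto
  have im: "(r, c) \<in> (\<lambda>(r, c). (l + l' - 1 - r, c)) ` B' \<longleftrightarrow> (l + l' - 1 - r, c) \<in> B'" for r c
    by (force simp: image_iff)
  have DU: "(r, c) \<in> ?D i \<longleftrightarrow> l \<le> r \<and> (l + l' - 1 - r, c) \<in> ?U' i" for r c i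
    by (auto simp: down_triangle_def up_triangle_def)
  have D: "(r, c) \<notin> ?D i" if "r < l" for r c i using that by (simp add: down_triangle_def)
  have U: "(r, c) \<notin> ?U i" if "l \<le> r" for r c i using that by (simp add: up_triangle_def)
  \<comment> \<open>Prolonged up to the cut, the southeastern side encloses more than the region:
    the surplus lies between it and the northeastern side, and has side \<open>z\<close> because
    these sides meet \<open>z\<close> rows below the cut.\<close>
  have corner: "(l + l' - 1 - r, c) \<in> up_triangle (2 * int X - int p) l' (int z) \<longleftrightarrow>
      l \<le> r \<and> 2 * N + r < c \<and> c \<le> 2 * N + 2 * v - r - 1" for r c
    using XN VN h v by (auto simp: up_triangle_def)
  have memB: "(r, c) \<in> B' \<longleftrightarrow> 0 \<le> r \<and> r < l' \<and> 0 \<le> c \<and> c \<le> 2 * int (x + odd_sum a) + r \<and>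
      (\<forall>i\<in>{i\<in>{1..length a}. even i}. (r, c) \<notin> ?U' i) \<and>
      (r, c) \<notin> up_triangle (2 * int X - int p) l' (int z)" for r c
    by (auto simp: B'_def trapezoid_def)
  have memA: "(r, c) \<in> A \<longleftrightarrow> 0 \<le> r \<and> r < l \<and> 0 \<le> c \<and> c \<le> 2 * N + r \<and>
      (\<forall>i\<in>{i\<in>{1..length a}. odd i}. (r, c) \<notin> ?U i)" for r c
    by (auto simp: A_def trapezoid_def N_def)
  have "(r, c) \<in> R_region x y z a \<longleftrightarrow> (r, c) \<in> A \<union> (\<lambda>(r, c). (l + l' - 1 - r, c)) ` B'" for r c
  proof (cases "r < l")
    case True
    then have "(l + l' - 1 - r, c) \<notin> B'" by (auto simp: B'_def trapezoid_def)
    moreover have "r < h" "c \<le> 2 * N + r \<Longrightarrow> c \<le> 2 * N + 2 * v - r - 1"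
      using True h v \<open>0 \<le> l'\<close> by auto
    ultimately show ?thesis
      using True D unfolding Un_iff R im memA by blast
  next
    case False
    define F where "F \<longleftrightarrow> (\<forall>i\<in>{i\<in>{1..length a}. even i}. (r, c) \<notin> ?D i)"
    have F: "(\<forall>i\<in>{i\<in>{1..length a}. even i}. (l + l' - 1 - r, c) \<notin> ?U' i) \<longleftrightarrow> F"
      using DU False by (simp add: F_def)
    have "c \<le> 2 * int (x + odd_sum a) + (l + l' - 1 - r) \<longleftrightarrow> c \<le> 2 * N + 2 * v - r - 1"
      "0 \<le> l + l' - 1 - r \<longleftrightarrow> r < h" "l + l' - 1 - r < l'" "l \<le> r"
      using False VN h by linarith+
    then have "(l + l' - 1 - r, c) \<in> B' \<longleftrightarrow>
        r < h \<and> 0 \<le> c \<and> c \<le> 2 * N + 2 * v - r - 1 \<and> c \<le> 2 * N + r \<and> F"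
      unfolding memB corner F by auto
    moreover note \<open>0 \<le> l\<close>
    ultimately show ?thesis
      using False U[of r c] unfolding Un_iff R im memA F_def[symmetric] by auto
  qed
  then show ?thesis by auto
qed

lemma num_tilings_top:
  fixes x m p :: nat and a :: "nat list"
  assumes "p \<le> 1"
  defines "X \<equiv> x + m + odd_sum a + even_sum a"
  defines "l \<equiv> 2 * int (odd_sum a + m) - int p"
  assumes "S \<subseteq> {..<x + m}"
  shows "num_tilings (trapezoid (x + even_sum a) l -
      (\<Union>i\<in>{i\<in>{1..length a}. odd i}. up_triangle (2 * int (X - part_sum a i) - int p) l (int (entry a i))) -
      {l - 1} \<times> dent_col p ` S) =
    num_tilings (dented p (x + even_sum a) (odd_sum a + m) (S \<union> odd_fern a X))"
proof -
  have X: "odd_sum a + even_sum a \<le> X" by (simp add: X_def)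
  let ?I = "{i\<in>{1..length a}. odd i}"
  have "num_tilings (dented p (x + even_sum a) (odd_sum a + m) S -
      (\<Union>i\<in>?I. up_triangle (2 * int (X - part_sum a i) - int p) (2 * int (odd_sum a + m) - int p) (int (entry a i)))) =
    num_tilings (dented p (x + even_sum a) (odd_sum a + m)
      (S \<union> (\<Union>i\<in>?I. {X - part_sum a i..<X - part_sum a i + entry a i})))"
  proof (rule num_tilings_dented_triangles)
    fix i assume i: "i \<in> ?I"
    show "X - part_sum a i + entry a i \<le> x + even_sum a + (odd_sum a + m)"
      using i part_sum_pred[of i a] part_sum_le[of a i] by (simp add: X_def)
    show "entry a i \<le> odd_sum a + m" using entry_le_odd_sum[of i a] i by simp
    show "S \<inter> {X - part_sum a i..<X - part_sum a i + entry a i} = {}"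
    proof -
      have "x + m \<le> X - part_sum a i" using part_sum_le[of a i] by (simp add: X_def)
      then show ?thesis using assms(4) by fastforce
    qed
    fix j assume "j \<in> ?I" "i \<noteq> j"
    with i X show "{X - part_sum a i..<X - part_sum a i + entry a i} \<inter>
        {X - part_sum a j..<X - part_sum a j + entry a j} = {}"
      using fern_block_disjoint[of i j a X] by (simp add: fern_block_def)
  qed (use assms in auto)
  also have "(\<Union>i\<in>?I. {X - part_sum a i..<X - part_sum a i + entry a i}) = odd_fern a X"
    by (simp only: odd_fern_def fern_block_def)
  also have "dented p (x + even_sum a) (odd_sum a + m) S -
      (\<Union>i\<in>?I. up_triangle (2 * int (X - part_sum a i) - int p) (2 * int (odd_sum a + m) - int p) (int (entry a i))) =
      trapezoid (x + even_sum a) l -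
      (\<Union>i\<in>?I. up_triangle (2 * int (X - part_sum a i) - int p) l (int (entry a i))) -
      {l - 1} \<times> dent_col p ` S"
    by (auto simp: dented_def dented_trapezoid_def l_def)
  finally show ?thesis .
qed

lemma num_tilings_bottom:
  fixes x z m p :: nat and a :: "nat list"
  assumes "p \<le> 1"
  defines "X \<equiv> x + m + odd_sum a + even_sum a"
  defines "l' \<equiv> 2 * int (even_sum a + z + m) - int p"
  assumes "S \<subseteq> {..<x + m}"
  shows "num_tilings (trapezoid (x + odd_sum a) l' -
      (\<Union>i\<in>{i\<in>{1..length a}. even i}. up_triangle (2 * int (X - part_sum a i) - int p) l' (int (entry a i))) -
      up_triangle (2 * int X - int p) l' (int z) -
      {l' - 1} \<times> dent_col p ` S) =
    num_tilings (dented p (x + odd_sum a) (even_sum a + z + m) (S \<union> (even_fern a X \<union> {X..<X + z})))"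
proof -
  have X: "odd_sum a + even_sum a \<le> X" by (simp add: X_def)
  let ?J = "{i\<in>{1..length a}. even i}"
  define e where "e = (\<lambda>i. if i = 0 then z else entry a i)"
  let ?B = "\<lambda>i. {X - part_sum a i..<X - part_sum a i + e i}"
  have eJ: "e i = entry a i" if "i \<in> ?J" for i using that by (auto simp: e_def)
  have block: "?B i \<subseteq> {x + m..<X}" if "i \<in> ?J" for i
    using eJ[OF that] that part_sum_pred[of i a] part_sum_le[of a i] by (auto simp: X_def)
  have B0: "?B 0 = {X..<X + z}" by (simp add: e_def)
  have "num_tilings (dented p (x + odd_sum a) (even_sum a + z + m) S -
      (\<Union>i\<in>insert 0 ?J. up_triangle (2 * int (X - part_sum a i) - int p) (2 * int (even_sum a + z + m) - int p) (int (e i)))) =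
    num_tilings (dented p (x + odd_sum a) (even_sum a + z + m) (S \<union> (\<Union>i\<in>insert 0 ?J. ?B i)))"
  proof (rule num_tilings_dented_triangles)
    fix i assume i: "i \<in> insert 0 ?J"
    show "X - part_sum a i + e i \<le> x + odd_sum a + (even_sum a + z + m)"
      using i part_sum_pred[of i a] part_sum_le[of a i] by (auto simp: X_def e_def)
    show "e i \<le> even_sum a + z + m" using entry_le_even_sum[of i a] i by (auto simp: e_def)
    show "S \<inter> ?B i = {}"
      using i assms(4) block[of i] B0 by (fastforce simp: X_def)
    fix j assume j: "j \<in> insert 0 ?J" "i \<noteq> j"
    show "?B i \<inter> ?B j = {}"
    proof (cases "i = 0 \<or> j = 0")
      case True
      then show ?thesis using i j block[of i] block[of j] B0 by fastforce
    next
      case False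
      then show ?thesis
        using i j X fern_block_disjoint[of i j a X] eJ[of i] eJ[of j] by (simp add: fern_block_def)
    qed
  qed (use assms in auto)
  also have "(\<Union>i\<in>insert 0 ?J. ?B i) = even_fern a X \<union> {X..<X + z}"
    using eJ B0 by (auto simp: even_fern_def fern_block_def)
  also have "dented p (x + odd_sum a) (even_sum a + z + m) S -
      (\<Union>i\<in>insert 0 ?J. up_triangle (2 * int (X - part_sum a i) - int p) (2 * int (even_sum a + z + m) - int p) (int (e i))) =
      trapezoid (x + odd_sum a) l' -
      (\<Union>i\<in>?J. up_triangle (2 * int (X - part_sum a i) - int p) l' (int (entry a i))) -
      up_triangle (2 * int X - int p) l' (int z) - {l' - 1} \<times> dent_col p ` S"
    using eJ by (auto simp: dented_def dented_trapezoid_def l'_def e_def)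
  finally show ?thesis .
qed

lemma up_triangle_base_row:
  "(d - 1, dent_col p k) \<in> up_triangle (2 * int P - int p) d (int e) \<longleftrightarrow> P \<le> k \<and> k < P + e"
  by (auto simp: up_triangle_def dent_col_def)

text \<open>Every lozenge across the cut is a unit dent, at the same position, of both halves. The
  two lower bounds give both halves at least one row, also for \<open>p = 1\<close>.\<close>

lemma num_tilings_R_region:
  fixes x y z m p :: nat and a :: "nat list"
  assumes "y + p = 2 * m + 1" "p \<le> 1" "1 \<le> odd_sum a + m" "1 \<le> even_sum a + z + m"
  defines "X \<equiv> x + m + odd_sum a + even_sum a"
  shows "num_tilings (R_region x y z a) = (\<Sum>S\<in>Pow {..<x + m}.
    num_tilings (dented p (x + even_sum a) (odd_sum a + m) (S \<union> odd_fern a X)) *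
    num_tilings (dented p (x + odd_sum a) (even_sum a + z + m) (S \<union> (even_fern a X \<union> {X..<X + z}))))"
proof -
  define l l' where "l = 2 * int (odd_sum a + m) - int p" and "l' = 2 * int (even_sum a + z + m) - int p"
  define A where "A = trapezoid (x + even_sum a) l -
    (\<Union>i\<in>{i\<in>{1..length a}. odd i}. up_triangle (2 * int (X - part_sum a i) - int p) l (int (entry a i)))"
  define B' where "B' = trapezoid (x + odd_sum a) l' -
    (\<Union>i\<in>{i\<in>{1..length a}. even i}. up_triangle (2 * int (X - part_sum a i) - int p) l' (int (entry a i))) -
    up_triangle (2 * int X - int p) l' (int z)"
  define f where "f = (\<lambda>(r, c :: int). (l + l' - 1 - r, c))"
  have l: "1 \<le> l" "1 \<le> l'" using assms(2-4) by (auto simp: l_def l'_def)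
  have R: "R_region x y z a = A \<union> f ` B'"
    unfolding A_def B'_def f_def l_def l'_def X_def
    by (rule R_region_split) (use assms(1,2) l in \<open>auto simp: l_def l'_def\<close>)
  have fB: "(r, c) \<in> f ` M \<longleftrightarrow> (l + l' - 1 - r, c) \<in> M" for r c M
    by (force simp: f_def image_iff)
  let ?C = "{c. (l - 1, c) \<in> A \<and> (l, c) \<in> f ` B' \<and> even (l - 1 + c)}"
  have Xs: "odd_sum a + even_sum a \<le> X" "X - (odd_sum a + even_sum a) = x + m" by (simp_all add: X_def)
  have memA: "(l - 1, dent_col p k) \<in> A \<longleftrightarrow> k < X \<and> k \<notin> odd_fern a X" for k
  proof -
    have "(l - 1, dent_col p k) \<in> trapezoid (x + even_sum a) l \<longleftrightarrow> k < X"
      using l assms(2) by (auto simp: trapezoid_def dent_col_def l_def X_def)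
    then show ?thesis by (auto simp: A_def up_triangle_base_row odd_fern_def fern_block_def)
  qed
  have memB: "(l, dent_col p k) \<in> f ` B' \<longleftrightarrow> k < X \<and> k \<notin> even_fern a X" for k
  proof -
    have "(l' - 1, dent_col p k) \<in> trapezoid (x + odd_sum a) l' \<longleftrightarrow> k < X + z"
      using l assms(2) by (auto simp: trapezoid_def dent_col_def l'_def X_def)
    moreover have "k < X" if "k \<in> even_fern a X" using fern_Un[OF Xs(1)] that by auto
    moreover have "l + l' - 1 - l = l' - 1" by simp
    ultimately show ?thesis
      unfolding fB by (auto simp: B'_def up_triangle_base_row even_fern_def fern_block_def)
  qed
  \<comment> \<open>A position under the fern is blocked in one of the two halves, and beyond
    \<open>X\<close> the upper half has ended; only the \<open>x + m\<close> positions left of the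
    fern stay free.\<close>
  have "?C = dent_col p ` {..<x + m}"
  proof (intro equalityI subsetI)
    fix c assume c: "c \<in> ?C"
    then have "0 \<le> c" "even (l - 1 + c)" by (auto simp: A_def trapezoid_def)
    then have ev: "even (c - 1 + int p)" by (simp add: l_def) blast
    then have "0 \<le> c - 1 + int p"
      using \<open>0 \<le> c\<close> assms(2) by (cases "c = 0"; cases "p = 0") auto
    moreover from ev obtain k where "c - 1 + int p = 2 * k" by (rule evenE)
    ultimately have "c - 1 + int p = 2 * k" "0 \<le> k" by simp_all
    then have k: "c = dent_col p (nat k)" by (simp add: dent_col_def)
    with c memA[of "nat k"] memB[of "nat k"]
    have "nat k < X" "nat k \<notin> odd_fern a X \<union> even_fern a X" by auto
    then have "nat k < x + m" using fern_Un[OF Xs(1)] Xs(2) by auto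
    with k show "c \<in> dent_col p ` {..<x + m}" by auto
  next
    fix c assume "c \<in> dent_col p ` {..<x + m}"
    then obtain k where k: "c = dent_col p k" "k < x + m" by auto
    then have "k < X" "k \<notin> odd_fern a X \<union> even_fern a X" using fern_Un[OF Xs(1)] Xs(2) by (auto simp: X_def)
    then show "c \<in> ?C" using k memA[of k] memB[of k] by (simp add: l_def dent_col_def)
  qed
  moreover have "num_tilings (A \<union> f ` B') =
      (\<Sum>V\<in>Pow ?C. num_tilings (A - {l - 1} \<times> V) * num_tilings (f ` B' - {l} \<times> V))"
  proof (rule num_tilings_cut)
    show "finite A" "finite (f ` B')" by (simp_all add: A_def B'_def)
    show "r < l" if "(r, c) \<in> A" for r c using that by (auto simp: A_def trapezoid_def)
    show "l \<le> r" if "(r, c) \<in> f ` B'" for r c using that unfolding fB by (auto simp: B'_def trapezoid_def)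
  qed
  ultimately have "num_tilings (R_region x y z a) =
      (\<Sum>V\<in>(`) (dent_col p) ` Pow {..<x + m}. num_tilings (A - {l - 1} \<times> V) * num_tilings (f ` B' - {l} \<times> V))"
    unfolding R by (simp only: image_Pow_surj[OF refl])
  also have "\<dots> = (\<Sum>S\<in>Pow {..<x + m}. num_tilings (A - {l - 1} \<times> dent_col p ` S) *
      num_tilings (f ` B' - {l} \<times> dent_col p ` S))"
  proof (rule sum.reindex_cong[where l = "(`) (dent_col p)"])
    show "inj_on ((`) (dent_col p)) (Pow {..<x + m})"
      by (meson inj_dent_col inj_image_eq_iff inj_onI)
  qed auto
  also have "\<dots> = (\<Sum>S\<in>Pow {..<x + m}.
    num_tilings (dented p (x + even_sum a) (odd_sum a + m) (S \<union> odd_fern a X)) *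
    num_tilings (dented p (x + odd_sum a) (even_sum a + z + m) (S \<union> (even_fern a X \<union> {X..<X + z}))))"
  proof (rule sum.cong[OF refl])
    fix S assume "S \<in> Pow {..<x + m}"
    then have S: "S \<subseteq> {..<x + m}" by simp
    have "num_tilings (A - {l - 1} \<times> dent_col p ` S) =
        num_tilings (dented p (x + even_sum a) (odd_sum a + m) (S \<union> odd_fern a X))"
      unfolding A_def l_def X_def by (rule num_tilings_top[OF assms(2) S])
    moreover have "num_tilings (f ` B' - {l} \<times> dent_col p ` S) =
        num_tilings (dented p (x + odd_sum a) (even_sum a + z + m) (S \<union> (even_fern a X \<union> {X..<X + z})))"
    proof -
      have "f ` B' - {l} \<times> dent_col p ` S = f ` (B' - {l' - 1} \<times> dent_col p ` S)"
      proof -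
        have "(r, c) \<in> f ` B' - {l} \<times> dent_col p ` S \<longleftrightarrow> (r, c) \<in> f ` (B' - {l' - 1} \<times> dent_col p ` S)"
          for r c unfolding fB Diff_iff by auto
        then show ?thesis by (intro equalityI subrelI) blast+
      qed
      also have "num_tilings \<dots> = num_tilings (B' - {l' - 1} \<times> dent_col p ` S)"
      proof (rule num_tilings_involution)
        show "finite (B' - {l' - 1} \<times> dent_col p ` S)" by (simp add: B'_def)
        show "f (f t) = t" for t by (simp add: f_def split: prod.splits)
        have "even (l + l')" by (simp add: l_def l'_def)
        then show "is_lozenge (f ` L)" if "is_lozenge L" for L
          unfolding f_def using that by (rule is_lozenge_reflect)
      qed
      also have "\<dots> = num_tilings (dented p (x + odd_sum a) (even_sum a + z + m) (S \<union> (even_fern a X \<union> {X..<X + z})))"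
        unfolding B'_def l'_def X_def by (rule num_tilings_bottom[OF assms(2) S])
      finally show ?thesis .
    qed
    ultimately show "num_tilings (A - {l - 1} \<times> dent_col p ` S) * num_tilings (f ` B' - {l} \<times> dent_col p ` S) =
        num_tilings (dented p (x + even_sum a) (odd_sum a + m) (S \<union> odd_fern a X)) *
        num_tilings (dented p (x + odd_sum a) (even_sum a + z + m) (S \<union> (even_fern a X \<union> {X..<X + z})))"
      by simp
  qed
  finally show ?thesis .
qed

section \<open>Separating free dents from forced ones\<close>

definition dent_cross :: "nat \<Rightarrow> nat set \<Rightarrow> nat set \<Rightarrow> real" where
  "dent_cross p S D = (\<Prod>d\<in>D. \<Prod>s\<in>S. (2 * real d + 2 - real p)\<^sup>2 - (2 * real s + 2 - real p)\<^sup>2)"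

text \<open>As \<open>S\<close> lies entirely to the left of \<open>D\<close>, the larger element of
  every mixed pair is in \<open>D\<close>, so the mixed factors are those of
  \<open>dent_cross\<close> with the correct sign.\<close>

lemma dent_weight_Un:
  assumes "finite S" "finite D" "\<And>s d. s \<in> S \<Longrightarrow> d \<in> D \<Longrightarrow> s < d"
  shows "dent_weight p (S \<union> D) = dent_weight p S * dent_weight p D * dent_cross p S D"
proof -
  let ?w = "\<lambda>b. if p = 0 then 2 * real b + 2 else 1"
  let ?g = "\<lambda>b a. (2 * real b + 2 - real p)\<^sup>2 - (2 * real a + 2 - real p)\<^sup>2"
  have disj: "S \<inter> D = {}" using assms(3) by fastforce
  have "dent_weight p (S \<union> D) = (\<Prod>b\<in>S. ?w b * (\<Prod>a\<in>{a\<in>S \<union> D. a < b}. ?g b a)) *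
      (\<Prod>b\<in>D. ?w b * (\<Prod>a\<in>{a\<in>S \<union> D. a < b}. ?g b a))"
    unfolding dent_weight_def by (rule prod.union_disjoint) (use assms disj in auto)
  also have "(\<Prod>b\<in>S. ?w b * (\<Prod>a\<in>{a\<in>S \<union> D. a < b}. ?g b a)) = dent_weight p S"
    unfolding dent_weight_def
  proof (rule prod.cong[OF refl])
    fix b assume "b \<in> S"
    then have "{a\<in>S \<union> D. a < b} = {a\<in>S. a < b}" using assms(3) by fastforce
    then show "?w b * (\<Prod>a\<in>{a\<in>S \<union> D. a < b}. ?g b a) = ?w b * (\<Prod>a\<in>{a\<in>S. a < b}. ?g b a)" by simp
  qed
  also have "(\<Prod>b\<in>D. ?w b * (\<Prod>a\<in>{a\<in>S \<union> D. a < b}. ?g b a)) =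
      (\<Prod>b\<in>D. (?w b * (\<Prod>a\<in>{a\<in>D. a < b}. ?g b a)) * (\<Prod>a\<in>S. ?g b a))"
  proof (rule prod.cong[OF refl])
    fix b assume "b \<in> D"
    then have "{a\<in>S \<union> D. a < b} = {a\<in>D. a < b} \<union> S" using assms(3) by auto
    moreover have "prod (?g b) ({a\<in>D. a < b} \<union> S) = prod (?g b) {a\<in>D. a < b} * prod (?g b) S"
      by (rule prod.union_disjoint) (use assms disj in auto)
    ultimately show "?w b * (\<Prod>a\<in>{a\<in>S \<union> D. a < b}. ?g b a) =
        (?w b * (\<Prod>a\<in>{a\<in>D. a < b}. ?g b a)) * (\<Prod>a\<in>S. ?g b a)" by simp
  qed
  also have "\<dots> = dent_weight p D * dent_cross p S D"
    by (simp only: dent_weight_def dent_cross_def prod.distrib)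
  finally show ?thesis by simp
qed

lemma dent_cross_Un:
  assumes "finite D" "finite D'" "D \<inter> D' = {}"
  shows "dent_cross p S (D \<union> D') = dent_cross p S D * dent_cross p S D'"
  unfolding dent_cross_def by (rule prod.union_disjoint) (use assms in auto)

text \<open>A discrete analogue of a Selberg integral. The square arises because both halves have
  the dents \<open>S\<close>; the remaining factor is a product of weights of the single elements of
  \<open>S\<close>.\<close>

definition selberg_sum :: "nat \<Rightarrow> nat \<Rightarrow> nat \<Rightarrow> nat \<Rightarrow> real" where
  "selberg_sum p n m L =
     (\<Sum>S\<in>{S. S \<subseteq> {..<n} \<and> card S = m}. (dent_weight p S)\<^sup>2 * dent_cross p S {n..<n + L})"

lemma selberg_sum_0: "selberg_sum p n 0 L = 1"
proof -
  have "{S. S \<subseteq> {..<n} \<and> card S = 0} = {{}}"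
    by (auto simp: card_eq_0_iff finite_subset[OF _ finite_lessThan])
  then show ?thesis by (simp add: selberg_sum_def dent_weight_def dent_cross_def)
qed

text \<open>The removed triangles together with the corner occupy all of \<open>{n..<n + L}\<close>, hence their
  individual sizes only enter through the factors outside the sum.\<close>

lemma real_num_tilings_R_region:
  fixes x y z m p :: nat and a :: "nat list"
  assumes "y + p = 2 * m + 1" "p \<le> 1" "1 \<le> odd_sum a + m" "1 \<le> even_sum a + z + m"
  defines "X \<equiv> x + m + odd_sum a + even_sum a"
  shows "real (num_tilings (R_region x y z a)) =
    dent_factor p (odd_sum a + m) * dent_weight p (odd_fern a X) *
    (dent_factor p (even_sum a + z + m) * dent_weight p (even_fern a X \<union> {X..<X + z})) *
    selberg_sum p (x + m) m (odd_sum a + even_sum a + z)"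
proof -
  define D1 D2 where "D1 = odd_fern a X" and "D2 = even_fern a X \<union> {X..<X + z}"
  have Xs: "odd_sum a + even_sum a \<le> X" "X - (odd_sum a + even_sum a) = x + m" by (simp_all add: X_def)
  have ferns: "odd_fern a X \<union> even_fern a X = {x + m..<X}" using fern_Un[OF Xs(1)] Xs(2) by simp
  then have sub: "odd_fern a X \<subseteq> {x + m..<X}" "even_fern a X \<subseteq> {x + m..<X}" by blast+
  have fin: "finite D1" "finite D2" by (simp_all add: D1_def D2_def)
  have card: "card D1 = odd_sum a" "card D2 = even_sum a + z"
  proof -
    have "even_fern a X \<inter> {X..<X + z} = {}" using sub(2) by fastforce
    then show "card D1 = odd_sum a" "card D2 = even_sum a + z"
      using card_fern[OF Xs(1)] by (simp_all add: D1_def D2_def card_Un_disjoint)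
  qed
  have Int: "D1 \<inter> D2 = {}"
    using fern_Int[OF Xs(1)] sub(1) by (fastforce simp: D1_def D2_def)
  have Un: "D1 \<union> D2 = {x + m..<x + m + (odd_sum a + even_sum a + z)}"
  proof -
    have "D1 \<union> D2 = {x + m..<X} \<union> {X..<X + z}"
      unfolding D1_def D2_def ferns[symmetric] by (rule Un_assoc[symmetric])
    also have "\<dots> = {x + m..<X + z}" by (rule ivl_disj_un_two) (simp_all add: X_def)
    finally show ?thesis by (simp add: X_def ac_simps)
  qed
  let ?t = "\<lambda>S. num_tilings (dented p (x + even_sum a) (odd_sum a + m) (S \<union> D1))"
  let ?b = "\<lambda>S. num_tilings (dented p (x + odd_sum a) (even_sum a + z + m) (S \<union> D2))"
  have lt: "s < d" if "s \<in> S" "S \<subseteq> {..<x + m}" "d \<in> D1 \<union> D2" for s d S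
    using that unfolding Un by fastforce
  have cardS: "finite S" "card (S \<union> D1) = card S + odd_sum a" "card (S \<union> D2) = card S + (even_sum a + z)"
    "S \<union> D1 \<subseteq> {..<x + even_sum a + (odd_sum a + m)}" "S \<union> D2 \<subseteq> {..<x + odd_sum a + (even_sum a + z + m)}"
    if S: "S \<subseteq> {..<x + m}" for S
  proof -
    show fS: "finite S" using S by (rule finite_subset) simp
    have "S \<inter> D1 = {}" "S \<inter> D2 = {}" using lt[OF _ S] by fastforce+
    then show "card (S \<union> D1) = card S + odd_sum a" "card (S \<union> D2) = card S + (even_sum a + z)"
      using fS fin by (simp_all add: card_Un_disjoint card)
    have "D1 \<subseteq> {..<X}" using sub(1) by (auto simp: D1_def)
    then show "S \<union> D1 \<subseteq> {..<x + even_sum a + (odd_sum a + m)}"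
      using S by (fastforce simp: X_def)
    have "D2 \<subseteq> {..<X + z}" using sub(2) by (auto simp: D2_def)
    then show "S \<union> D2 \<subseteq> {..<x + odd_sum a + (even_sum a + z + m)}"
      using S by (fastforce simp: X_def)
  qed
  have "num_tilings (R_region x y z a) = (\<Sum>S\<in>Pow {..<x + m}. ?t S * ?b S)"
    using num_tilings_R_region[OF assms(1-4), of x] by (simp only: D1_def D2_def X_def)
  also have "\<dots> = (\<Sum>S\<in>{S. S \<subseteq> {..<x + m} \<and> card S = m}. ?t S * ?b S)"
  \<comment> \<open>Balance of the upper half alone already forces
    \<open>card S = m\<close>.\<close>
  proof (rule sum.mono_neutral_right)
    show "\<forall>S\<in>Pow {..<x + m} - {S. S \<subseteq> {..<x + m} \<and> card S = m}. ?t S * ?b S = 0"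
    proof
      fix S assume "S \<in> Pow {..<x + m} - {S. S \<subseteq> {..<x + m} \<and> card S = m}"
      then have S: "S \<subseteq> {..<x + m}" "card S \<noteq> m" by auto
      have "?t S = 0"
      proof (rule ccontr)
        assume "?t S \<noteq> 0"
        from card_dented[OF assms(2,3) cardS(4)[OF S(1)] this] cardS(2)[OF S(1)] S(2)
        show False by simp
      qed
      then show "?t S * ?b S = 0" by simp
    qed
  qed auto
  finally have "real (num_tilings (R_region x y z a)) =
      (\<Sum>S\<in>{S. S \<subseteq> {..<x + m} \<and> card S = m}. real (?t S) * real (?b S))"
    by simp
  also have "\<dots> = (\<Sum>S\<in>{S. S \<subseteq> {..<x + m} \<and> card S = m}.
      dent_factor p (odd_sum a + m) * dent_weight p D1 * (dent_factor p (even_sum a + z + m) * dent_weight p D2) *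
      ((dent_weight p S)\<^sup>2 * dent_cross p S {x + m..<x + m + (odd_sum a + even_sum a + z)}))"
  proof (rule sum.cong[OF refl])
    fix S assume "S \<in> {S. S \<subseteq> {..<x + m} \<and> card S = m}"
    then have S: "S \<subseteq> {..<x + m}" "card S = m" by auto
    note cS = cardS[OF S(1)]
    have c: "card (S \<union> D1) = odd_sum a + m" "card (S \<union> D2) = even_sum a + z + m"
      using cS(2,3) S(2) by simp_all
    have "real (?t S) = dent_factor p (odd_sum a + m) * dent_weight p (S \<union> D1)"
      using num_tilings_dented[of p "S \<union> D1" "x + even_sum a"] assms(2) cS(1,4) fin c by simp
    moreover have "real (?b S) = dent_factor p (even_sum a + z + m) * dent_weight p (S \<union> D2)"
      using num_tilings_dented[of p "S \<union> D2" "x + odd_sum a"] assms(2) cS(1,5) fin c by simp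
    moreover have "dent_weight p (S \<union> D1) = dent_weight p S * dent_weight p D1 * dent_cross p S D1"
      "dent_weight p (S \<union> D2) = dent_weight p S * dent_weight p D2 * dent_cross p S D2"
      using lt[OF _ S(1)] cS(1) fin by (auto intro!: dent_weight_Un)
    moreover have "dent_cross p S {x + m..<x + m + (odd_sum a + even_sum a + z)} =
        dent_cross p S D1 * dent_cross p S D2"
      unfolding Un[symmetric] by (rule dent_cross_Un[OF fin Int])
    ultimately show "real (?t S) * real (?b S) =
      dent_factor p (odd_sum a + m) * dent_weight p D1 * (dent_factor p (even_sum a + z + m) * dent_weight p D2) *
      ((dent_weight p S)\<^sup>2 * dent_cross p S {x + m..<x + m + (odd_sum a + even_sum a + z)})"
      by (simp only: power2_eq_square mult_ac)
  qed
  also have "\<dots> = dent_factor p (odd_sum a + m) * dent_weight p D1 *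
      (dent_factor p (even_sum a + z + m) * dent_weight p D2) *
      selberg_sum p (x + m) m (odd_sum a + even_sum a + z)"
    by (simp only: selberg_sum_def sum_distrib_left)
  finally show ?thesis unfolding D1_def D2_def .
qed

section \<open>Evaluation of the sum\<close>

text \<open>The part of the weight of an interval of \<open>u + p\<close> dents starting at
  \<open>x\<close> that depends on \<open>x\<close>: the product of \<open>2 x + 2 + j + i\<close>
  over \<open>i <= j < u\<close>.\<close>

definition triangle_prod :: "nat \<Rightarrow> nat \<Rightarrow> real" where
  "triangle_prod x u = (\<Prod>j<u. pochhammer (2 * real x + real j + 2) (Suc j))"

lemma triangle_prod_pos: "0 < triangle_prod x u"
  by (simp add: triangle_prod_def prod_pos pochhammer_pos)

text \<open>Raising \<open>x\<close> by 1 amounts to the index shift \<open>(i, j)\<close> to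
  \<open>(i + 1, j + 1)\<close> in the factors \<open>2 x + 2 + j + i\<close>. What the shifted
  triangle misses, the pairs with \<open>i = 0\<close> and those with \<open>j = u + 1\<close>, are
  \<open>2 u + 3\<close> consecutive numbers from \<open>2 x + 2\<close> on.\<close>

lemma triangle_prod_Suc_Suc:
  "triangle_prod x (Suc (Suc u)) = pochhammer (2 * real x + 2) (2 * u + 3) * triangle_prod (Suc x) u"
proof (induction u)
  case 0
  show ?case by (simp add: triangle_prod_def eval_nat_numeral pochhammer_Suc algebra_simps)
next
  case (Suc u)
  have "pochhammer (2 * real x + real (Suc (Suc u)) + 2) (Suc (Suc (Suc u))) =
      pochhammer (2 * real (Suc x) + real u + 2) (Suc u) *
      ((2 * real x + 2 + real (2 * u + 3)) * (2 * real x + 2 + real (2 * u + 4)))"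
    unfolding pochhammer_Suc[of _ "Suc (Suc u)"] pochhammer_Suc[of _ "Suc u"] by (simp add: algebra_simps)
  moreover have "pochhammer (2 * real x + 2) (2 * Suc u + 3) = pochhammer (2 * real x + 2) (2 * u + 3) *
      ((2 * real x + 2 + real (2 * u + 3)) * (2 * real x + 2 + real (2 * u + 4)))"
  proof -
    have "2 * Suc u + 3 = Suc (Suc (2 * u + 3))" by simp
    then show ?thesis by (simp only: pochhammer_Suc) (simp add: algebra_simps)
  qed
  ultimately show ?case
    using Suc by (simp add: triangle_prod_def)
qed

text \<open>Iterating the previous identity \<open>m\<close> times produces the Pochhammer product
  of the theorem.\<close>

lemma triangle_prod_shift:
  "triangle_prod x (u + 2 * m) =
    (\<Prod>i=1..m. pochhammer (real (2 * x + 2 * i)) (2 * (u + 2 * m) + 3 - 4 * i)) * triangle_prod (x + m) u"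
proof (induction m arbitrary: x)
  case (Suc m)
  have "triangle_prod x (u + 2 * Suc m) =
      pochhammer (2 * real x + 2) (2 * (u + 2 * m) + 3) * triangle_prod (Suc x) (u + 2 * m)"
    using triangle_prod_Suc_Suc[of x "u + 2 * m"] by simp
  also have "triangle_prod (Suc x) (u + 2 * m) =
      (\<Prod>i=1..m. pochhammer (real (2 * x + 2 * Suc i)) (2 * (u + 2 * Suc m) + 3 - 4 * Suc i)) *
      triangle_prod (x + Suc m) u"
    unfolding Suc.IH by (simp add: algebra_simps)
  also have "(\<Prod>i=1..m. pochhammer (real (2 * x + 2 * Suc i)) (2 * (u + 2 * Suc m) + 3 - 4 * Suc i)) =
      (\<Prod>i=Suc 1..Suc m. pochhammer (real (2 * x + 2 * i)) (2 * (u + 2 * Suc m) + 3 - 4 * i))"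
    by (rule prod.shift_bounds_cl_Suc_ivl[symmetric])
  also have "pochhammer (2 * real x + 2) (2 * (u + 2 * m) + 3) *
      ((\<Prod>i=Suc 1..Suc m. pochhammer (real (2 * x + 2 * i)) (2 * (u + 2 * Suc m) + 3 - 4 * i)) *
       triangle_prod (x + Suc m) u) =
      (\<Prod>i=1..Suc m. pochhammer (real (2 * x + 2 * i)) (2 * (u + 2 * Suc m) + 3 - 4 * i)) *
      triangle_prod (x + Suc m) u"
    by (subst prod.atLeast_Suc_atMost[of 1 "Suc m"]) (simp_all add: algebra_simps)
  finally show ?case .
qed simp

lemma hyper_Suc: "hyper (Suc n) = hyper n * fact n"
  by (simp add: hyper_def)

lemma hyper_pos: "0 < hyper n"
  by (simp add: hyper_def prod_pos)

text \<open>Factor by factor, \<open>(2 j + 2)! = 2 (j + 1) (2 j + 1)!\<close>.\<close>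

lemma hyper2_even: "hyper2 (2 * Suc u) = 2 ^ u * fact u * hyper2 (2 * u + 1)"
proof (induction u)
  case (Suc u)
  have "hyper2 (2 * Suc (Suc u)) = 2 ^ u * fact u * hyper2 (2 * u + 1) * fact (2 * Suc u)"
    unfolding hyper2_Suc(1)[of "Suc u"] Suc.IH ..
  also have "fact (2 * Suc u) = 2 * Suc u * (fact (2 * u + 1) :: nat)"
    by simp
  finally show ?case
    unfolding hyper2_Suc(2) by (simp add: algebra_simps)
qed (simp add: hyper2_def)

lemma prod_ivl_shift: "(\<Prod>a\<in>{x..<x + u}. g a) = (\<Prod>i<u. g (x + i))" for g :: "nat \<Rightarrow> real"
  by (induction u) simp_all

text \<open>The difference of squares for the dents \<open>x + u\<close> and \<open>x + i\<close> is
  \<open>4 (u - i) (2 x + u + i + 2 - p)\<close>; the factors \<open>u - i\<close> multiply to a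
  factorial, the last ones to a Pochhammer symbol.\<close>

lemma dent_weight_interval_Suc:
  "dent_weight p {x..<x + Suc u} = dent_weight p {x..<x + u} * (if p = 0 then 2 * real (x + u) + 2 else 1) *
    (4 ^ u * fact u * pochhammer (2 * real x + real u + 2 - real p) u)"
proof -
  have "{x..<x + Suc u} = {x..<x + u} \<union> {x + u}" by auto
  moreover have "dent_weight p \<dots> = dent_weight p {x..<x + u} * dent_weight p {x + u} * dent_cross p {x..<x + u} {x + u}"
    by (rule dent_weight_Un) auto
  moreover have "dent_weight p {x + u} = (if p = 0 then 2 * real (x + u) + 2 else 1)"
  proof -
    have "{a \<in> {x + u}. a < x + u} = {}" by auto
    then show ?thesis by (simp add: dent_weight_def del: Collect_empty_eq)
  qed
  moreover have "dent_cross p {x..<x + u} {x + u} =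
      (\<Prod>i<u. 4 * real (u - i) * (2 * real x + real u + 2 - real p + real i))"
    unfolding dent_cross_def prod_ivl_shift
    by (simp, intro prod.cong refl) (auto simp: of_nat_diff power2_eq_square algebra_simps)
  moreover have "\<dots> = 4 ^ u * fact u * pochhammer (2 * real x + real u + 2 - real p) u"
  proof -
    have "(\<Prod>i<u. real (u - i)) = fact u" by (simp add: fact_prod_rev lessThan_atLeast0)
    then show ?thesis
      by (simp only: prod.distrib prod_constant card_atLeastLessThan diff_zero pochhammer_prod lessThan_atLeast0)
  qed
  ultimately show ?thesis by simp
qed

lemma power_two_Suc: "2 ^ (Suc u * u) = (2 ^ (u * (u - 1)) * 4 ^ u :: real)"
proof -
  have "(4 :: real) ^ u = 2 ^ (2 * u)" by (simp only: power_mult) simp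
  moreover have "Suc u * u = u * (u - 1) + 2 * u" by (cases u) simp_all
  ultimately show ?thesis by (simp only: power_add)
qed

text \<open>For \<open>p = 0\<close> the linear factor of a new dent is the missing last factor of
  its Pochhammer row. For \<open>p = 1\<close> there is none, and the first dent contributes no row;
  hence the index \<open>L - p\<close>.\<close>

lemma dent_weight_interval:
  assumes "p \<le> 1"
  shows "dent_weight p {x..<x + L} = 2 ^ (L * (L - 1)) * real (hyper L) * triangle_prod x (L - p)"
proof (induction L)
  case 0
  show ?case by (simp add: dent_weight_def hyper_def triangle_prod_def)
next
  case (Suc L)
  have t: "triangle_prod x (Suc L - p) = triangle_prod x (L - p) *
      ((if p = 0 then 2 * real (x + L) + 2 else 1) * pochhammer (2 * real x + real L + 2 - real p) L)"
  proof (cases "p = 0")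
    case True
    have "pochhammer (2 * real x + real L + 2) (Suc L) =
        pochhammer (2 * real x + real L + 2) L * (2 * real (x + L) + 2)"
      by (simp add: pochhammer_Suc algebra_simps)
    with True show ?thesis by (simp add: triangle_prod_def)
  next
    case False
    then have "p = 1" using assms by simp
    then show ?thesis by (cases L) (simp_all add: triangle_prod_def algebra_simps)
  qed
  have pw: "2 ^ (Suc L * (Suc L - 1)) = (2 ^ (L * (L - 1)) * 4 ^ L :: real)"
    using power_two_Suc[of L] by simp
  have hy: "real (hyper (Suc L)) = real (hyper L) * fact L" by (simp add: hyper_Suc)
  show ?case
    unfolding dent_weight_interval_Suc Suc.IH t pw hy by (simp only: mult_ac)
qed

lemma even_index_pair: "{i\<in>{1..length [x, u]}. even i} = {2 :: nat}"
  by (auto simp: le_Suc_eq numeral_2_eq_2)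

lemma pair_sums: "even_sum [x, u] = u" "odd_sum [x, u] = x" "part_sum [x, u] 1 = x" "entry [x, u] 2 = u"
proof -
  show e: "entry [x, u] 2 = u" by (simp add: entry_def)
  show "even_sum [x, u] = u" unfolding even_sum_def even_index_pair by (simp add: e)
  show p: "part_sum [x, u] 1 = x" by (simp add: part_sum_def entry_def)
  have "{i\<in>{1..length [x, u]}. odd i} = {1}" by (auto simp: le_Suc_eq numeral_2_eq_2)
  then show "odd_sum [x, u] = x" unfolding odd_sum_def by (simp add: entry_def)
qed

text \<open>Prolonging the northeastern side down to the southern line turns the region into a
  dented quarter with one triangle of side \<open>u\<close> in its corner. Its height
  \<open>2 * u\<close> is even for either parity of \<open>y\<close>, hence the index 0.\<close>

lemma num_tilings_hexagon:
  assumes "y + L = Suc u"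
  shows "real (num_tilings (R_region x y L [])) = dent_factor 0 u * dent_weight 0 {x..<x + u}"
proof -
  have "R_region x y L [] = dented_quarter (2 * int (even_sum [x, u]) - int 0) [x, u]"
  proof -
    have u: "int y + int L = int u + 1" using assms by linarith
    have nil: "odd_sum [] = 0" "even_sum [] = 0" "{i\<in>{1..length ([] :: nat list)}. P i} = {}" for P
      by (simp_all add: odd_sum_def even_sum_def)
    have v: "int y + int L + 2 * int 0 - 1 = int u" "2 * (int y + int L + int 0 - 1) = 2 * int u"
      using u by simp_all
    have "R_region x y L [] = {(r, c). 0 \<le> r \<and> r < 2 * int u \<and> 0 \<le> c \<and> c \<le> 2 * int x + r \<and>
        c \<le> 2 * int x + 2 * int u - r - 1}"
      unfolding R_region_def Let_def nil list.size(3) part_sum_0 v by simp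
    also have "\<dots> = {(r, c). 0 \<le> r \<and> r < 2 * int u \<and> 0 \<le> c \<and> c \<le> 2 * int x + r} -
        up_triangle (2 * int x) (2 * int u) (int u)"
      by (auto simp: up_triangle_def)
    also have "\<dots> = dented_quarter (2 * int (even_sum [x, u]) - int 0) [x, u]"
      unfolding dented_quarter_def even_index_pair by (simp add: pair_sums[simplified])
    finally show ?thesis .
  qed
  moreover have "even_blocks [x, u] = {x..<x + u}"
    unfolding even_blocks_def even_index_pair by (simp add: pair_sums[simplified])
  ultimately show ?thesis
    using num_tilings_dented_quarter[of 0 "[x, u]"] by (simp only: pair_sums)
qed

lemma dent_factor_0: "dent_factor p 0 = 1"
  by (simp add: dent_factor_def hyper2_def)

text \<open>Geometrically, beside a triangle of side \<open>u + 1\<close> at height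
  \<open>2 u + 1\<close> the bottom row is forced, and deleting it leaves side \<open>u\<close> at
  height \<open>2 u\<close>. Here the identity is read off from the closed forms.\<close>

lemma dent_factor_weight_change:
  "dent_factor 0 u * dent_weight 0 {x..<x + u} = dent_factor 1 (Suc u) * dent_weight 1 {x..<x + Suc u}"
proof -
  have pw: "2 ^ (u * u) = (2 ^ (u * (u - 1)) * 2 ^ u :: real)"
    by (cases u) (simp_all add: power_add[symmetric] algebra_simps)
  have cancel: "1 / (A * B * H) * (A * h * T) = 1 / (D * (B * F * H)) * (D * (h * F) * T)"
    if "A \<noteq> 0" "B \<noteq> 0" "D \<noteq> 0" "F \<noteq> 0" "H \<noteq> 0" for A B D F H h T :: real
    using that by (simp add: field_simps)
  have w: "dent_weight 0 {x..<x + u} = 2 ^ (u * (u - 1)) * real (hyper u) * triangle_prod x u"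
    "dent_weight 1 {x..<x + Suc u} = 2 ^ (Suc u * u) * real (hyper (Suc u)) * triangle_prod x u"
    using dent_weight_interval[of 0 x u] dent_weight_interval[of 1 x "Suc u"] by simp_all
  have f: "dent_factor 0 u = 1 / (2 ^ (u * u) * real (hyper2 (2 * u + 1)))"
    "dent_factor 1 (Suc u) = 1 / (2 ^ (Suc u * u) * real (hyper2 (2 * Suc u)))"
    by (simp_all add: dent_factor_def)
  have h2: "real (hyper2 (2 * Suc u)) = 2 ^ u * fact u * real (hyper2 (2 * u + 1))"
    unfolding hyper2_even by simp
  have h: "real (hyper (Suc u)) = real (hyper u) * fact u" by (simp add: hyper_Suc)
  show ?thesis
    unfolding w f h2 h pw by (rule cancel) (simp_all add: hyper2_pos)
qed

text \<open>The sum is evaluated by applying the cutting formula to a region without removed triangles.\<close>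

lemma selberg_sum_eq:
  assumes "p \<le> 1" "1 \<le> L"
  shows "selberg_sum p (x + m) m L * (dent_factor p m * dent_factor p (L + m) * dent_weight p {x + m..<x + m + L}) =
    dent_factor 0 (L - p + 2 * m) * dent_weight 0 {x..<x + (L - p + 2 * m)}"
proof (cases "m = 0")
  case True
  have "dent_factor p L * dent_weight p {x..<x + L} = dent_factor 0 (L - p) * dent_weight 0 {x..<x + (L - p)}"
  proof (cases "p = 0")
    case False
    then have "p = 1" using assms by simp
    moreover obtain v where "L = Suc v" using assms(2) by (cases L) auto
    ultimately show ?thesis using dent_factor_weight_change[of v x] by simp
  qed simp
  then show ?thesis by (simp add: True selberg_sum_0 dent_factor_0)
next
  case False
  \<comment> \<open>This \<open>y\<close> gives the halves parity \<open>p\<close> and puts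
    \<open>m\<close> lozenges across the cut; with \<open>z = L\<close> the corner alone fills the
    interval.\<close>
  define y where "y = 2 * m + 1 - p"
  have y: "y + p = 2 * m + 1" using assms(1) by (simp add: y_def)
  have sums: "odd_sum [] = 0" "even_sum [] = 0" "odd_fern [] X = {}" "even_fern [] X = {}" for X
    by (simp_all add: odd_sum_def even_sum_def odd_fern_def even_fern_def)
  have "real (num_tilings (R_region x y L [])) =
      dent_factor p m * (dent_factor p (L + m) * dent_weight p {x + m..<x + m + L}) * selberg_sum p (x + m) m L"
    using real_num_tilings_R_region[OF y assms(1), of "[]" L x] False
    by (simp add: sums dent_weight_def[of p "{}"])
  moreover have "real (num_tilings (R_region x y L [])) =
      dent_factor 0 (L - p + 2 * m) * dent_weight 0 {x..<x + (L - p + 2 * m)}"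
    by (rule num_tilings_hexagon) (use assms y in auto)
  ultimately show ?thesis by (simp only: mult_ac)
qed

text \<open>The factor \<open>triangle_prod (x + m) (L - p)\<close> occurs on both sides and
  cancels; the dependence on \<open>x\<close> that survives is the Pochhammer product.\<close>

lemma selberg_sum_closed_form:
  fixes p L m x :: nat
  assumes "p \<le> 1" "1 \<le> L"
  defines "u \<equiv> L - p + 2 * m"
  shows "selberg_sum p (x + m) m L =
    (\<Prod>i=1..m. pochhammer (real (2 * x + 2 * i)) (2 * u + 3 - 4 * i)) *
    (dent_factor 0 u * 2 ^ (u * (u - 1)) * real (hyper u)) /
    (dent_factor p m * dent_factor p (L + m) * 2 ^ (L * (L - 1)) * real (hyper L))"
proof -
  let ?P = "\<Prod>i=1..m. pochhammer (real (2 * x + 2 * i)) (2 * u + 3 - 4 * i)"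
  have "dent_weight 0 {x..<x + u} = 2 ^ (u * (u - 1)) * real (hyper u) * (?P * triangle_prod (x + m) (L - p))"
    using dent_weight_interval[of 0 x u] triangle_prod_shift[of x "L - p" m] by (simp add: u_def)
  moreover have "dent_weight p {x + m..<x + m + L} = 2 ^ (L * (L - 1)) * real (hyper L) * triangle_prod (x + m) (L - p)"
    by (rule dent_weight_interval[OF assms(1)])
  ultimately have "selberg_sum p (x + m) m L * (dent_factor p m * dent_factor p (L + m) * 2 ^ (L * (L - 1)) * real (hyper L)) *
      triangle_prod (x + m) (L - p) =
      ?P * (dent_factor 0 u * 2 ^ (u * (u - 1)) * real (hyper u)) * triangle_prod (x + m) (L - p)"
    using selberg_sum_eq[OF assms(1,2), of x m] unfolding u_def[symmetric] by (simp only: mult_ac)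
  then have "selberg_sum p (x + m) m L * (dent_factor p m * dent_factor p (L + m) * 2 ^ (L * (L - 1)) * real (hyper L)) =
      ?P * (dent_factor 0 u * 2 ^ (u * (u - 1)) * real (hyper u))"
    by (rule mult_right_cancel[THEN iffD1, rotated])
      (use triangle_prod_pos[of "x + m" "L - p"] in simp)
  moreover have "dent_factor p m * dent_factor p (L + m) * 2 ^ (L * (L - 1)) * real (hyper L) \<noteq> 0"
    using dent_factor_pos[of p m] dent_factor_pos[of p "L + m"] hyper_pos[of L] by simp
  ultimately show ?thesis by (rule nonzero_eq_divide_eq[THEN iffD2, rotated])
qed

section \<open>Reading off the fern from the lists\<close>

text \<open>The shape of the arguments of Q and K in the theorem, the latter list still to be
  extended by \<open>z\<close>. The index \<open>c\<close> may exceed the length of \<open>a\<close>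
  by one; then the first entry is just \<open>w\<close>.\<close>

definition fern_list :: "nat list \<Rightarrow> nat \<Rightarrow> nat \<Rightarrow> nat list" where
  "fern_list a c w = (w + entry a c) # map (entry a) (rev [1..<c])"

lemma length_fern_list: "1 \<le> c \<Longrightarrow> length (fern_list a c w) = c"
  by (simp add: fern_list_def)

lemma entry_fern_list:
  assumes "2 \<le> j" "j \<le> c"
  shows "entry (fern_list a c w @ ys) j = entry a (c + 1 - j)"
proof -
  obtain i where i: "j = Suc (Suc i)" using assms(1) by (cases j; cases "j - 1") auto
  have "entry (v # xs @ ys) (Suc (Suc i)) = xs ! i" if "i < length xs" for v xs
    using that by (simp add: entry_def nth_append)
  from this[of "map (entry a) (rev [1..<c])"]
  have "entry (fern_list a c w @ ys) j = map (entry a) (rev [1..<c]) ! (j - 2)"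
    using assms(2) by (simp add: i fern_list_def)
  also have "\<dots> = entry a (rev [1..<c] ! (j - 2))"
    using assms by (intro nth_map) simp
  also have "rev [1..<c] ! (j - 2) = c + 1 - j"
    using assms by (subst rev_nth) auto
  finally show ?thesis .
qed

lemma part_sum_fern_list:
  assumes "1 \<le> j" "j \<le> c"
  shows "part_sum (fern_list a c w @ ys) j + part_sum a (c - j) = w + part_sum a c"
  using assms
proof (induction j rule: dec_induct)
  case base
  have "part_sum (fern_list a c w @ ys) 1 = w + entry a c"
    by (simp add: part_sum_def entry_def fern_list_def)
  then show ?case using part_sum_pred[of c a] base by simp
next
  case (step j)
  have "part_sum a (c - j) = part_sum a (c - Suc j) + entry a (c - j)"
    using part_sum_pred[of "c - j" a] step by simp
  moreover have "part_sum (fern_list a c w @ ys) (Suc j) = part_sum (fern_list a c w @ ys) j + entry a (c - j)"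
    using entry_fern_list[of "Suc j" c a w ys] step by (simp add: part_sum_Suc)
  ultimately show ?case using step by simp
qed

lemma block_fern_list:
  fixes a ys :: "nat list" and c w :: nat
  assumes "2 \<le> i" "i \<le> c"
  defines "t \<equiv> fern_list a c w @ ys"
  shows "{part_sum t (i - 1)..<part_sum t (i - 1) + entry t i} = fern_block a (w + part_sum a c) (c + 1 - i)"
proof -
  have "part_sum t (i - 1) = w + part_sum a c - part_sum a (c + 1 - i)"
  proof -
    have "1 \<le> i - 1" "i - 1 \<le> c" "c - (i - 1) = c + 1 - i" using assms(1,2) by auto
    from part_sum_fern_list[OF this(1,2), of a w ys] this(3) show ?thesis by (simp add: t_def)
  qed
  then show ?thesis
    using entry_fern_list[OF assms(1,2), of a w ys] by (simp only: fern_block_def t_def)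
qed

lemma fern_block_beyond: "length a < i \<Longrightarrow> fern_block a X i = {}"
  by (simp add: fern_block_def entry_def)

text \<open>Reversal sends index \<open>i\<close> to \<open>c + 1 - i\<close>. So the even indices
  of the list meet the odd entries of \<open>a\<close> (up-pointing triangles) for even
  \<open>c\<close>, and the even entries (down-pointing ones) for odd \<open>c\<close>;
  \<open>b\<close> records which.\<close>

lemma blocks_fern_list:
  fixes a ys :: "nat list" and c w :: nat
  assumes "length a \<le> c" "even c \<longleftrightarrow> b" "b \<Longrightarrow> 1 \<le> c"
  defines "t \<equiv> fern_list a c w @ ys"
  shows "(\<Union>i\<in>{i\<in>{1..c}. even i}. {part_sum t (i - 1)..<part_sum t (i - 1) + entry t i}) =
    (if b then odd_fern a (w + part_sum a c) else even_fern a (w + part_sum a c))"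
proof -
  let ?X = "w + part_sum a c"
  have blk: "{part_sum t (i - 1)..<part_sum t (i - 1) + entry t i} = fern_block a ?X (c + 1 - i)"
    if "i \<in> {i\<in>{1..c}. even i}" for i
  proof -
    have "i \<noteq> 1" using that by auto
    then have "2 \<le> i" "i \<le> c" using that by auto
    then show ?thesis unfolding t_def by (rule block_fern_list)
  qed
  have "(\<Union>i\<in>{i\<in>{1..c}. even i}. {part_sum t (i - 1)..<part_sum t (i - 1) + entry t i}) =
      (\<Union>i\<in>{i\<in>{1..c}. even i}. fern_block a ?X (c + 1 - i))"
    using blk by (intro SUP_cong refl)
  also have "\<dots> = (\<Union>i\<in>{i\<in>{1..length a}. odd i \<longleftrightarrow> b}. fern_block a ?X i)"
  proof (intro equalityI UN_least)
    fix i assume i: "i \<in> {i\<in>{1..c}. even i}"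
    have par: "odd (c + 1 - i) \<longleftrightarrow> b" using i assms(2) by auto
    show "fern_block a ?X (c + 1 - i) \<subseteq> (\<Union>i\<in>{i\<in>{1..length a}. odd i \<longleftrightarrow> b}. fern_block a ?X i)"
    proof (cases "c + 1 - i \<le> length a")
      case True
      then have "c + 1 - i \<in> {i\<in>{1..length a}. odd i \<longleftrightarrow> b}" using par i by auto
      then show ?thesis by blast
    next
      case False
      then show ?thesis by (simp add: fern_block_beyond)
    qed
  next
    fix i assume i: "i \<in> {i\<in>{1..length a}. odd i \<longleftrightarrow> b}"
    then have "c + 1 - i \<in> {i\<in>{1..c}. even i}" "c + 1 - (c + 1 - i) = i" using assms(1,2) by auto
    then show "fern_block a ?X i \<subseteq> (\<Union>i\<in>{i\<in>{1..c}. even i}. fern_block a ?X (c + 1 - i))"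
      using UN_upper[of "c + 1 - i" "{i\<in>{1..c}. even i}" "\<lambda>i. fern_block a ?X (c + 1 - i)"]
      by (simp only:)
  qed
  also have "\<dots> = (if b then odd_fern a ?X else even_fern a ?X)"
    by (simp add: odd_fern_def even_fern_def)
  finally show ?thesis .
qed

lemma even_blocks_fern_list:
  assumes "even c" "1 \<le> c" "length a \<le> c"
  shows "even_blocks (fern_list a c w) = odd_fern a (w + part_sum a c)"
  using blocks_fern_list[of a c True w "[]"] assms by (simp add: even_blocks_def length_fern_list)

text \<open>As \<open>c\<close> is odd, the appended \<open>z\<close> has the even index
  \<open>c + 1\<close> and becomes one more removed triangle, directly to the right of the
  fern.\<close>

lemma even_blocks_fern_list_append:
  assumes "odd c" "length a \<le> c"
  shows "even_blocks (fern_list a c w @ [z]) =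
    even_fern a (w + part_sum a c) \<union> {w + part_sum a c..<w + part_sum a c + z}"
proof -
  let ?t = "fern_list a c w @ [z]"
  let ?B = "\<lambda>i. {part_sum ?t (i - 1)..<part_sum ?t (i - 1) + entry ?t i}"
  have c: "1 \<le> c" using assms(1) by (cases c) auto
  have "{i\<in>{1..length ?t}. even i} = insert (Suc c) {i\<in>{1..c}. even i}"
    using assms(1) c by (auto simp: length_fern_list le_Suc_eq)
  then have "even_blocks ?t = ?B (Suc c) \<union> (\<Union>i\<in>{i\<in>{1..c}. even i}. ?B i)"
    by (simp only: even_blocks_def UN_insert)
  also have "(\<Union>i\<in>{i\<in>{1..c}. even i}. ?B i) = even_fern a (w + part_sum a c)"
    using blocks_fern_list[of a c False w "[z]"] assms by simp
  also have "?B (Suc c) = {w + part_sum a c..<w + part_sum a c + z}"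
    using part_sum_fern_list[of c c a w "[z]"] c
    by (simp add: entry_def length_fern_list nth_append)
  finally show ?thesis by (simp only: Un_commute)
qed

section \<open>The counts Q and K, degenerate regions and the constant factor\<close>

lemma Q_num_eq: "real (Q_num t) = dent_factor 0 (even_sum t) * dent_weight 0 (even_blocks t)"
  using num_tilings_dented_quarter[of 0 t] by (simp add: Q_num_def Q_region_def)

lemma K_num_eq: "real (K_num t) = dent_factor 1 (even_sum t) * dent_weight 1 (even_blocks t)"
  using num_tilings_dented_quarter[of 1 t] by (simp add: K_num_def K_region_def)

lemma odd_sum_pos:
  assumes "a \<noteq> []" "\<forall>k\<in>set a. k > 0"
  shows "1 \<le> odd_sum a"
proof -
  have "0 < entry a 1" using assms by (cases a) (auto simp: entry_def)
  then show ?thesis using entry_le_odd_sum[of 1 a] by simp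
qed

lemma even_sum_eq_0:
  assumes "\<forall>k\<in>set a. k > 0" "even_sum a = 0"
  shows "length a \<le> 1"
proof (rule ccontr)
  assume "\<not> length a \<le> 1"
  then have "0 < entry a 2" using assms(1) nth_mem[of 1 a] by (simp add: entry_def)
  then show False using entry_le_even_sum[of 2 a] assms(2) by simp
qed

text \<open>The lower part is empty here, or (for \<open>y = 0\<close>) has height \<open>-1\<close>; in the latter case the
  removed triangle loses its base row.\<close>

lemma num_tilings_R_region_degenerate:
  assumes "y + p = 1" "p \<le> 1" "a \<noteq> []" "\<forall>k\<in>set a. k > 0" "even_sum a = 0"
  shows "real (num_tilings (R_region x y 0 a)) =
    dent_factor p (odd_sum a) * dent_weight p (odd_fern a (x + odd_sum a))"
proof -
  have "length a = 1" using even_sum_eq_0[OF assms(4,5)] assms(3) by (cases a) auto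
  then obtain k where a: "a = [k]" by (auto simp: length_Suc_conv)
  then have k: "1 \<le> k" using assms(4) by simp
  have sums: "{i\<in>{1..length a}. odd i} = {1}" "{i\<in>{1..length a}. even i} = {}"
    "entry a 1 = k" "part_sum a 1 = k" "part_sum a (length a) = k"
    by (auto simp: a entry_def part_sum_def)
  have O: "odd_sum a = k" unfolding odd_sum_def sums by (simp add: sums(3)[simplified])
  have fern: "odd_fern a (x + k) = {x..<x + k}"
    unfolding odd_fern_def sums by (simp add: fern_block_def sums(3,4)[simplified])
  have ivl: "real (num_tilings (dented 0 x n {x..<x + n})) = dent_factor 0 n * dent_weight 0 {x..<x + n}" for n
  proof -
    have "{x..<x + n} \<subseteq> {..<x + card {x..<x + n}}" by auto
    from num_tilings_dented[OF _ _ this, of 0] show ?thesis by simp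
  qed
  show ?thesis
  proof (cases "p = 0")
    case True
    then have y: "y = 1" using assms(1) by simp
    have "R_region x y 0 a = dented 0 x k {} - (\<Union>i\<in>{0 :: nat}. up_triangle (2 * int x - int 0) (2 * int k - int 0) (int k))"
      unfolding R_region_def Let_def sums y O assms(5)
      by (auto simp: sums(3,4)[simplified] dented_def dented_trapezoid_def trapezoid_def up_triangle_def)
    moreover have "num_tilings (dented 0 x k {} - (\<Union>i\<in>{0 :: nat}. up_triangle (2 * int x - int 0) (2 * int k - int 0) (int k))) =
        num_tilings (dented 0 x k ({} \<union> (\<Union>i\<in>{0 :: nat}. {x..<x + k})))"
      by (rule num_tilings_dented_triangles) auto
    ultimately show ?thesis using ivl[of k] by (simp add: fern True O)
  next
    case False
    then have p: "p = 1" "y = 0" using assms(1,2) by auto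
    obtain u where u: "k = Suc u" using k by (cases k) auto
    have "R_region x y 0 a = dented 0 x u {} - (\<Union>i\<in>{0 :: nat}. up_triangle (2 * int x - int 0) (2 * int u - int 0) (int u))"
      unfolding R_region_def Let_def sums p(2) O assms(5)
      by (auto simp: sums(3,4)[simplified] dented_def dented_trapezoid_def trapezoid_def up_triangle_def u)
    moreover have "num_tilings (dented 0 x u {} - (\<Union>i\<in>{0 :: nat}. up_triangle (2 * int x - int 0) (2 * int u - int 0) (int u))) =
        num_tilings (dented 0 x u ({} \<union> (\<Union>i\<in>{0 :: nat}. {x..<x + u})))"
      by (rule num_tilings_dented_triangles) auto
    ultimately have "real (num_tilings (R_region x y 0 a)) = dent_factor 0 u * dent_weight 0 {x..<x + u}"
      using ivl[of u] by simp
    \<comment> \<open>Exchanging side \<open>u\<close> at height \<open>2 u\<close> for side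
      \<open>u + 1\<close> at height \<open>2 u + 1\<close> restores the lost base row.\<close>
    then show ?thesis
      unfolding dent_factor_weight_change O fern p(1) u[symmetric] .
  qed
qed

lemma real_num_tilings_R_region_pos:
  fixes x y z m p :: nat and a :: "nat list"
  assumes "y + p = 2 * m + 1" "p \<le> 1" "a \<noteq> []" "\<forall>k\<in>set a. k > 0"
  defines "X \<equiv> x + m + odd_sum a + even_sum a"
  shows "real (num_tilings (R_region x y z a)) =
    dent_factor p (odd_sum a + m) * dent_weight p (odd_fern a X) *
    (dent_factor p (even_sum a + z + m) * dent_weight p (even_fern a X \<union> {X..<X + z})) *
    selberg_sum p (x + m) m (odd_sum a + even_sum a + z)"
proof (cases "even_sum a + z + m = 0")
  case True
  then have z: "even_sum a = 0" "z = 0" "m = 0" by auto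
  then have "card (even_fern a X) = 0" using card_fern(2)[of a X] by (simp add: X_def)
  then have "even_fern a X = {}" by simp
  then show ?thesis
    using num_tilings_R_region_degenerate[of y p a x] assms z
    by (simp add: selberg_sum_0 dent_factor_0 dent_weight_def[of p "{}"])
next
  case False
  then have "1 \<le> odd_sum a + m" "1 \<le> even_sum a + z + m" using odd_sum_pos[OF assms(3,4)] by linarith+
  then show ?thesis
    unfolding X_def by (rule real_num_tilings_R_region[OF assms(1,2)])
qed

text \<open>The \<open>P\<close>s will be powers of 2 and the \<open>h\<close>s products of
  factorials; \<open>T\<close> is the net power of 2, so that only the exponents in
  \<open>eq\<close> have to be checked in each case.\<close>

lemma quotient_regroup:
  fixes P1 P2 P3 P4 P5 P6 P7 P8 P9 T :: real
  assumes "P1 \<noteq> 0" "P2 \<noteq> 0" "P3 \<noteq> 0" "P4 \<noteq> 0" "P5 \<noteq> 0" "P6 \<noteq> 0" "P7 \<noteq> 0" "P8 \<noteq> 0" "P9 \<noteq> 0" "T \<noteq> 0"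
    and "h1 \<noteq> 0" "h2 \<noteq> 0" "h3 \<noteq> 0" "h4 \<noteq> 0" "h5 \<noteq> 0" "h7 \<noteq> 0" "h8 \<noteq> 0" "h9 \<noteq> 0"
    and eq: "P3 * P4 * P7 * P8 * P6 * T = P1 * P2 * P5 * P9"
  shows "(1 / (P1 * h1)) * (1 / (P2 * h2)) / ((1 / (P3 * h3)) * (1 / (P4 * h4))) *
      (((1 / (P5 * h5)) * P6 * h6) / ((1 / (P7 * h7)) * (1 / (P8 * h8)) * P9 * h9)) =
    (1 / T) * ((h6 * h7 * h4 * h3 * h8) / (h9 * h2 * h1 * h5))"
proof -
  have "(1 / (P1 * h1)) * (1 / (P2 * h2)) / ((1 / (P3 * h3)) * (1 / (P4 * h4))) *
      (((1 / (P5 * h5)) * P6 * h6) / ((1 / (P7 * h7)) * (1 / (P8 * h8)) * P9 * h9)) =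
      (P3 * P4 * P7 * P8 * P6 / (P1 * P2 * P5 * P9)) * ((h6 * h7 * h4 * h3 * h8) / (h9 * h2 * h1 * h5))"
    by (simp add: mult_ac)
  also have "P3 * P4 * P7 * P8 * P6 / (P1 * P2 * P5 * P9) = 1 / T"
    using assms(1-10) unfolding eq[symmetric] by simp
  finally show ?thesis .
qed

lemma mult_pred_add: "k * (k - 1) + k = k * (k :: nat)"
  by (cases k) simp_all

lemma pred_mult_add: "(a + b) * (a + b - 1) = a * (a - 1) + b * (b - 1) + 2 * a * (b :: nat)"
  by (cases a; cases b) (simp_all add: algebra_simps)

text \<open>The exponents of 2 leave a surplus of \<open>2 * m\<close>, which is
  \<open>y - 1\<close>: the origin of the power of 2 in the odd case.\<close>

lemma dent_factors_odd:
  fixes O' e m :: nat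
  defines "L \<equiv> O' + e" and "u \<equiv> O' + e + 2 * m"
  shows "dent_factor 0 (O' + m) * dent_factor 0 (e + m) / (dent_factor 0 O' * dent_factor 0 e) *
      ((dent_factor 0 u * 2 ^ (u * (u - 1)) * real (hyper u)) /
       (dent_factor 0 m * dent_factor 0 (L + m) * 2 ^ (L * (L - 1)) * real (hyper L))) =
    (1 / 2 ^ (2 * m)) * ((real (hyper u) * real (hyper2 (2 * m + 1)) * real (hyper2 (2 * e + 1)) *
        real (hyper2 (2 * O' + 1)) * real (hyper2 (2 * (L + m) + 1))) /
      (real (hyper L) * real (hyper2 (2 * (e + m) + 1)) * real (hyper2 (2 * (O' + m) + 1)) * real (hyper2 (2 * u + 1))))"
proof -
  have f: "dent_factor 0 k = 1 / (2 ^ (k * k) * real (hyper2 (2 * k + 1)))" for k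
    by (simp add: dent_factor_def)
  \<comment> \<open>Adding \<open>u + L\<close> on both sides turns \<open>u * (u - 1)\<close> and
    \<open>L * (L - 1)\<close> into squares and so avoids truncated subtraction.\<close>
  have "O' * O' + e * e + m * m + (L + m) * (L + m) + u * (u - 1) + 2 * m + u + L =
      (O' + m) * (O' + m) + (e + m) * (e + m) + u * u + L * (L - 1) + u + L"
    using mult_pred_add[of u] mult_pred_add[of L] by (simp add: L_def u_def algebra_simps)
  then have "O' * O' + e * e + m * m + (L + m) * (L + m) + u * (u - 1) + 2 * m =
      (O' + m) * (O' + m) + (e + m) * (e + m) + u * u + L * (L - 1)"
    by simp
  then have "(2 :: real) ^ (O' * O') * 2 ^ (e * e) * 2 ^ (m * m) * 2 ^ ((L + m) * (L + m)) * 2 ^ (u * (u - 1)) * 2 ^ (2 * m) =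
      2 ^ ((O' + m) * (O' + m)) * 2 ^ ((e + m) * (e + m)) * 2 ^ (u * u) * 2 ^ (L * (L - 1))"
    by (simp only: power_add[symmetric])
  then show ?thesis
    unfolding f by (intro quotient_regroup) (simp_all add: hyper2_pos hyper_pos del: power_mult)
qed

text \<open>The surplus exponent is \<open>u\<close> here. The power \<open>2 ^ u\<close> is just
  what \<open>hyper2_even\<close> absorbs when \<open>hyper u\<close> and
  \<open>hyper2 (2 * u + 1)\<close> are replaced by \<open>hyper (Suc u)\<close> and
  \<open>hyper2 (2 * Suc u)\<close>, so the even case shows no power of 2.\<close>

lemma dent_factors_even:
  fixes O' e m :: nat
  assumes "1 \<le> O' + e"
  defines "L \<equiv> O' + e" and "u \<equiv> O' + e - 1 + 2 * m"
  shows "dent_factor 1 (O' + m) * dent_factor 1 (e + m) / (dent_factor 1 O' * dent_factor 1 e) *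
      ((dent_factor 0 u * 2 ^ (u * (u - 1)) * real (hyper u)) /
       (dent_factor 1 m * dent_factor 1 (L + m) * 2 ^ (L * (L - 1)) * real (hyper L))) =
    (real (hyper (Suc u)) * real (hyper2 (2 * m)) * real (hyper2 (2 * e)) *
        real (hyper2 (2 * O')) * real (hyper2 (2 * (L + m)))) /
      (real (hyper L) * real (hyper2 (2 * (e + m))) * real (hyper2 (2 * (O' + m))) * real (hyper2 (2 * Suc u)))"
proof -
  have f: "dent_factor 1 k = 1 / (2 ^ (k * (k - 1)) * real (hyper2 (2 * k)))"
    "dent_factor 0 k = 1 / (2 ^ (k * k) * real (hyper2 (2 * k + 1)))" for k
    by (simp_all add: dent_factor_def)
  have "O' * (O' - 1) + e * (e - 1) + m * (m - 1) + (L + m) * (L + m - 1) =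
      (O' + m) * (O' + m - 1) + (e + m) * (e + m - 1) + L * (L - 1)"
    unfolding L_def pred_mult_add[of O' m] pred_mult_add[of e m] pred_mult_add[of "O' + e" m]
      pred_mult_add[of O' e] by (simp add: distrib_left distrib_right)
  then have "O' * (O' - 1) + e * (e - 1) + m * (m - 1) + (L + m) * (L + m - 1) + u * (u - 1) + u =
      (O' + m) * (O' + m - 1) + (e + m) * (e + m - 1) + u * u + L * (L - 1)"
    using mult_pred_add[of u] by simp
  then have "(2 :: real) ^ (O' * (O' - 1)) * 2 ^ (e * (e - 1)) * 2 ^ (m * (m - 1)) * 2 ^ ((L + m) * (L + m - 1)) *
        2 ^ (u * (u - 1)) * 2 ^ u =
      2 ^ ((O' + m) * (O' + m - 1)) * 2 ^ ((e + m) * (e + m - 1)) * 2 ^ (u * u) * 2 ^ (L * (L - 1))"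
    by (simp only: power_add[symmetric])
  then have "dent_factor 1 (O' + m) * dent_factor 1 (e + m) / (dent_factor 1 O' * dent_factor 1 e) *
      ((dent_factor 0 u * 2 ^ (u * (u - 1)) * real (hyper u)) /
       (dent_factor 1 m * dent_factor 1 (L + m) * 2 ^ (L * (L - 1)) * real (hyper L))) =
    (1 / 2 ^ u) * ((real (hyper u) * real (hyper2 (2 * m)) * real (hyper2 (2 * e)) *
        real (hyper2 (2 * O')) * real (hyper2 (2 * (L + m)))) /
      (real (hyper L) * real (hyper2 (2 * (e + m))) * real (hyper2 (2 * (O' + m))) * real (hyper2 (2 * u + 1))))"
    unfolding f by (intro quotient_regroup) (simp_all add: hyper2_pos hyper_pos del: power_mult)
  moreover have "real (hyper (Suc u)) = real (hyper u) * fact u" by (simp add: hyper_Suc)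
  moreover have "real (hyper2 (2 * Suc u)) = 2 ^ u * fact u * real (hyper2 (2 * u + 1))"
    unfolding hyper2_even by simp
  ultimately show ?thesis by (simp add: mult_ac)
qed

text \<open>The weights of the two parts of the fern are those of the Q or K regions for
  \<open>t1\<close> and \<open>t2\<close>. Multiplying and dividing by the
  \<open>dent_factor\<close> of each turns them into numbers of tilings.\<close>

lemma real_num_tilings_R_region_product:
  fixes x y z m p :: nat and a :: "nat list"
  assumes "y + p = 2 * m + 1" "p \<le> 1" "a \<noteq> []" "\<forall>k\<in>set a. k > 0"
  defines "L \<equiv> odd_sum a + (even_sum a + z)" and "w \<equiv> x + m" and "n \<equiv> length a"
  defines "u \<equiv> L - p + 2 * m"
    and "t1 \<equiv> (w + entry a (2 * ((n + 1) div 2))) # map (entry a) (rev [1..<2 * ((n + 1) div 2)])"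
    and "t2 \<equiv> (w + entry a (2 * (n div 2) + 1)) # map (entry a) (rev [1..<2 * (n div 2) + 1]) @ [z]"
  shows "real (num_tilings (R_region x y z a)) =
    (\<Prod>i=1..m. pochhammer (real (2 * x + 2 * i)) (2 * u + 3 - 4 * i)) *
    (dent_factor p (odd_sum a + m) * dent_factor p (even_sum a + z + m) /
       (dent_factor p (odd_sum a) * dent_factor p (even_sum a + z)) *
     ((dent_factor 0 u * 2 ^ (u * (u - 1)) * real (hyper u)) /
      (dent_factor p m * dent_factor p (L + m) * 2 ^ (L * (L - 1)) * real (hyper L)))) *
    (dent_factor p (even_sum t1) * dent_weight p (even_blocks t1)) *
    (dent_factor p (even_sum t2) * dent_weight p (even_blocks t2))"
proof -
  define X where "X = x + m + odd_sum a + even_sum a"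
  have n: "1 \<le> n" using assms(3) by (cases a) (auto simp: n_def)
  have ps: "part_sum a c = odd_sum a + even_sum a" if "n \<le> c" for c
    using part_sum_beyond[of a c] part_sum_length[of a] that by (simp add: n_def)
  have X: "w + (odd_sum a + even_sum a) = X" by (simp add: X_def w_def)
  have "t1 = fern_list a (2 * ((n + 1) div 2)) w" by (simp add: t1_def fern_list_def)
  moreover have "1 \<le> 2 * ((n + 1) div 2)" "length a \<le> 2 * ((n + 1) div 2)" "n \<le> 2 * ((n + 1) div 2)"
    using n by (simp_all add: n_def)
  ultimately have t1: "even_blocks t1 = odd_fern a X"
    using even_blocks_fern_list[of "2 * ((n + 1) div 2)" a w] ps X by simp
  have "t2 = fern_list a (2 * (n div 2) + 1) w @ [z]" by (simp add: t2_def fern_list_def)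
  moreover have "length a \<le> 2 * (n div 2) + 1" "n \<le> 2 * (n div 2) + 1" by (simp_all add: n_def)
  ultimately have t2: "even_blocks t2 = even_fern a X \<union> {X..<X + z}"
    using even_blocks_fern_list_append[of "2 * (n div 2) + 1" a w z] ps X by simp
  have OX: "odd_sum a + even_sum a \<le> X" by (simp add: X_def)
  have e1: "even_sum t1 = odd_sum a"
    using card_even_blocks[of t1] card_fern(1)[OF OX] by (simp add: t1)
  have e2: "even_sum t2 = even_sum a + z"
  proof -
    have "even_fern a X \<subseteq> {X - (odd_sum a + even_sum a)..<X}" using fern_Un[OF OX] by blast
    then have "even_fern a X \<inter> {X..<X + z} = {}" by fastforce
    then have "card (even_fern a X \<union> {X..<X + z}) = even_sum a + z"
      using card_fern(2)[OF OX] by (simp add: card_Un_disjoint)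
    then show ?thesis using card_even_blocks[of t2] by (simp add: t2)
  qed
  have "1 \<le> L" using odd_sum_pos[OF assms(3,4)] by (simp add: L_def)
  note S = selberg_sum_closed_form[OF assms(2) this, of x m, folded u_def]
  have "real (num_tilings (R_region x y z a)) =
    dent_factor p (odd_sum a + m) * dent_weight p (odd_fern a X) *
    (dent_factor p (even_sum a + z + m) * dent_weight p (even_fern a X \<union> {X..<X + z})) *
    selberg_sum p (x + m) m L"
    using real_num_tilings_R_region_pos[OF assms(1-4), of x z] by (simp add: X_def L_def add.assoc)
  moreover have "dent_factor p (odd_sum a) \<noteq> 0" "dent_factor p (even_sum a + z) \<noteq> 0"
    using dent_factor_pos[of p "odd_sum a"] dent_factor_pos[of p "even_sum a + z"] by simp_all
  ultimately show ?thesis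
    unfolding S t1 t2 e1 e2 by (simp add: mult_ac)
qed

theorem theorem1p5:
  fixes x y z n s Ev Od :: nat and a :: "nat list"
  assumes "a \<noteq> []"
    and "\<forall>k\<in>set a. k > 0"
    and "y + 2 * odd_sum a \<ge> entry a 1 + 1"
    and "n = length a"
    and "s = part_sum a n"
    and "Ev = even_sum a"
    and "Od = odd_sum a"
  shows
    "(odd y \<longrightarrow>
       real (num_tilings (R_region x y z a)) =
         (\<Prod>i=1..(y - 1) div 2.
            pochhammer (real (2 * x + 2 * i)) (2 * s + 2 * y + 2 * z + 1 - 4 * i))
         * (1 / 2 ^ (y - 1))
         * (real (hyper (s + y + z - 1) * hyper2 y * hyper2 (2 * Ev + 2 * z + 1)
                  * hyper2 (2 * Od + 1) * hyper2 (2 * s + y + 2 * z))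
            / real (hyper (s + z) * hyper2 (2 * Ev + y + 2 * z) * hyper2 (2 * Od + y)
                    * hyper2 (2 * s + 2 * y + 2 * z - 1)))
         * real (Q_num ((x + (y - 1) div 2 + entry a (2 * ((n + 1) div 2)))
                        # map (entry a) (rev [1..<2 * ((n + 1) div 2)])))
         * real (Q_num ((x + (y - 1) div 2 + entry a (2 * (n div 2) + 1))
                        # map (entry a) (rev [1..<2 * (n div 2) + 1]) @ [z])))
    \<and>
     (even y \<longrightarrow>
       real (num_tilings (R_region x y z a)) =
         (\<Prod>i=1..y div 2.
            pochhammer (real (2 * x + 2 * i)) (2 * s + 2 * y + 2 * z + 1 - 4 * i))
         * (real (hyper (s + y + z) * hyper2 y * hyper2 (2 * Ev + 2 * z)
                  * hyper2 (2 * Od) * hyper2 (2 * s + y + 2 * z))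
            / real (hyper (s + z) * hyper2 (2 * Ev + y + 2 * z) * hyper2 (2 * Od + y)
                    * hyper2 (2 * s + 2 * y + 2 * z)))
         * real (K_num ((x + y div 2 + entry a (2 * ((n + 1) div 2)))
                        # map (entry a) (rev [1..<2 * ((n + 1) div 2)])))
         * real (K_num ((x + y div 2 + entry a (2 * (n div 2) + 1))
                        # map (entry a) (rev [1..<2 * (n div 2) + 1]) @ [z])))"
proof -
  have L: "s + z = odd_sum a + (even_sum a + z)" and s: "s = odd_sum a + even_sum a"
    using part_sum_length[of a] assms(4,5) by simp_all
  let ?L = "odd_sum a + (even_sum a + z)"
  let ?t1 = "\<lambda>w. (w + entry a (2 * ((n + 1) div 2))) # map (entry a) (rev [1..<2 * ((n + 1) div 2)])"
  let ?t2 = "\<lambda>w. (w + entry a (2 * (n div 2) + 1)) # map (entry a) (rev [1..<2 * (n div 2) + 1]) @ [z]"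
  let ?C = "\<lambda>p m u. dent_factor p (odd_sum a + m) * dent_factor p (even_sum a + z + m) /
       (dent_factor p (odd_sum a) * dent_factor p (even_sum a + z)) *
     ((dent_factor 0 u * 2 ^ (u * (u - 1)) * real (hyper u)) /
      (dent_factor p m * dent_factor p (?L + m) * 2 ^ (?L * (?L - 1)) * real (hyper ?L)))"
  show ?thesis
  proof (intro conjI impI)
    assume "odd y"
    define m where "m = (y - 1) div 2"
    have y: "y + 0 = 2 * m + 1" using \<open>odd y\<close> by (auto simp: m_def elim: oddE)
    \<comment> \<open>For either parity of \<open>y\<close> this is \<open>s + y + z - 1\<close>,
      the side of the triangle that completes the region without a fern; so both cases have the same
      Pochhammer lengths.\<close>
    define u where "u = ?L + 2 * m"
    have M: "real (num_tilings (R_region x y z a)) =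
        (\<Prod>i=1..m. pochhammer (real (2 * x + 2 * i)) (2 * u + 3 - 4 * i)) * ?C 0 m u *
        real (Q_num (?t1 (x + m))) * real (Q_num (?t2 (x + m)))"
      using real_num_tilings_R_region_product[OF y _ assms(1,2), of x z]
      unfolding Q_num_eq u_def assms(4) by (simp only: diff_zero zero_le)
    have idx: "2 * u + 3 - 4 * i = 2 * s + 2 * y + 2 * z + 1 - 4 * i" for i
      using y by (simp add: u_def s)
    have C: "?C 0 m u = (1 / 2 ^ (y - 1))
         * (real (hyper (s + y + z - 1) * hyper2 y * hyper2 (2 * Ev + 2 * z + 1)
                  * hyper2 (2 * Od + 1) * hyper2 (2 * s + y + 2 * z))
            / real (hyper (s + z) * hyper2 (2 * Ev + y + 2 * z) * hyper2 (2 * Od + y)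
                    * hyper2 (2 * s + 2 * y + 2 * z - 1)))"
    proof -
      have "y - 1 = 2 * m" "s + y + z - 1 = u" "hyper2 y = hyper2 (2 * m + 1)"
        "2 * Ev + 2 * z + 1 = 2 * (even_sum a + z) + 1" "2 * Od + 1 = 2 * odd_sum a + 1"
        "2 * s + y + 2 * z = 2 * (?L + m) + 1" "2 * Ev + y + 2 * z = 2 * (even_sum a + z + m) + 1"
        "2 * Od + y = 2 * (odd_sum a + m) + 1" "2 * s + 2 * y + 2 * z - 1 = 2 * u + 1" "hyper (s + z) = hyper ?L"
        using y by (simp_all add: u_def s assms(6,7) add.assoc)
      then show ?thesis
        using dent_factors_odd[of "odd_sum a" m "even_sum a + z", folded u_def] by (simp only: of_nat_mult)
    qed
    from M[unfolded idx C] show "real (num_tilings (R_region x y z a)) =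
         (\<Prod>i=1..(y - 1) div 2.
            pochhammer (real (2 * x + 2 * i)) (2 * s + 2 * y + 2 * z + 1 - 4 * i))
         * (1 / 2 ^ (y - 1))
         * (real (hyper (s + y + z - 1) * hyper2 y * hyper2 (2 * Ev + 2 * z + 1)
                  * hyper2 (2 * Od + 1) * hyper2 (2 * s + y + 2 * z))
            / real (hyper (s + z) * hyper2 (2 * Ev + y + 2 * z) * hyper2 (2 * Od + y)
                    * hyper2 (2 * s + 2 * y + 2 * z - 1)))
         * real (Q_num ((x + (y - 1) div 2 + entry a (2 * ((n + 1) div 2)))
                        # map (entry a) (rev [1..<2 * ((n + 1) div 2)])))
         * real (Q_num ((x + (y - 1) div 2 + entry a (2 * (n div 2) + 1))
                        # map (entry a) (rev [1..<2 * (n div 2) + 1]) @ [z]))"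
      unfolding m_def[symmetric] by (simp only: mult.assoc)
  next
    assume "even y"
    define m where "m = y div 2"
    have y: "y + 1 = 2 * m + 1" using \<open>even y\<close> by (simp add: m_def)
    have L1: "1 \<le> ?L" using odd_sum_pos[OF assms(1,2)] by simp
    define u where "u = ?L - 1 + 2 * m"
    have M: "real (num_tilings (R_region x y z a)) =
        (\<Prod>i=1..m. pochhammer (real (2 * x + 2 * i)) (2 * u + 3 - 4 * i)) * ?C 1 m u *
        real (K_num (?t1 (x + m))) * real (K_num (?t2 (x + m)))"
      using real_num_tilings_R_region_product[OF y _ assms(1,2), of x z]
      unfolding K_num_eq u_def assms(4) by (simp only: order_refl)
    have idx: "2 * u + 3 - 4 * i = 2 * s + 2 * y + 2 * z + 1 - 4 * i" for i
      using y L1 by (simp add: u_def s)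
    have C: "?C 1 m u = real (hyper (s + y + z) * hyper2 y * hyper2 (2 * Ev + 2 * z)
                  * hyper2 (2 * Od) * hyper2 (2 * s + y + 2 * z))
            / real (hyper (s + z) * hyper2 (2 * Ev + y + 2 * z) * hyper2 (2 * Od + y)
                    * hyper2 (2 * s + 2 * y + 2 * z))"
    proof -
      have "s + y + z = Suc u" "hyper2 y = hyper2 (2 * m)"
        "2 * Ev + 2 * z = 2 * (even_sum a + z)" "2 * Od = 2 * odd_sum a"
        "2 * s + y + 2 * z = 2 * (?L + m)" "2 * Ev + y + 2 * z = 2 * (even_sum a + z + m)"
        "2 * Od + y = 2 * (odd_sum a + m)" "2 * s + 2 * y + 2 * z = 2 * Suc u" "hyper (s + z) = hyper ?L"
        using y L1 by (simp_all add: u_def s assms(6,7) add.assoc)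
      then show ?thesis
        using dent_factors_even[OF L1, of m, folded u_def] by (simp only: of_nat_mult)
    qed
    from M[unfolded idx C] show "real (num_tilings (R_region x y z a)) =
         (\<Prod>i=1..y div 2.
            pochhammer (real (2 * x + 2 * i)) (2 * s + 2 * y + 2 * z + 1 - 4 * i))
         * (real (hyper (s + y + z) * hyper2 y * hyper2 (2 * Ev + 2 * z)
                  * hyper2 (2 * Od) * hyper2 (2 * s + y + 2 * z))
            / real (hyper (s + z) * hyper2 (2 * Ev + y + 2 * z) * hyper2 (2 * Od + y)
                    * hyper2 (2 * s + 2 * y + 2 * z)))
         * real (K_num ((x + y div 2 + entry a (2 * ((n + 1) div 2)))
                        # map (entry a) (rev [1..<2 * ((n + 1) div 2)])))
         * real (K_num ((x + y div 2 + entry a (2 * (n div 2) + 1))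
                        # map (entry a) (rev [1..<2 * (n div 2) + 1]) @ [z]))"
      unfolding m_def[symmetric] by (simp only: mult.assoc)
  qed
qed

end
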